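(* Let $M/F$ be a Galois field extension of degree $n$ with non-trivial solvable Galois group $G=\mathrm{Gal}(M/F)$, and let $A$ be a $G$-crossed product algebra of degree $n$ over $F$ with maximal subfield $M$. Let $$\{1\}=G_0<G_1<\dots<G_k=G$$ be a chain of subgroups such that $G_j$ is normal in $G_{j+1}$ and $G_{j+1}/G_j$ is cyclic of prime order $q_j$ for all $j\in\{0,\dots,k-1\}$, and let $Z_i=\mathrm{Fix}(G_i)$. Then there exists a chain of subalgebras $$M=A_0\subset A_1\subset\dots\subset A_k=M(G)=A$$ of $A$ which are generalised cyclic algebras $$A_{i+1}\cong A_i[t_i;\tau_i]/A_i[t_i;\tau_i](t_i^{q_i}-c_i)$$ of degree $\prod_{l=0}^{i}q_l$ over $Z_{i+1}=\mathrm{Fix}(G_{i+1})$, for all $i\in\{0,\dots,k-1\}$, such that (i) $q_i$ is a prime, (ii) $\tau_i$ is an $F$-automorphism of $A_i$ of inner order $q_i$ which restricts (on $M$) to an automorphism $\sigma_{i+1}\in G$, (iii) $c_i\in\mathrm{Fix}(\tau_i)^\times$, and (iv) $Z_{i-1}/Z_i$ has prime degree $q_{i-1}$ for all $i\in\{1,\dots,k\}$, and $A_i$ is the centralizer of $\mathrm{Fix}(G_i)$ in $A$ for all $i\in\{0,\dots,k\}$.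
   Context: For a subgroup $H\le G$, $\mathrm{Fix}(H)$ is its fixed field in $M$, and $M(H)=\mathrm{Cent}_A(\mathrm{Fix}(H))$ is the centralizer of $\mathrm{Fix}(H)$ in $A$. A central simple algebra has degree $n$ over $F$ if it has dimension $n^2$. A $G$-crossed product algebra over $F$ is a central simple $F$-algebra of degree $n$ containing a field extension $M/F$ which is Galois of degree $n$ with Galois group $G$. For a ring $B$ and an automorphism $\tau$ of $B$, $B[t;\tau]$ is the twisted polynomial ring with $tb=\tau(b)t$. For monic $f\in B[t;\tau]$ of degree $q$, $B[t;\tau]/B[t;\tau]f$ denotes the set of polynomials of degree $<q$ with multiplication $g\circ h=$ the remainder of $gh$ after right division by $f$ (the unique $r$ with $\deg r<q$ and $gh=q_1f+r$); $f$ is right invariant if $B[t;\tau]f$ is a two-sided ideal, in which case this is the associative quotient algebra. $\mathrm{Fix}(\tau)=\{b\in B:\tau(b)=b\}$, with $\mathrm{Fix}(\tau)^\times$ its invertible elements. The inner order of an automorphism $\tau$ is the smallest positive integer $e$ such that $\tau^e$ is an inner automorphism $x\mapsto uxu^{-1}$ ($u$ a unit). An $F$-automorphism is a ring automorphism fixing $F$ pointwise. Generalised cyclic algebra: for a finite-dimensional central simple algebra $B$ over a field $C$ and $\tau\in\mathrm{Aut}(B)$ such that $\tau|_C$ has finite order $q$, $(B,\tau,c)$ is the associative algebra $B[t;\tau]/B[t;\tau](t^q-c)$ where $c\in\mathrm{Fix}(\tau)^\times$ and $t^q-c$ is right invariant; it is central simple over $C\cap\mathrm{Fix}(\tau)$.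 *)

theory Defs
  imports "HOL-Algebra.Algebra"
begin

text \<open>
  Subfields and subalgebras of a ring \<open>R\<close> are subsets of its carrier; such a subset \<open>S\<close>, viewed as
  a ring in its own right, is \<open>R\<lparr>carrier := S\<rparr>\<close>. A \<open>K\<close>-algebra is a ring with a distinguished
  subfield \<open>K\<close> contained in its centre.
\<close>

section \<open>Galois extensions and fixed fields\<close>

text \<open>As in \<^term>\<open>BijGroup\<close>, automorphisms are \<^term>\<open>extensional\<close>, so that equality of
  automorphisms is equality of functions on \<open>M\<close>.\<close>

definition galois_group :: "('a, 'b) ring_scheme \<Rightarrow> 'a set \<Rightarrow> 'a set \<Rightarrow> ('a \<Rightarrow> 'a) monoid" where
  "galois_group R F M = BijGroup M
     \<lparr>carrier := {\<sigma> \<in> Bij M. \<sigma> \<in> ring_hom (R\<lparr>carrier := M\<rparr>) (R\<lparr>carrier := M\<rparr>)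
                          \<and> (\<forall>x\<in>F. \<sigma> x = x)}\<rparr>"

definition fixed_field :: "'a set \<Rightarrow> ('a \<Rightarrow> 'a) set \<Rightarrow> 'a set" where
  "fixed_field M H = {x \<in> M. \<forall>\<sigma>\<in>H. \<sigma> x = x}"

text \<open>Finite Galois extensions in the sense of Artin: \<open>F\<close> is the fixed field of \<open>Gal(M/F)\<close>.\<close>

definition galois_extension :: "('a, 'b) ring_scheme \<Rightarrow> 'a set \<Rightarrow> 'a set \<Rightarrow> nat \<Rightarrow> bool" where
  "galois_extension R F M n \<longleftrightarrow>
     subfield F R \<and> subfield M R \<and> F \<subseteq> M \<and> ring.dimension R n F M
     \<and> fixed_field M (carrier (galois_group R F M)) = F"


section \<open>Central simple algebras and crossed products\<close>

definition centralizer :: "('a, 'b) ring_scheme \<Rightarrow> 'a set \<Rightarrow> 'a set" where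
  "centralizer R S = {x \<in> carrier R. \<forall>s\<in>S. x \<otimes>\<^bsub>R\<^esub> s = s \<otimes>\<^bsub>R\<^esub> x}"

definition central_simple_algebra :: "('a, 'b) ring_scheme \<Rightarrow> 'a set \<Rightarrow> bool" where
  "central_simple_algebra R K \<longleftrightarrow>
     ring R \<and> subfield K R \<and> (\<exists>d. ring.dimension R d K (carrier R))
     \<and> centralizer R (carrier R) = K
     \<and> (\<forall>I. ideal I R \<longrightarrow> I = {\<zero>\<^bsub>R\<^esub>} \<or> I = carrier R)"

definition csa_degree :: "('a, 'b) ring_scheme \<Rightarrow> 'a set \<Rightarrow> nat \<Rightarrow> bool" where
  "csa_degree R K n \<longleftrightarrow> central_simple_algebra R K \<and> ring.dimension R (n\<^sup>2) K (carrier R)"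

definition maximal_subfield :: "('a, 'b) ring_scheme \<Rightarrow> 'a set \<Rightarrow> bool" where
  "maximal_subfield R M \<longleftrightarrow> subfield M R \<and> (\<forall>L. subfield L R \<and> M \<subseteq> L \<longrightarrow> L = M)"

definition crossed_product_algebra ::
    "('a, 'b) ring_scheme \<Rightarrow> 'a set \<Rightarrow> nat \<Rightarrow> 'a set \<Rightarrow> ('a \<Rightarrow> 'a) monoid \<Rightarrow> bool" where
  "crossed_product_algebra R F n M G \<longleftrightarrow>
     csa_degree R F n \<and> galois_extension R F M n \<and> G = galois_group R F M"


section \<open>Automorphisms\<close>

definition fixed_ring :: "('a, 'b) ring_scheme \<Rightarrow> ('a \<Rightarrow> 'a) \<Rightarrow> 'a set" where
  "fixed_ring B \<tau> = {b \<in> carrier B. \<tau> b = b}"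

definition fixed_units :: "('a, 'b) ring_scheme \<Rightarrow> ('a \<Rightarrow> 'a) \<Rightarrow> 'a set" where
  "fixed_units B \<tau> = Units (B\<lparr>carrier := fixed_ring B \<tau>\<rparr>)"

definition inner_automorphism :: "('a, 'b) ring_scheme \<Rightarrow> ('a \<Rightarrow> 'a) \<Rightarrow> bool" where
  "inner_automorphism B \<phi> \<longleftrightarrow>
     (\<exists>u\<in>Units B. \<forall>x\<in>carrier B. \<phi> x = u \<otimes>\<^bsub>B\<^esub> x \<otimes>\<^bsub>B\<^esub> inv\<^bsub>B\<^esub> u)"

definition has_inner_order :: "('a, 'b) ring_scheme \<Rightarrow> ('a \<Rightarrow> 'a) \<Rightarrow> nat \<Rightarrow> bool" where
  "has_inner_order B \<tau> e \<longleftrightarrow>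
     0 < e \<and> inner_automorphism B (\<tau> ^^ e)
     \<and> (\<forall>d. 0 < d \<and> d < e \<longrightarrow> \<not> inner_automorphism B (\<tau> ^^ d))"

definition has_order_on :: "'a set \<Rightarrow> ('a \<Rightarrow> 'a) \<Rightarrow> nat \<Rightarrow> bool" where
  "has_order_on C \<tau> q \<longleftrightarrow>
     0 < q \<and> (\<forall>x\<in>C. (\<tau> ^^ q) x = x)
     \<and> (\<forall>d. 0 < d \<and> d < q \<longrightarrow> (\<exists>x\<in>C. (\<tau> ^^ d) x \<noteq> x))"


section \<open>Twisted polynomials and generalised cyclic algebras\<close>

text \<open>The polynomial \<open>p\<close> stands for \<open>\<Sum>i. p i * t ^ i\<close>, coefficients on the left; the product is
  forced by \<open>t b = \<tau>(b) t\<close>.\<close>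

definition twisted_poly :: "('a, 'b) ring_scheme \<Rightarrow> ('a \<Rightarrow> 'a) \<Rightarrow> (nat \<Rightarrow> 'a) ring" where
  "twisted_poly B \<tau> =
     \<lparr>carrier = up B,
      monoid.mult = (\<lambda>p q n. \<Oplus>\<^bsub>B\<^esub>i\<in>{..n}. p i \<otimes>\<^bsub>B\<^esub> (\<tau> ^^ i) (q (n - i))),
      one = (\<lambda>i. if i = 0 then \<one>\<^bsub>B\<^esub> else \<zero>\<^bsub>B\<^esub>),
      ring.zero = (\<lambda>i. \<zero>\<^bsub>B\<^esub>),
      add = (\<lambda>p q i. p i \<oplus>\<^bsub>B\<^esub> q i)\<rparr>"

definition monomial :: "('a, 'b) ring_scheme \<Rightarrow> 'a \<Rightarrow> nat \<Rightarrow> nat \<Rightarrow> 'a" where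
  "monomial B a k = (\<lambda>i. if i = k then a else \<zero>\<^bsub>B\<^esub>)"

definition polys_below :: "('a, 'b) ring_scheme \<Rightarrow> nat \<Rightarrow> (nat \<Rightarrow> 'a) set" where
  "polys_below B q = {p \<in> up B. \<forall>i\<ge>q. p i = \<zero>\<^bsub>B\<^esub>}"

text \<open>Meaningful for \<open>f\<close> monic of degree \<open>q\<close>, where the remainder exists and is unique.\<close>

definition right_remainder ::
    "('a, 'b) ring_scheme \<Rightarrow> ('a \<Rightarrow> 'a) \<Rightarrow> (nat \<Rightarrow> 'a) \<Rightarrow> nat \<Rightarrow> (nat \<Rightarrow> 'a) \<Rightarrow> (nat \<Rightarrow> 'a)" where
  "right_remainder B \<tau> f q g =
     (THE r. r \<in> polys_below B q
           \<and> (\<exists>s \<in> carrier (twisted_poly B \<tau>).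
                g = s \<otimes>\<^bsub>twisted_poly B \<tau>\<^esub> f \<oplus>\<^bsub>twisted_poly B \<tau>\<^esub> r))"

definition twisted_quotient ::
    "('a, 'b) ring_scheme \<Rightarrow> ('a \<Rightarrow> 'a) \<Rightarrow> (nat \<Rightarrow> 'a) \<Rightarrow> nat \<Rightarrow> (nat \<Rightarrow> 'a) ring" where
  "twisted_quotient B \<tau> f q =
     (twisted_poly B \<tau>)
       \<lparr>carrier := polys_below B q,
        monoid.mult := (\<lambda>g h. right_remainder B \<tau> f q (g \<otimes>\<^bsub>twisted_poly B \<tau>\<^esub> h))\<rparr>"

text \<open>Over a noncommutative ring, \<^term>\<open>PIdl\<^bsub>R\<^esub> f\<close> is the left ideal \<open>R f\<close>.\<close>

definition right_invariant :: "('a, 'b) ring_scheme \<Rightarrow> ('a \<Rightarrow> 'a) \<Rightarrow> (nat \<Rightarrow> 'a) \<Rightarrow> bool" where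
  "right_invariant B \<tau> f \<longleftrightarrow> ideal (PIdl\<^bsub>twisted_poly B \<tau>\<^esub> f) (twisted_poly B \<tau>)"

definition cyclic_poly ::
    "('a, 'b) ring_scheme \<Rightarrow> ('a \<Rightarrow> 'a) \<Rightarrow> nat \<Rightarrow> 'a \<Rightarrow> nat \<Rightarrow> 'a" where
  "cyclic_poly B \<tau> q c = monomial B \<one>\<^bsub>B\<^esub> q \<ominus>\<^bsub>twisted_poly B \<tau>\<^esub> monomial B c 0"

text \<open>The requirements on the data for \<open>(B, \<tau>, c)\<close> to be a generalised cyclic algebra,
  \<open>C\<close> being the centre of \<open>B\<close>.\<close>

definition generalised_cyclic_data ::
    "('a, 'b) ring_scheme \<Rightarrow> 'a set \<Rightarrow> ('a \<Rightarrow> 'a) \<Rightarrow> nat \<Rightarrow> 'a \<Rightarrow> bool" where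
  "generalised_cyclic_data B C \<tau> q c \<longleftrightarrow>
     central_simple_algebra B C \<and> \<tau> \<in> ring_iso B B \<and> has_order_on C \<tau> q
     \<and> c \<in> fixed_units B \<tau> \<and> right_invariant B \<tau> (cyclic_poly B \<tau> q c)"

definition generalised_cyclic_algebra ::
    "('a, 'b) ring_scheme \<Rightarrow> ('a \<Rightarrow> 'a) \<Rightarrow> nat \<Rightarrow> 'a \<Rightarrow> (nat \<Rightarrow> 'a) ring" where
  "generalised_cyclic_algebra B \<tau> q c = twisted_quotient B \<tau> (cyclic_poly B \<tau> q c) q"

text \<open>\<open>E \<cong> (B, \<tau>, c)\<close> as algebras over \<open>Z = C \<inter> Fix(\<tau>)\<close>; the image of \<open>z \<in> Z\<close> in \<open>(B, \<tau>, c)\<close> is the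
  constant polynomial \<open>z\<close>.\<close>

definition iso_generalised_cyclic ::
    "('a, 'b) ring_scheme \<Rightarrow> 'a set \<Rightarrow> ('a, 'd) ring_scheme \<Rightarrow> 'a set
       \<Rightarrow> ('a \<Rightarrow> 'a) \<Rightarrow> nat \<Rightarrow> 'a \<Rightarrow> bool" where
  "iso_generalised_cyclic E Z B C \<tau> q c \<longleftrightarrow>
     generalised_cyclic_data B C \<tau> q c \<and> Z = C \<inter> fixed_ring B \<tau>
     \<and> (\<exists>h \<in> ring_iso E (generalised_cyclic_algebra B \<tau> q c). \<forall>z\<in>Z. h z = monomial B z 0)"

end

theory Submission
  imports Defs
begin

text \<open>
  The proof describes \<open>A\<close> as a classical crossed product and reads the chain off from it.

  Choose a basis \<open>e\<close> of \<open>M\<close> over \<open>F\<close> and elements \<open>w i\<close> of \<open>M\<close> such that \<open>\<Sum>i. w i * g (e i)\<close> is one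
  for \<open>g = 1\<close> and zero for every other \<open>g\<close> in the Galois group (\<open>coordinates_exist\<close>). Such coordinates
  exist for every subgroup \<open>H\<close> over its fixed field \<open>Fix H\<close>. They say that two matrices are inverse to
  each other, which gives Artin's theorem \<open>[M : Fix H] = |H|\<close> and with it the Galois correspondence
  (\<open>dimension_over_fixed\<close>, \<open>fixing_imp_mem\<close>).

  On \<open>A\<close> the map \<open>a \<mapsto> \<Sum>i. g (w i) * a * e i\<close> projects onto the elements \<open>a\<close> of degree \<open>g\<close>, that is,
  with \<open>a * x = g x * a\<close> for all \<open>x \<in> M\<close> (\<open>proj_in_component\<close>). In a central simple algebra a map
  \<open>x \<mapsto> \<Sum>i. p i * x * b i\<close> with independent \<open>b\<close> vanishes only if all \<open>p i\<close> do
  (\<open>two_sided_relation_trivial\<close>), so in every degree \<open>g\<close> there is some \<open>u g \<noteq> 0\<close>. These elements are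
  independent over \<open>M\<close>, and there are \<open>n\<close> of them; counting dimensions, \<open>A\<close> is the direct sum of the
  lines \<open>M * u g\<close>. The same vanishing argument shows that \<open>u g\<close> is a unit (\<open>u_Units\<close>). This is the
  instance of the Skolem--Noether and double centralizer theorems that the theorem rests on.

  An element of degree \<open>g\<close> commutes with \<open>Fix H\<close> only if \<open>g \<in> H\<close>. Hence the centralizer \<open>C H\<close> of \<open>Fix H\<close>
  is the sum of the lines \<open>M * u h\<close> with \<open>h \<in> H\<close>. It is central simple over \<open>Fix H\<close>, of dimension
  \<open>|H|\<^sup>2\<close> (\<open>csa_C\<close>). The algebras \<open>A i\<close> are these centralizers for the groups of the chain.

  For consecutive groups \<open>H\<close> and \<open>H'\<close> of index \<open>q\<close> take \<open>g \<in> H' - H\<close> and \<open>v = u g\<close>. The cosets of \<open>H\<close>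
  in \<open>H'\<close> are represented by \<open>g ^ j\<close> with \<open>j < q\<close>, so every element of \<open>C H'\<close> is uniquely
  \<open>\<Sum>j<q. s j * v ^ j\<close> with \<open>s j \<in> C H\<close> (\<open>free_v\<close>, \<open>span_v\<close>). Conjugation by \<open>v\<close> is an automorphism \<open>\<tau>\<close>
  of \<open>C H\<close> that restricts to \<open>g\<close> on \<open>M\<close>, and \<open>v ^ q \<in> C H\<close>. Therefore \<open>t \<mapsto> v\<close> defines a homomorphism
  of \<open>C H[t; \<tau>]\<close> onto \<open>C H'\<close> whose kernel is generated by \<open>t ^ q - v ^ q\<close>, and \<open>C H'\<close> is the generalised
  cyclic algebra of \<open>\<tau>\<close> and \<open>v ^ q\<close> (\<open>iso_generalised_cyclic_algebra\<close>, \<open>step_iso\<close>). Since \<open>g ^ d\<close>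
  acts nontrivially on \<open>Fix H\<close>, the centre of \<open>C H\<close>, for \<open>0 < d < q\<close>, the inner order of \<open>\<tau>\<close> is \<open>q\<close>.
\<close>

section \<open>Finite sums in abelian groups\<close>

lemma (in abelian_monoid) finsum_swap:
  assumes "finite I" "finite J" "\<And>i j. i \<in> I \<Longrightarrow> j \<in> J \<Longrightarrow> f i j \<in> carrier G"
  shows "(\<Oplus>i\<in>I. \<Oplus>j\<in>J. f i j) = (\<Oplus>j\<in>J. \<Oplus>i\<in>I. f i j)"
  using assms
proof (induction I)
  case empty
  then show ?case by simp
next
  case (insert i I)
  have "(\<Oplus>j\<in>J. \<Oplus>i'\<in>insert i I. f i' j) = (\<Oplus>j\<in>J. f i j \<oplus> (\<Oplus>i'\<in>I. f i' j))"
    using insert by (intro add.finprod_cong') (auto simp: Pi_def)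
  also have "\<dots> = (\<Oplus>j\<in>J. f i j) \<oplus> (\<Oplus>j\<in>J. \<Oplus>i'\<in>I. f i' j)"
    using insert by (intro finsum_addf) (auto simp: Pi_def)
  also have "\<dots> = (\<Oplus>i'\<in>insert i I. \<Oplus>j\<in>J. f i' j)"
    using insert by (simp add: Pi_def)
  finally show ?case by simp
qed

text \<open>A fold over \<open>I\<close> only looks at the values on \<open>I\<close>, so the sums agree even for values outside the
  carrier.\<close>

lemma (in abelian_monoid) finsum_eqI:
  assumes "\<And>i. i \<in> I \<Longrightarrow> f i = g i"
  shows "(\<Oplus>i\<in>I. f i) = (\<Oplus>i\<in>I. g i)"
proof -
  have "(J, x) \<in> foldSetD D g' e"
    if "(J, x) \<in> foldSetD D f' e" "\<And>i. i \<in> J \<Longrightarrow> f' i = g' i"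
    for J x D e and f' g' :: "'c \<Rightarrow> 'a \<Rightarrow> 'a"
    using that
  proof (induction rule: foldSetD.induct)
    case (insertI i J y)
    then show ?case using foldSetD.insertI[of i J g' y D e] by auto
  qed (rule foldSetD.emptyI)
  then have "(I, x) \<in> foldSetD (carrier G) (\<lambda>i. (\<oplus>) (f i)) \<zero> \<longleftrightarrow> (I, x) \<in> foldSetD (carrier G) (\<lambda>i. (\<oplus>) (g i)) \<zero>"
    for x using assms by (metis (mono_tags, lifting))
  then show ?thesis
    unfolding finsum_def finprod_def foldD_def by (simp add: comp_def)
qed

text \<open>The triangle \<open>i + j \<le> n\<close> is summed by diagonals and by rows. Associativity of twisted
  multiplication and multiplicativity of evaluation are both instances.\<close>

lemma (in abelian_monoid) finsum_triangle:
  fixes n :: nat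
  assumes "\<And>i j. i + j \<le> n \<Longrightarrow> F i j \<in> carrier G"
  shows "(\<Oplus>k\<in>{..n}. \<Oplus>i\<in>{..k}. F i (k - i)) = (\<Oplus>i\<in>{..n}. \<Oplus>j\<in>{..n - i}. F i j)"
  using assms
proof (induction n)
  case 0
  then show ?case by simp
next
  case (Suc n)
  have row: "(\<Oplus>j\<in>{..Suc n - i}. F i j) = (\<Oplus>j\<in>{..n - i}. F i j) \<oplus> F i (Suc n - i)" if "i \<le> n" for i
    using that Suc.prems by (simp add: Suc_diff_le Pi_def a_comm)
  have "(\<Oplus>i\<in>{..Suc n}. \<Oplus>j\<in>{..Suc n - i}. F i j)
      = F (Suc n) 0 \<oplus> (\<Oplus>i\<in>{..n}. \<Oplus>j\<in>{..Suc n - i}. F i j)"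
    using Suc.prems by (subst finsum_Suc) (auto simp: Pi_def)
  also have "(\<Oplus>i\<in>{..n}. \<Oplus>j\<in>{..Suc n - i}. F i j)
      = (\<Oplus>i\<in>{..n}. (\<Oplus>j\<in>{..n - i}. F i j) \<oplus> F i (Suc n - i))"
    using Suc.prems row by (intro add.finprod_cong') (auto simp: Pi_def)
  also have "\<dots> = (\<Oplus>i\<in>{..n}. \<Oplus>j\<in>{..n - i}. F i j) \<oplus> (\<Oplus>i\<in>{..n}. F i (Suc n - i))"
    using Suc.prems by (intro finsum_addf) (auto simp: Pi_def)
  also have "(\<Oplus>i\<in>{..n}. \<Oplus>j\<in>{..n - i}. F i j) = (\<Oplus>k\<in>{..n}. \<Oplus>i\<in>{..k}. F i (k - i))"
    using Suc.IH Suc.prems by simp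
  also have "F (Suc n) 0 \<oplus> ((\<Oplus>k\<in>{..n}. \<Oplus>i\<in>{..k}. F i (k - i)) \<oplus> (\<Oplus>i\<in>{..n}. F i (Suc n - i)))
      = (\<Oplus>i\<in>{..Suc n}. F i (Suc n - i)) \<oplus> (\<Oplus>k\<in>{..n}. \<Oplus>i\<in>{..k}. F i (k - i))"
    using Suc.prems by (simp add: Pi_def a_ac)
  also have "\<dots> = (\<Oplus>k\<in>{..Suc n}. \<Oplus>i\<in>{..k}. F i (k - i))"
    using Suc.prems by (simp add: Pi_def)
  finally show ?case by simp
qed

text \<open>The map \<open>g\<close> is additive on a submonoid \<open>S\<close> only and may lead into another structure: field
  automorphisms are defined on \<open>M\<close> alone, and with the identity map the lemma compares sums in a ring
  and in a subring.\<close>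

lemma (in abelian_monoid) additive_finsum:
  assumes H: "abelian_monoid H" and "finite I" "f \<in> I \<rightarrow> S" "S \<subseteq> carrier G" "\<zero> \<in> S"
    and "\<And>x y. x \<in> S \<Longrightarrow> y \<in> S \<Longrightarrow> x \<oplus> y \<in> S"
    and "g \<in> S \<rightarrow> carrier H" "g \<zero> = \<zero>\<^bsub>H\<^esub>"
    and "\<And>x y. x \<in> S \<Longrightarrow> y \<in> S \<Longrightarrow> g (x \<oplus> y) = g x \<oplus>\<^bsub>H\<^esub> g y"
  shows "g (\<Oplus>i\<in>I. f i) = (\<Oplus>\<^bsub>H\<^esub>i\<in>I. g (f i)) \<and> (\<Oplus>i\<in>I. f i) \<in> S"
  using assms(2-9)
proof (induction I)
  case empty
  then show ?case by (simp add: abelian_monoid.finsum_empty[OF H])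
next
  case (insert i I)
  have fi: "f i \<in> S" and fI: "f \<in> I \<rightarrow> S" using insert.prems(1) by auto
  have IH: "g (\<Oplus>i\<in>I. f i) = (\<Oplus>\<^bsub>H\<^esub>i\<in>I. g (f i))" "(\<Oplus>i\<in>I. f i) \<in> S"
    using insert.IH[OF fI insert.prems(2-)] by auto
  have "(\<Oplus>i\<in>insert i I. f i) = f i \<oplus> (\<Oplus>i\<in>I. f i)"
    using insert.hyps fi fI insert.prems(2) by (intro finsum_insert) auto
  moreover have "(\<Oplus>\<^bsub>H\<^esub>j\<in>insert i I. g (f j)) = g (f i) \<oplus>\<^bsub>H\<^esub> (\<Oplus>\<^bsub>H\<^esub>j\<in>I. g (f j))"
    using insert.hyps fi fI insert.prems(5) by (intro abelian_monoid.finsum_insert[OF H]) auto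
  ultimately show ?case using IH fi insert.prems by simp
qed

lemma (in ring) finsum_mem_subring:
  assumes "subring S R" "finite I" "f \<in> I \<rightarrow> S"
  shows "finsum R f I \<in> S"
  using additive_finsum[OF abelian_monoid_axioms assms(2,3) subringE(1,2,7)[OF assms(1)], of "\<lambda>x. x"]
    subringE(1)[OF assms(1)] by auto

lemma (in ring) finsum_subring:
  assumes "subring S R" "finite I" "f \<in> I \<rightarrow> S"
  shows "finsum (R\<lparr>carrier := S\<rparr>) f I = finsum R f I"
proof -
  have "abelian_monoid (R\<lparr>carrier := S\<rparr>)"
    using subring_is_ring[OF assms(1)] by (simp add: ring_def abelian_group_def)
  from additive_finsum[OF this assms(2,3) subringE(1,2,7)[OF assms(1)], of "\<lambda>x. x"]
  show ?thesis by simp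
qed

lemma (in ring) finsum_delta:
  assumes "finite I" "j \<in> I" "f \<in> I \<rightarrow> carrier R" "\<And>i. i \<in> I \<Longrightarrow> i \<noteq> j \<Longrightarrow> f i = \<zero>"
  shows "(\<Oplus>i\<in>I. f i) = f j"
proof -
  have "(\<Oplus>i\<in>I. f i) = (\<Oplus>i\<in>I. if i = j then f j else \<zero>)"
    using assms by (intro finsum_cong') auto
  also have "\<dots> = (\<Oplus>i\<in>I. if j = i then f j else \<zero>)"
    using assms by (intro finsum_cong') auto
  also have "\<dots> = f j" using assms finsum_singleton[of j I "\<lambda>_. f j"] by auto
  finally show ?thesis .
qed

lemma (in ring) finsum_neg:
  assumes "finite I" "f \<in> I \<rightarrow> carrier R"
  shows "\<ominus> (\<Oplus>i\<in>I. f i) = (\<Oplus>i\<in>I. \<ominus> f i)"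
  using additive_finsum[OF abelian_monoid_axioms assms(1,2), of "\<lambda>x. \<ominus> x"] by (simp add: minus_add)

lemma (in ring) finsum_diff:
  assumes "finite I" "f \<in> I \<rightarrow> carrier R" "g \<in> I \<rightarrow> carrier R"
  shows "(\<Oplus>i\<in>I. f i \<ominus> g i) = (\<Oplus>i\<in>I. f i) \<ominus> (\<Oplus>i\<in>I. g i)"
  using assms unfolding a_minus_def
  by (subst finsum_addf) (auto simp: finsum_neg)

section \<open>Bases indexed by finite sets\<close>

text \<open>The coefficients \<open>K\<close> need not form a field: the powers of a single element will be a free family
  over a noncommutative subring.\<close>

definition (in ring) span_family :: "'a set \<Rightarrow> 'i set \<Rightarrow> ('i \<Rightarrow> 'a) \<Rightarrow> 'a set" where
  "span_family K I b = {\<Oplus>i\<in>I. c i \<otimes> b i | c. c \<in> I \<rightarrow> K}"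

definition (in ring) free_family :: "'a set \<Rightarrow> 'i set \<Rightarrow> ('i \<Rightarrow> 'a) \<Rightarrow> bool" where
  "free_family K I b \<longleftrightarrow> (\<forall>c\<in>I \<rightarrow> K. (\<Oplus>i\<in>I. c i \<otimes> b i) = \<zero> \<longrightarrow> (\<forall>i\<in>I. c i = \<zero>))"

lemma (in ring) span_family_insert:
  assumes K: "subring K R" and I: "finite I" "i \<notin> I" "b \<in> insert i I \<rightarrow> carrier R"
  shows "span_family K (insert i I) b = line_extension K (b i) (span_family K I b)"
proof -
  note Ksub = subringE(1)[OF K]
  have sum: "(\<Oplus>j\<in>insert i I. c j \<otimes> b j) = c i \<otimes> b i \<oplus> (\<Oplus>j\<in>I. c j \<otimes> b j)"
    if "c \<in> insert i I \<rightarrow> K" for c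
    using that I Ksub by (intro finsum_insert) (auto simp: Pi_def)
  show ?thesis
  proof (intro equalityI subsetI)
    fix x assume "x \<in> span_family K (insert i I) b"
    then obtain c where "c \<in> insert i I \<rightarrow> K" "x = (\<Oplus>j\<in>insert i I. c j \<otimes> b j)"
      unfolding span_family_def by blast
    then show "x \<in> line_extension K (b i) (span_family K I b)"
      unfolding line_extension_mem_iff span_family_def using sum[of c] by auto
  next
    fix x assume "x \<in> line_extension K (b i) (span_family K I b)"
    then obtain k c where kc: "k \<in> K" "c \<in> I \<rightarrow> K" "x = k \<otimes> b i \<oplus> (\<Oplus>j\<in>I. c j \<otimes> b j)"
      unfolding line_extension_mem_iff span_family_def by blast
    have "(\<Oplus>j\<in>I. (c(i := k)) j \<otimes> b j) = (\<Oplus>j\<in>I. c j \<otimes> b j)"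
      using kc I Ksub by (intro finsum_cong') (auto simp: Pi_def)
    then have "x = (\<Oplus>j\<in>insert i I. (c(i := k)) j \<otimes> b j)"
      using kc sum[of "c(i := k)"] by (auto simp: Pi_def)
    then show "x \<in> span_family K (insert i I) b"
      unfolding span_family_def using kc by (intro CollectI exI[of _ "c(i := k)"]) auto
  qed
qed

lemma (in ring) span_family_empty [simp]: "span_family K {} b = {\<zero>}"
  unfolding span_family_def by auto

text \<open>The span is built up by one index at a time, which either leaves it unchanged or is a line
  extension.\<close>

lemma (in ring) finite_dimension_span_family:
  assumes K: "subfield K R" and "finite I" "b \<in> I \<rightarrow> carrier R"
  shows "\<exists>d. dimension d K (span_family K I b)"
  using assms(2,3)
proof (induction I)
  case empty
  then show ?case by auto
next
  case (insert i I)
  then obtain d where d: "dimension d K (span_family K I b)" by auto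
  have eq: "span_family K (insert i I) b = line_extension K (b i) (span_family K I b)"
    using insert by (intro span_family_insert[OF subfieldE(1)[OF K]]) auto
  show ?case
  proof (cases "b i \<in> span_family K I b")
    case False
    then show ?thesis using Suc_dim[OF _ False d] insert eq by fastforce
  next
    case True
    have "line_extension K (b i) (span_family K I b) = span_family K I b"
    proof (intro equalityI subsetI)
      fix x assume "x \<in> line_extension K (b i) (span_family K I b)"
      then show "x \<in> span_family K I b"
        using True space_subgroup_props[OF K d] unfolding line_extension_mem_iff by auto
    next
      fix x assume x: "x \<in> span_family K I b"
      then have "x = \<zero> \<otimes> b i \<oplus> x"
        using space_subgroup_props(1)[OF K d] insert by auto
      then show "x \<in> line_extension K (b i) (span_family K I b)"
        using x subringE(2)[OF subfieldE(1)[OF K]] unfolding line_extension_mem_iff by blast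
    qed
    then show ?thesis using d eq by auto
  qed
qed

lemma (in ring) dimension_span_free_family:
  assumes K: "subfield K R" and "finite I" "b \<in> I \<rightarrow> carrier R" "free_family K I b"
  shows "dimension (card I) K (span_family K I b)"
  using assms(2-)
proof (induction I)
  case empty
  then show ?case by auto
next
  case (insert i I)
  note Kr = subringE[OF subfieldE(1)[OF K]]
  have sum: "(\<Oplus>j\<in>insert i I. c j \<otimes> b j) = c i \<otimes> b i \<oplus> (\<Oplus>j\<in>I. c j \<otimes> b j)"
    if "c \<in> insert i I \<rightarrow> K" for c
    using that insert Kr(1) by (intro finsum_insert) (auto simp: Pi_def)
  have ext: "(\<Oplus>j\<in>insert i I. (c(i := k)) j \<otimes> b j) = k \<otimes> b i \<oplus> (\<Oplus>j\<in>I. c j \<otimes> b j)"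
    if "c \<in> I \<rightarrow> K" "k \<in> K" for c k
  proof -
    have "(\<Oplus>j\<in>I. (c(i := k)) j \<otimes> b j) = (\<Oplus>j\<in>I. c j \<otimes> b j)"
      using that insert Kr(1) by (intro finsum_cong') (auto simp: Pi_def)
    then show ?thesis using that sum[of "c(i := k)"] by (auto simp: Pi_def)
  qed
  have "free_family K I b"
    unfolding free_family_def
  proof (intro ballI impI)
    fix c j assume c: "c \<in> I \<rightarrow> K" "(\<Oplus>j\<in>I. c j \<otimes> b j) = \<zero>" and j: "j \<in> I"
    have "(\<Oplus>j\<in>insert i I. (c(i := \<zero>)) j \<otimes> b j) = \<zero>"
      using ext[OF c(1) Kr(2)] c insert.prems(1) by auto
    moreover have "c(i := \<zero>) \<in> insert i I \<rightarrow> K" using c Kr(2) by auto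
    ultimately have "\<forall>j\<in>insert i I. (c(i := \<zero>)) j = \<zero>"
      using insert.prems(2) unfolding free_family_def by blast
    then have "(c(i := \<zero>)) j = \<zero>" using j by blast
    moreover have "j \<noteq> i" using j insert.hyps by auto
    ultimately show "c j = \<zero>" by simp
  qed
  then have d: "dimension (card I) K (span_family K I b)"
    using insert by auto
  have "b i \<notin> span_family K I b"
  proof
    assume "b i \<in> span_family K I b"
    then obtain c where c: "c \<in> I \<rightarrow> K" "b i = (\<Oplus>j\<in>I. c j \<otimes> b j)"
      unfolding span_family_def by blast
    have m1: "\<ominus> \<one> \<in> K" using Kr by auto
    have "(\<Oplus>j\<in>insert i I. (c(i := \<ominus> \<one>)) j \<otimes> b j) = \<ominus> b i \<oplus> b i"
      using ext[OF c(1) m1] c(2) insert.prems(1) by (auto simp: l_minus)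
    then have "(\<Oplus>j\<in>insert i I. (c(i := \<ominus> \<one>)) j \<otimes> b j) = \<zero>"
      using insert.prems(1) by (simp add: l_neg)
    moreover have "c(i := \<ominus> \<one>) \<in> insert i I \<rightarrow> K" using c m1 by auto
    ultimately have "(c(i := \<ominus> \<one>)) i = \<zero>"
      using insert.prems(2) unfolding free_family_def by blast
    then show False using subfieldE(6)[OF K] by (metis fun_upd_same minus_minus minus_zero one_closed)
  qed
  then show ?case
    using Suc_dim[OF _ _ d, of "b i"] insert span_family_insert[OF subfieldE(1)[OF K], of I i b] by auto
qed

lemma (in ring) dimension_imp_basis:
  assumes K: "subfield K R" and "dimension d K E"
  shows "\<exists>b \<in> {..<d} \<rightarrow> carrier R. free_family K {..<d} b \<and> span_family K {..<d} b = E"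
  using assms(2)
proof (induction d arbitrary: E)
  case 0
  then show ?case using dimension_zero[OF K] unfolding free_family_def by auto
next
  case (Suc d)
  note Kr = subringE[OF subfieldE(1)[OF K]]
  obtain v E' where v: "v \<in> carrier R" "dimension d K E'" "v \<notin> E'" "E = line_extension K v E'"
    using dimension_backwards[OF K Suc.prems] by blast
  obtain b where b: "b \<in> {..<d} \<rightarrow> carrier R" "free_family K {..<d} b" "span_family K {..<d} b = E'"
    using Suc.IH[OF v(2)] by blast
  let ?b = "b(d := v)"
  have b': "?b \<in> insert d {..<d} \<rightarrow> carrier R" using b v by auto
  have same: "(\<Oplus>j\<in>{..<d}. c j \<otimes> ?b j) = (\<Oplus>j\<in>{..<d}. c j \<otimes> b j)" if "c \<in> {..<d} \<rightarrow> K" for c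
    using that b Kr(1) by (intro finsum_cong') (auto simp: Pi_def)
  have same': "span_family K {..<d} ?b = E'"
  proof -
    have "span_family K {..<d} ?b = span_family K {..<d} b"
      unfolding span_family_def using same by (smt (verit) Collect_cong)
    then show ?thesis using b(3) by simp
  qed
  have "span_family K (insert d {..<d}) ?b = E"
    using span_family_insert[OF subfieldE(1)[OF K] _ _ b'] v same' by auto
  moreover have "free_family K (insert d {..<d}) ?b"
    unfolding free_family_def
  proof (intro ballI impI)
    fix c j assume c: "c \<in> insert d {..<d} \<rightarrow> K" "(\<Oplus>j\<in>insert d {..<d}. c j \<otimes> ?b j) = \<zero>"
      and j: "j \<in> insert d {..<d}"
    have c': "c \<in> {..<d} \<rightarrow> K" using c by auto
    let ?s = "\<Oplus>j\<in>{..<d}. c j \<otimes> b j"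
    have sE: "?s \<in> E'" using b(3) c' unfolding span_family_def by auto
    have sc: "?s \<in> carrier R" using sE space_subgroup_props(1)[OF K v(2)] by auto
    have "(\<Oplus>j\<in>insert d {..<d}. c j \<otimes> ?b j) = c d \<otimes> v \<oplus> (\<Oplus>j\<in>{..<d}. c j \<otimes> ?b j)"
      using c b v Kr(1) by (subst finsum_insert) (auto simp: Pi_def)
    then have z: "c d \<otimes> v \<oplus> ?s = \<zero>" using c same[OF c'] by simp
    have cd: "c d \<in> carrier R" using c Kr(1) by auto
    have "c d \<otimes> v = \<ominus> ?s" using z cd v(1) sc by (simp add: minus_equality[symmetric])
    then have "c d \<otimes> v \<in> E'" using space_subgroup_props(4)[OF K v(2) sE] by simp
    then have cd0: "c d = \<zero>"
      using space_subgroup_props(6)[OF K v(2), of "c d" v] v c by auto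
    then have "?s = \<zero>" using z v sc by simp
    then have "\<forall>j\<in>{..<d}. c j = \<zero>" using b(2) c' unfolding free_family_def by blast
    then show "c j = \<zero>" using j cd0 by auto
  qed
  ultimately show ?case using b' unfolding lessThan_Suc by blast
qed

text \<open>Gaussian elimination, by induction on the number of equations.\<close>

lemma (in ring) homogeneous_system:
  assumes K: "subfield K R" and "finite S" "finite I" "card S < card I"
    and "\<And>i s. i \<in> I \<Longrightarrow> s \<in> S \<Longrightarrow> v i s \<in> K"
  shows "\<exists>x\<in>I \<rightarrow> K. (\<exists>i\<in>I. x i \<noteq> \<zero>) \<and> (\<forall>s\<in>S. (\<Oplus>i\<in>I. x i \<otimes> v i s) = \<zero>)"
  using assms(2-)
proof (induction S arbitrary: I v)
  case empty
  then have "I \<noteq> {}" by auto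
  then show ?case
    using subringE(3)[OF subfieldE(1)[OF K]] subfieldE(6)[OF K] by (intro bexI[of _ "\<lambda>_. \<one>"]) auto
next
  case (insert s S)
  note Kr = subringE[OF subfieldE(1)[OF K]]
  note Kc = subsetD[OF Kr(1)]
  note Kcomm = subfieldE(4)[OF K]
  show ?case
  proof (cases "\<forall>i\<in>I. v i s = \<zero>")
    case True
    obtain x where x: "x \<in> I \<rightarrow> K" "\<exists>i\<in>I. x i \<noteq> \<zero>" "\<forall>s\<in>S. (\<Oplus>i\<in>I. x i \<otimes> v i s) = \<zero>"
    proof -
      have "card S < card I" using insert.prems(2) insert.hyps by simp
      from insert.IH[OF insert.prems(1) this, of v] insert.prems(3) show ?thesis
        using that by blast
    qed
    have "(\<Oplus>i\<in>I. x i \<otimes> v i s) = (\<Oplus>i\<in>I. \<zero>)"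
      using True x Kc by (intro finsum_cong') (auto simp: Pi_def)
    then show ?thesis using x by auto
  next
    case False
    then obtain j where j: "j \<in> I" "v j s \<noteq> \<zero>" by auto
    define p where "p = inv (v j s)"
    have p: "p \<in> K" "v j s \<otimes> p = \<one>" "p \<otimes> v j s = \<one>"
      using subfield_m_inv[OF K, of "v j s"] insert j unfolding p_def by auto
    \<comment> \<open>Unknown \<open>j\<close> is eliminated from the equations of \<open>S\<close> with the help of equation \<open>s\<close>.\<close>
    define I' where "I' = I - {j}"
    define w where "w i t = v i t \<ominus> v i s \<otimes> p \<otimes> v j t" for i t
    have vK: "v i t \<in> K" if "i \<in> I" "t \<in> insert s S" for i t using insert.prems that by auto
    have wK: "w i t \<in> K" if "i \<in> I'" "t \<in> S" for i t
      unfolding w_def a_minus_def using that p vK j Kr unfolding I'_def by auto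
    have card: "card S < card I'" using insert j unfolding I'_def by auto
    have finI': "finite I'" using insert unfolding I'_def by auto
    obtain x where x: "x \<in> I' \<rightarrow> K" "\<exists>i\<in>I'. x i \<noteq> \<zero>" "\<forall>t\<in>S. (\<Oplus>i\<in>I'. x i \<otimes> w i t) = \<zero>"
      using insert.IH[of I' w] finI' card wK by blast
    define y where "y = (\<Oplus>i\<in>I'. x i \<otimes> v i s \<otimes> p)"
    have yK: "y \<in> K" unfolding y_def
      using finsum_mem_subring[OF subfieldE(1)[OF K] finI'] x(1) vK p Kr I'_def by (auto simp: Pi_def)
    have sumI: "(\<Oplus>i\<in>I. (x(j := \<ominus> y)) i \<otimes> v i t) = (\<Oplus>i\<in>I'. x i \<otimes> v i t) \<ominus> y \<otimes> v j t"
      if t: "t \<in> insert s S" for t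
    proof -
      have "I = insert j I'" using j unfolding I'_def by auto
      moreover have "(\<Oplus>i\<in>insert j I'. (x(j := \<ominus> y)) i \<otimes> v i t)
          = \<ominus> y \<otimes> v j t \<oplus> (\<Oplus>i\<in>I'. (x(j := \<ominus> y)) i \<otimes> v i t)"
        using finI' x(1) yK vK[OF _ t] j Kc
        by (subst finsum_insert) (auto simp: I'_def Pi_def)
      moreover have "(\<Oplus>i\<in>I'. (x(j := \<ominus> y)) i \<otimes> v i t) = (\<Oplus>i\<in>I'. x i \<otimes> v i t)"
        using x(1) vK[OF _ t] Kc by (intro finsum_cong') (auto simp: I'_def Pi_def)
      moreover have "(\<Oplus>i\<in>I'. x i \<otimes> v i t) \<in> carrier R"
        using x(1) vK[OF _ t] Kc by (intro finsum_closed) (auto simp: I'_def Pi_def)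
      ultimately show ?thesis
        using Kc[OF yK] Kc[OF vK[OF j(1) t]] by (simp add: a_minus_def l_minus a_comm)
    qed
    have "(\<Oplus>i\<in>I. (x(j := \<ominus> y)) i \<otimes> v i t) = \<zero>" if t: "t \<in> insert s S" for t
    proof (cases "t = s")
      case True
      have "y \<otimes> v j s = (\<Oplus>i\<in>I'. x i \<otimes> v i s \<otimes> p \<otimes> v j s)"
        unfolding y_def using finI' x(1) vK p Kc j
        by (intro finsum_ldistr) (auto simp: I'_def Pi_def)
      also have "\<dots> = (\<Oplus>i\<in>I'. x i \<otimes> v i s)"
        using x(1) vK p Kc j by (intro finsum_cong') (auto simp: I'_def Pi_def m_assoc)
      finally have eq: "y \<otimes> v j s = (\<Oplus>i\<in>I'. x i \<otimes> v i s)" .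
      have "y \<otimes> v j s \<in> carrier R" using yK vK[OF j(1), of s] Kc by simp
      then show ?thesis using sumI[of s] True eq by (simp add: a_minus_def r_neg)
    next
      case False
      then have t: "t \<in> S" using t by simp
      have "\<zero> = (\<Oplus>i\<in>I'. x i \<otimes> v i t \<ominus> x i \<otimes> v i s \<otimes> p \<otimes> v j t)"
        unfolding x(3)[rule_format, OF t, symmetric] w_def
        using x(1) vK p Kc j t
        by (intro finsum_cong') (auto simp: I'_def Pi_def m_assoc r_distr a_minus_def r_minus)
      also have "\<dots> = (\<Oplus>i\<in>I'. x i \<otimes> v i t) \<ominus> (\<Oplus>i\<in>I'. x i \<otimes> v i s \<otimes> p \<otimes> v j t)"
        using x(1) vK p Kc j t finI' by (intro finsum_diff) (auto simp: I'_def Pi_def)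
      also have "(\<Oplus>i\<in>I'. x i \<otimes> v i s \<otimes> p \<otimes> v j t) = y \<otimes> v j t"
        unfolding y_def using finI' x(1) vK p Kc j t
        by (intro finsum_ldistr[symmetric]) (auto simp: I'_def Pi_def)
      finally show ?thesis using sumI[of t] t by simp
    qed
    moreover have "x(j := \<ominus> y) \<in> I \<rightarrow> K" using x(1) yK Kr(5) unfolding I'_def by auto
    moreover have "\<exists>i\<in>I. (x(j := \<ominus> y)) i \<noteq> \<zero>" using x(2) unfolding I'_def by auto
    ultimately show ?thesis by blast
  qed
qed

lemma (in ring) free_family_spans:
  assumes K: "subfield K R" and d: "dimension (card I) K E"
    and I: "finite I" "u \<in> I \<rightarrow> E" "free_family K I u"
  shows "span_family K I u = E"
proof -
  note E = space_subgroup_props[OF K d]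
  have "(\<Oplus>i\<in>I. c i \<otimes> u i) \<in> E" if "c \<in> I \<rightarrow> K" for c
    using additive_finsum[OF abelian_monoid_axioms I(1), of "\<lambda>i. c i \<otimes> u i" E "\<lambda>x. x"] E that I(2)
    by (auto simp: Pi_def)
  then have sub: "span_family K I u \<subseteq> E" unfolding span_family_def by auto
  have "dimension (card I) K (span_family K I u)"
    using I E(1) by (intro dimension_span_free_family[OF K]) auto
  from exists_base[OF K this] obtain Us
    where Us: "set Us \<subseteq> carrier R" "independent K Us" "length Us = card I" "Span K Us = span_family K I u"
    by blast
  then have "set Us \<subseteq> E" using Span_base_incl[OF K Us(1)] sub by simp
  then show ?thesis using independent_length_eq_dimension[OF K d Us(2)] Us(3,4) by simp
qed

lemma (in ring) span_family_single:
  assumes K: "subring K R" and I: "finite I" "b \<in> I \<rightarrow> carrier R" "i \<in> I" and s: "s \<in> K"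
  shows "s \<otimes> b i \<in> span_family K I b"
proof -
  have sc: "s \<in> carrier R" using s subringE(1)[OF K] by blast
  have "(\<Oplus>j\<in>I. (if j = i then s else \<zero>) \<otimes> b j) = (if i = i then s else \<zero>) \<otimes> b i"
    using I sc by (intro finsum_delta) (auto simp: Pi_def)
  then have "s \<otimes> b i = (\<Oplus>j\<in>I. (if j = i then s else \<zero>) \<otimes> b j)" by simp
  then show ?thesis unfolding span_family_def using subringE(2)[OF K] s by auto
qed

lemma (in ring) span_family_base:
  assumes "subring K R" "finite I" "b \<in> I \<rightarrow> carrier R" "i \<in> I"
  shows "b i \<in> span_family K I b"
  using span_family_single[OF assms subringE(3)[OF assms(1)]] funcset_mem[OF assms(3,4)] by simp

lemma (in ring) span_family_add:
  assumes K: "subring K R" and I: "finite I" "b \<in> I \<rightarrow> carrier R"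
    and xy: "x \<in> span_family K I b" "y \<in> span_family K I b"
  shows "x \<oplus> y \<in> span_family K I b"
proof -
  obtain c c' where c: "c \<in> I \<rightarrow> K" "x = (\<Oplus>i\<in>I. c i \<otimes> b i)" "c' \<in> I \<rightarrow> K" "y = (\<Oplus>i\<in>I. c' i \<otimes> b i)"
    using xy unfolding span_family_def by blast
  have mem: "c i \<in> carrier R" "c' i \<in> carrier R" "b i \<in> carrier R" if "i \<in> I" for i
    using that c(1,3) I(2) subringE(1)[OF K] by auto
  have "x \<oplus> y = (\<Oplus>i\<in>I. c i \<otimes> b i \<oplus> c' i \<otimes> b i)"
    unfolding c(2,4) using mem I(1) by (intro finsum_addf[symmetric]) auto
  also have "\<dots> = (\<Oplus>i\<in>I. (c i \<oplus> c' i) \<otimes> b i)"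
    using mem by (intro finsum_eqI) (auto simp: l_distr)
  finally show ?thesis
    unfolding span_family_def using c(1,3) subringE(7)[OF K]
    by (intro CollectI exI[of _ "\<lambda>i. c i \<oplus> c' i"]) (auto simp: Pi_def)
qed

lemma (in ring) span_family_coeff:
  assumes "x \<in> span_family K I b"
  obtains c where "c \<in> I \<rightarrow> K" "x = (\<Oplus>i\<in>I. c i \<otimes> b i)"
  using assms unfolding span_family_def by blast

lemma (in ring) span_family_mono: "K \<subseteq> K' \<Longrightarrow> span_family K I b \<subseteq> span_family K' I b"
  unfolding span_family_def by blast

lemma (in ring) free_family_unique:
  assumes K: "subfield K R" and I: "finite I" "b \<in> I \<rightarrow> carrier R" "free_family K I b"
    and c: "c \<in> I \<rightarrow> K" "c' \<in> I \<rightarrow> K" "(\<Oplus>i\<in>I. c i \<otimes> b i) = (\<Oplus>i\<in>I. c' i \<otimes> b i)" and i: "i \<in> I"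
  shows "c i = c' i"
proof -
  have mem: "c j \<in> carrier R" "c' j \<in> carrier R" "b j \<in> carrier R" if "j \<in> I" for j
    using that c(1,2) I(2) subfieldE(3)[OF K] by auto
  have "(\<Oplus>j\<in>I. (c j \<ominus> c' j) \<otimes> b j) = (\<Oplus>j\<in>I. c j \<otimes> b j \<ominus> c' j \<otimes> b j)"
    using mem by (intro finsum_eqI) (auto simp: a_minus_def l_distr l_minus)
  also have "\<dots> = (\<Oplus>j\<in>I. c j \<otimes> b j) \<ominus> (\<Oplus>j\<in>I. c' j \<otimes> b j)"
    using mem I(1) by (intro finsum_diff) auto
  also have "\<dots> = \<zero>" unfolding c(3) using mem by (simp add: a_minus_def r_neg Pi_def)
  finally have "(\<Oplus>j\<in>I. (c j \<ominus> c' j) \<otimes> b j) = \<zero>" .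
  moreover have "(\<lambda>j. c j \<ominus> c' j) \<in> I \<rightarrow> K"
    using c(1,2) unfolding a_minus_def
    by (auto simp: Pi_def intro!: subringE(5,7)[OF subfieldE(1)[OF K]])
  ultimately have "\<forall>j\<in>I. c j \<ominus> c' j = \<zero>" using bspec[OF I(3)[unfolded free_family_def]] by blast
  then show ?thesis using i mem by simp
qed

text \<open>With fewer elements in \<open>S\<close> than in \<open>I\<close>, the rows of \<open>a\<close> would satisfy a nontrivial linear relation,
  and multiplying it by the right inverse \<open>b\<close> makes all its coefficients vanish.\<close>

lemma (in ring) card_le_if_right_inverse:
  assumes K: "subfield K R" and fin: "finite S" "finite I"
    and a: "\<And>i s. i \<in> I \<Longrightarrow> s \<in> S \<Longrightarrow> a i s \<in> K" and b: "\<And>i s. i \<in> I \<Longrightarrow> s \<in> S \<Longrightarrow> b s i \<in> K"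
    and inv: "\<And>i j. i \<in> I \<Longrightarrow> j \<in> I \<Longrightarrow> (\<Oplus>s\<in>S. a i s \<otimes> b s j) = (if i = j then \<one> else \<zero>)"
  shows "card I \<le> card S"
proof (rule ccontr)
  assume "\<not> card I \<le> card S"
  then obtain x where x: "x \<in> I \<rightarrow> K" "\<exists>i\<in>I. x i \<noteq> \<zero>" "\<forall>s\<in>S. (\<Oplus>i\<in>I. x i \<otimes> a i s) = \<zero>"
    using homogeneous_system[OF K fin, of a] a by auto
  note Kc = subsetD[OF subfieldE(3)[OF K]]
  have mem: "x i \<in> carrier R" "a i s \<in> carrier R" "b s i \<in> carrier R" if "i \<in> I" "s \<in> S" for i s
    using that x(1) a b Kc by (auto simp: Pi_def)
  have "x j = \<zero>" if j: "j \<in> I" for j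
  proof -
    have xc: "x i \<in> carrier R" if "i \<in> I" for i using that x(1) Kc by auto
    have "x j = (\<Oplus>i\<in>I. x i \<otimes> (\<Oplus>s\<in>S. a i s \<otimes> b s j))"
      using xc j fin by (subst finsum_delta[of I j]) (auto simp: inv)
    also have "\<dots> = (\<Oplus>i\<in>I. \<Oplus>s\<in>S. x i \<otimes> (a i s \<otimes> b s j))"
      using xc mem j fin by (intro finsum_eqI finsum_rdistr) auto
    also have "\<dots> = (\<Oplus>s\<in>S. \<Oplus>i\<in>I. x i \<otimes> (a i s \<otimes> b s j))"
      using xc mem j fin by (intro finsum_swap) auto
    also have "\<dots> = (\<Oplus>s\<in>S. \<zero>)"
    proof (rule finsum_eqI)
      fix s assume s: "s \<in> S"
      have "(\<Oplus>i\<in>I. x i \<otimes> (a i s \<otimes> b s j)) = (\<Oplus>i\<in>I. x i \<otimes> a i s \<otimes> b s j)"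
        using xc mem j s by (intro finsum_eqI) (auto simp: m_assoc)
      also have "\<dots> = (\<Oplus>i\<in>I. x i \<otimes> a i s) \<otimes> b s j"
        using xc mem j s fin by (intro finsum_ldistr[symmetric]) auto
      finally show "(\<Oplus>i\<in>I. x i \<otimes> (a i s \<otimes> b s j)) = \<zero>" using x(3) s mem[OF j s] by simp
    qed
    finally show ?thesis by simp
  qed
  then show False using x(2) by blast
qed

lemma (in ring) span_family_subring:
  assumes "subring S R" "finite I" "b \<in> I \<rightarrow> S" "K \<subseteq> S"
  shows "ring.span_family (R\<lparr>carrier := S\<rparr>) K I b = span_family K I b"
proof -
  have "(\<Oplus>\<^bsub>R\<lparr>carrier := S\<rparr>\<^esub>i\<in>I. c i \<otimes> b i) = (\<Oplus>i\<in>I. c i \<otimes> b i)" if "c \<in> I \<rightarrow> K" for c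
    using that assms(3,4)
    by (intro finsum_subring[OF assms(1,2)]) (auto simp: Pi_def intro!: subringE(6)[OF assms(1)])
  then show ?thesis
    unfolding span_family_def ring.span_family_def[OF subring_is_ring[OF assms(1)]]
    by simp (metis (no_types, lifting))
qed

lemma (in ring) free_family_subring:
  assumes "subring S R" "finite I" "b \<in> I \<rightarrow> S" "K \<subseteq> S"
  shows "ring.free_family (R\<lparr>carrier := S\<rparr>) K I b = free_family K I b"
proof -
  have "(\<Oplus>\<^bsub>R\<lparr>carrier := S\<rparr>\<^esub>i\<in>I. c i \<otimes> b i) = (\<Oplus>i\<in>I. c i \<otimes> b i)" if "c \<in> I \<rightarrow> K" for c
    using that assms(3,4)
    by (intro finsum_subring[OF assms(1,2)]) (auto simp: Pi_def intro!: subringE(6)[OF assms(1)])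
  then show ?thesis
    unfolding free_family_def ring.free_family_def[OF subring_is_ring[OF assms(1)]] by simp
qed

section \<open>Galois extensions and fixed fields\<close>

locale galois_subfield = ring A for A (structure) +
  fixes F M :: "'a set" and n :: nat
  assumes galois: "galois_extension A F M n"
    and finite_G: "finite (carrier (galois_group A F M))"
begin

abbreviation G :: "('a \<Rightarrow> 'a) monoid" where
  "G \<equiv> galois_group A F M"

lemma subfield_F: "subfield F A" and subfield_M: "subfield M A" and F_subset_M: "F \<subseteq> M"
  and dimension_M: "dimension n F M" and fixed_field_G: "fixed_field M (carrier G) = F"
  using galois unfolding galois_extension_def by auto

lemma M_carrier [simp]: "x \<in> M \<Longrightarrow> x \<in> carrier A"
  using subfieldE(3)[OF subfield_M] by auto

lemma M_closed [simp]:
  "x \<in> M \<Longrightarrow> y \<in> M \<Longrightarrow> x \<otimes> y \<in> M" "x \<in> M \<Longrightarrow> y \<in> M \<Longrightarrow> x \<oplus> y \<in> M"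
  "x \<in> M \<Longrightarrow> \<ominus> x \<in> M" "\<zero> \<in> M" "\<one> \<in> M"
  using subringE[OF subfieldE(1)[OF subfield_M]] by auto

lemma M_diff [simp]: "x \<in> M \<Longrightarrow> y \<in> M \<Longrightarrow> x \<ominus> y \<in> M"
  by (simp add: a_minus_def)

lemma M_finsum [simp]: "finite I \<Longrightarrow> f \<in> I \<rightarrow> M \<Longrightarrow> finsum A f I \<in> M"
  by (rule finsum_mem_subring[OF subfieldE(1)[OF subfield_M]])

lemma M_comm: "x \<in> M \<Longrightarrow> y \<in> M \<Longrightarrow> x \<otimes> y = y \<otimes> x"
  by (rule subfieldE(4)[OF subfield_M])

lemma one_not_zero_M [simp]: "\<one> \<noteq> \<zero>"
  by (rule subfieldE(6)[OF subfield_M])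

lemma M_inv:
  assumes "x \<in> M" "x \<noteq> \<zero>"
  shows "inv x \<in> M" "x \<otimes> inv x = \<one>" "inv x \<otimes> x = \<one>"
  using subfield_m_inv[OF subfield_M] assms by auto

lemma G_iff:
  "g \<in> carrier G \<longleftrightarrow> g \<in> extensional M \<and> bij_betw g M M
     \<and> (\<forall>x\<in>M. \<forall>y\<in>M. g (x \<otimes> y) = g x \<otimes> g y \<and> g (x \<oplus> y) = g x \<oplus> g y)
     \<and> g \<one> = \<one> \<and> (\<forall>x\<in>F. g x = x)"
  unfolding galois_group_def Bij_def ring_hom_def by (auto simp: bij_betw_imp_funcset) 
    (auto simp: bij_betw_def)

lemma subgroup_G: "subgroup (carrier G) (BijGroup M)"
proof (rule subgroup.intro)
  show "carrier G \<subseteq> carrier (BijGroup M)"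
    by (auto simp: G_iff BijGroup_def Bij_def)
next
  fix x y assume xy: "x \<in> carrier G" "y \<in> carrier G"
  then have B: "x \<in> Bij M" "y \<in> Bij M" by (auto simp: G_iff Bij_def)
  have "compose M x y \<in> Bij M" using compose_Bij[OF B] .
  moreover have "y z \<in> M" if "z \<in> M" for z using B(2) that Bij_imp_funcset by blast
  ultimately show "x \<otimes>\<^bsub>BijGroup M\<^esub> y \<in> carrier G"
    using xy B F_subset_M unfolding G_iff BijGroup_def Bij_def
    by (auto simp: compose_def subset_iff)
next
  show "\<one>\<^bsub>BijGroup M\<^esub> \<in> carrier G"
    using F_subset_M id_Bij[of M] by (auto simp: G_iff BijGroup_def Bij_def subset_iff)
next
  fix x assume x: "x \<in> carrier G"
  then have B: "x \<in> Bij M" by (auto simp: G_iff Bij_def)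
  have xi: "inv_into M x (x z) = z" if "z \<in> M" for z
    using B that unfolding Bij_def bij_betw_def by auto
  have "inv_into M x (y \<otimes> z) = inv_into M x y \<otimes> inv_into M x z" if "y \<in> M" "z \<in> M" for y z
    using x that by (intro Bij_inv_into_lemma[of M x "(\<otimes>)"]) (auto simp: G_iff B)
  moreover have "inv_into M x (y \<oplus> z) = inv_into M x y \<oplus> inv_into M x z" if "y \<in> M" "z \<in> M" for y z
    using x that by (intro Bij_inv_into_lemma[of M x "(\<oplus>)"]) (auto simp: G_iff B)
  moreover have "inv_into M x \<one> = \<one>" using x xi[of \<one>] by (auto simp: G_iff)
  moreover have "inv_into M x z = z" if "z \<in> F" for z
    using x xi[of z] that F_subset_M by (auto simp: G_iff)
  moreover have "restrict (inv_into M x) M \<in> Bij M" using restrict_inv_into_Bij[OF B] .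
  ultimately have "restrict (inv_into M x) M \<in> carrier G"
    using F_subset_M unfolding G_iff Bij_def by (auto simp: subset_iff)
  then show "inv\<^bsub>BijGroup M\<^esub> x \<in> carrier G" using inv_BijGroup[OF B] by simp
qed

sublocale Gr: group G
  using subgroup.subgroup_is_group[OF subgroup_G group_BijGroup]
  by (simp add: galois_group_def)

lemma G_mult_apply [simp]:
  assumes "g \<in> carrier G" "\<rho> \<in> carrier G" "x \<in> M"
  shows "(g \<otimes>\<^bsub>G\<^esub> \<rho>) x = g (\<rho> x)"
proof -
  have "g \<in> Bij M" "\<rho> \<in> Bij M" using assms by (auto simp: galois_group_def)
  then show ?thesis using assms(3) by (simp add: galois_group_def BijGroup_def compose_def)
qed

lemma G_one_apply [simp]: "x \<in> M \<Longrightarrow> \<one>\<^bsub>G\<^esub> x = x"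
  by (simp add: galois_group_def BijGroup_def)

lemma G_M [simp]: "g \<in> carrier G \<Longrightarrow> x \<in> M \<Longrightarrow> g x \<in> M"
  by (auto simp: G_iff bij_betw_def)

lemma G_hom [simp]:
  assumes "g \<in> carrier G"
  shows "x \<in> M \<Longrightarrow> y \<in> M \<Longrightarrow> g (x \<otimes> y) = g x \<otimes> g y"
    "x \<in> M \<Longrightarrow> y \<in> M \<Longrightarrow> g (x \<oplus> y) = g x \<oplus> g y" "g \<one> = \<one>"
  using assms by (auto simp: G_iff)

lemma G_fixes: "g \<in> carrier G \<Longrightarrow> x \<in> F \<Longrightarrow> g x = x"
  unfolding G_iff by blast

lemma G_zero [simp]: "g \<in> carrier G \<Longrightarrow> g \<zero> = \<zero>"
  using G_fixes[of g \<zero>] subringE(2)[OF subfieldE(1)[OF subfield_F]] by simp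

lemma G_inv_apply [simp]:
  assumes "g \<in> carrier G" "x \<in> M"
  shows "g ((inv\<^bsub>G\<^esub> g) x) = x" "(inv\<^bsub>G\<^esub> g) (g x) = x"
  using assms G_mult_apply[of g "inv\<^bsub>G\<^esub> g" x] G_mult_apply[of "inv\<^bsub>G\<^esub> g" g x] by simp_all

lemma G_finsum:
  assumes "g \<in> carrier G" "finite I" "f \<in> I \<rightarrow> M"
  shows "g (\<Oplus>i\<in>I. f i) = (\<Oplus>i\<in>I. g (f i))"
  using additive_finsum[OF abelian_monoid_axioms assms(2,3), of g] assms(1) by (auto simp: subset_iff)

lemma G_nonzero: "g \<in> carrier G \<Longrightarrow> x \<in> M \<Longrightarrow> x \<noteq> \<zero> \<Longrightarrow> g x \<noteq> \<zero>"
  by (metis G_inv_apply(2) G_zero Gr.inv_closed)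

lemma G_eqI:
  assumes "g \<in> carrier G" "\<rho> \<in> carrier G" "\<And>x. x \<in> M \<Longrightarrow> g x = \<rho> x"
  shows "g = \<rho>"
  using assms(1,2)[unfolded G_iff] by (intro extensionalityI[of _ M]) (blast intro: assms(3))+

lemma G_neg: "g \<in> carrier G \<Longrightarrow> x \<in> M \<Longrightarrow> g (\<ominus> x) = \<ominus> g x"
  using G_hom(2)[of g "\<ominus> x" x] by (simp add: l_neg minus_equality)

abbreviation fixed :: "('a \<Rightarrow> 'a) set \<Rightarrow> 'a set" where
  "fixed H \<equiv> fixed_field M H"

lemma fixed_M: "x \<in> fixed H \<Longrightarrow> x \<in> M"
  unfolding fixed_field_def by auto

lemma fixedD: "x \<in> fixed H \<Longrightarrow> h \<in> H \<Longrightarrow> h x = x"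
  unfolding fixed_field_def by auto

lemma fixedI: "x \<in> M \<Longrightarrow> (\<And>h. h \<in> H \<Longrightarrow> h x = x) \<Longrightarrow> x \<in> fixed H"
  unfolding fixed_field_def by auto

lemma fixed_antimono: "H \<subseteq> H' \<Longrightarrow> fixed H' \<subseteq> fixed H"
  unfolding fixed_field_def by auto

lemma subfield_fixed:
  assumes H: "H \<subseteq> carrier G"
  shows "subfield (fixed H) A"
proof (rule subfieldI)
  have HG: "h \<in> carrier G" if "h \<in> H" for h using that H by auto
  show "subcring (fixed H) A"
  proof (intro subcringI subringI)
    show "fixed H \<subseteq> carrier A" using fixed_M M_carrier by blast
    show "\<one> \<in> fixed H" using HG by (auto intro!: fixedI)
    show "\<ominus> x \<in> fixed H" if "x \<in> fixed H" for x
      using that HG by (intro fixedI) (simp_all add: G_neg fixed_M fixedD)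
    show "x \<otimes> y \<in> fixed H" "x \<oplus> y \<in> fixed H" if "x \<in> fixed H" "y \<in> fixed H" for x y
      using that HG by (intro fixedI; simp add: fixed_M fixedD[OF that(1)] fixedD[OF that(2)])+
    show "x \<otimes> y = y \<otimes> x" if "x \<in> fixed H" "y \<in> fixed H" for x y
      using that fixed_M M_comm by blast
  qed
  show "Units (A\<lparr>carrier := fixed H\<rparr>) = fixed H - {\<zero>}"
  proof (intro equalityI subsetI)
    fix x assume "x \<in> Units (A\<lparr>carrier := fixed H\<rparr>)"
    then obtain y where "x \<in> fixed H" "y \<in> fixed H" "x \<otimes> y = \<one>" unfolding Units_def by auto
    moreover from this have "x \<noteq> \<zero>" using fixed_M M_carrier by (metis l_null one_not_zero_M)
    ultimately show "x \<in> fixed H - {\<zero>}" by auto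
  next
    fix x assume x: "x \<in> fixed H - {\<zero>}"
    then have i: "inv x \<in> M" "x \<otimes> inv x = \<one>" "inv x \<otimes> x = \<one>"
      using M_inv[of x] fixed_M by auto
    have "h (inv x) = inv x" if h: "h \<in> H" for h
    proof -
      have "h (inv x) \<otimes> x = h (inv x \<otimes> x)" 
        using x i(1) h fixedD[of x H h] fixed_M[of x H] G_hom(1)[OF HG[OF h], of "inv x" x] by auto
      then have "h (inv x) \<otimes> x = \<one>" unfolding i(3) using HG[OF h] by simp
      moreover have "h (inv x) = (h (inv x) \<otimes> x) \<otimes> inv x"
        using x i HG[OF h] fixed_M[of x H] by (simp add: m_assoc)
      ultimately show ?thesis using i by simp
    qed
    then have "inv x \<in> fixed H" using i by (auto intro!: fixedI)
    then show "x \<in> Units (A\<lparr>carrier := fixed H\<rparr>)" using x i unfolding Units_def by auto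
  qed
qed

lemma fixed_one: "fixed {\<one>\<^bsub>G\<^esub>} = M"
  unfolding fixed_field_def by auto

text \<open>A basis \<open>e\<close> of \<open>M\<close> over the fixed field of \<open>H\<close>, together with the dual family \<open>w\<close>: in matrix
  form, \<open>h (w i)\<close> and \<open>h (e i)\<close> are inverse to each other. This is the separability idempotent
  \<open>\<Sum>i. w i \<otimes> e i\<close> of \<open>M \<otimes> M\<close>, written in coordinates.\<close>

definition coordinates :: "('a \<Rightarrow> 'a) set \<Rightarrow> nat \<Rightarrow> (nat \<Rightarrow> 'a) \<Rightarrow> (nat \<Rightarrow> 'a) \<Rightarrow> bool" where
  "coordinates H d e w \<longleftrightarrow> e \<in> {..<d} \<rightarrow> M \<and> w \<in> {..<d} \<rightarrow> M
     \<and> free_family (fixed H) {..<d} e \<and> span_family (fixed H) {..<d} e = M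
     \<and> (\<forall>h\<in>H. (\<Oplus>i\<in>{..<d}. w i \<otimes> h (e i)) = (if h = \<one>\<^bsub>G\<^esub> then \<one> else \<zero>))"

text \<open>The functions \<open>g \<mapsto> \<Sum>i. w i * g (b i)\<close> on \<open>H\<close> form an \<open>M\<close>-space stable under multiplication
  by \<open>g \<mapsto> g y\<close>. Multiplying by \<open>g \<mapsto> (g y - \<rho> y) / (y - \<rho> y)\<close> makes such a function vanish at \<open>\<rho>\<close> and
  keeps its value at the identity.\<close>

lemma coordinates_avoiding:
  fixes d :: nat
  assumes H: "H \<subseteq> carrier G" "\<one>\<^bsub>G\<^esub> \<in> H"
    and b: "b \<in> {..<d} \<rightarrow> carrier A" "span_family (fixed H) {..<d} b = M"
    and S: "finite S" "S \<subseteq> H - {\<one>\<^bsub>G\<^esub>}"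
  shows "\<exists>w\<in>{..<d} \<rightarrow> M. (\<Oplus>i\<in>{..<d}. w i \<otimes> b i) = \<one> \<and> (\<forall>\<rho>\<in>S. (\<Oplus>i\<in>{..<d}. w i \<otimes> \<rho> (b i)) = \<zero>)"
  using S
proof (induction S)
  case empty
  have "\<one> \<in> span_family (fixed H) {..<d} b" using b by simp
  then obtain w where "w \<in> {..<d} \<rightarrow> fixed H" "\<one> = (\<Oplus>i\<in>{..<d}. w i \<otimes> b i)"
    unfolding span_family_def by blast
  then show ?case using fixed_M by (intro bexI[of _ w]) auto
next
  case (insert \<rho> S)
  obtain w where w: "w \<in> {..<d} \<rightarrow> M" "(\<Oplus>i\<in>{..<d}. w i \<otimes> b i) = \<one>"
      "\<forall>\<rho>\<in>S. (\<Oplus>i\<in>{..<d}. w i \<otimes> \<rho> (b i)) = \<zero>"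
    using insert by auto
  have \<rho>: "\<rho> \<in> carrier G" "\<rho> \<noteq> \<one>\<^bsub>G\<^esub>" using insert H by auto
  obtain y where y: "y \<in> M" "\<rho> y \<noteq> y"
    using G_eqI[OF \<rho>(1) Gr.one_closed] \<rho>(2) by auto
  have bM: "b i \<in> M" if "i < d" for i
    using span_family_base[OF subfieldE(1)[OF subfield_fixed[OF H(1)]] finite_lessThan b(1), of i] that b(2) by simp
  have "\<forall>i<d. \<exists>c\<in>{..<d} \<rightarrow> fixed H. b i \<otimes> y = (\<Oplus>j\<in>{..<d}. c j \<otimes> b j)"
  proof (intro allI impI)
    fix i assume "i < d"
    then have "b i \<otimes> y \<in> span_family (fixed H) {..<d} b" using bM y b(2) by simp
    then show "\<exists>c\<in>{..<d} \<rightarrow> fixed H. b i \<otimes> y = (\<Oplus>j\<in>{..<d}. c j \<otimes> b j)"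
      by (rule span_family_coeff) blast
  qed
  then obtain c where c: "\<And>i. i < d \<Longrightarrow> c i \<in> {..<d} \<rightarrow> fixed H"
      "\<And>i. i < d \<Longrightarrow> b i \<otimes> y = (\<Oplus>j\<in>{..<d}. c i j \<otimes> b j)" by metis
  have cF: "c i j \<in> fixed H" "c i j \<in> M" if "i < d" "j < d" for i j
    using c(1)[OF that(1)] that fixed_M[of "c i j" H] by auto
  have wM: "w i \<in> M" if "i < d" for i using w(1) that by auto
  define r where "r = inv (y \<ominus> \<rho> y)"
  have nz: "y \<ominus> \<rho> y \<noteq> \<zero>" using y \<rho> by (metis G_M M_carrier r_right_minus_eq)
  have r: "r \<in> M" "r \<otimes> (y \<ominus> \<rho> y) = \<one>"
    using M_inv[OF _ nz] y \<rho> unfolding r_def by auto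
  define w' where "w' j = r \<otimes> ((\<Oplus>i\<in>{..<d}. w i \<otimes> c i j) \<ominus> \<rho> y \<otimes> w j)" for j
  have w'M: "w' \<in> {..<d} \<rightarrow> M" unfolding w'_def using wM cF y \<rho> r by auto
  have sum: "(\<Oplus>j\<in>{..<d}. w' j \<otimes> g (b j)) = r \<otimes> ((g y \<ominus> \<rho> y) \<otimes> (\<Oplus>i\<in>{..<d}. w i \<otimes> g (b i)))"
    if gH: "g \<in> H" for g
  proof -
    have g: "g \<in> carrier G" using gH H by auto
    have gc: "g (c i j) = c i j" if "i < d" "j < d" for i j using fixedD[OF cF(1)[OF that] gH] .
    have *: "(\<Oplus>j\<in>{..<d}. (\<Oplus>i\<in>{..<d}. w i \<otimes> c i j) \<otimes> g (b j)) = g y \<otimes> (\<Oplus>i\<in>{..<d}. w i \<otimes> g (b i))"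
    proof -
      have "(\<Oplus>j\<in>{..<d}. (\<Oplus>i\<in>{..<d}. w i \<otimes> c i j) \<otimes> g (b j))
          = (\<Oplus>j\<in>{..<d}. \<Oplus>i\<in>{..<d}. w i \<otimes> c i j \<otimes> g (b j))"
        using wM cF bM g by (intro finsum_eqI finsum_ldistr) auto
      also have "\<dots> = (\<Oplus>i\<in>{..<d}. \<Oplus>j\<in>{..<d}. w i \<otimes> c i j \<otimes> g (b j))"
        using wM cF bM g by (intro finsum_swap) auto
      also have "\<dots> = (\<Oplus>i\<in>{..<d}. g y \<otimes> (w i \<otimes> g (b i)))"
      proof (rule finsum_eqI)
        fix i assume "i \<in> {..<d}"
        then have i: "i < d" by simp
        have "(\<Oplus>j\<in>{..<d}. w i \<otimes> c i j \<otimes> g (b j)) = (\<Oplus>j\<in>{..<d}. w i \<otimes> g (c i j \<otimes> b j))"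
          using wM cF bM g i by (intro finsum_eqI) (auto simp: m_assoc gc)
        also have "\<dots> = w i \<otimes> (\<Oplus>j\<in>{..<d}. g (c i j \<otimes> b j))"
          using wM cF bM g i by (intro finsum_rdistr[symmetric]) auto
        also have "(\<Oplus>j\<in>{..<d}. g (c i j \<otimes> b j)) = g (\<Oplus>j\<in>{..<d}. c i j \<otimes> b j)"
          using cF bM g i by (intro G_finsum[symmetric]) auto
        also have "\<dots> = g (b i) \<otimes> g y" using c(2)[OF i] bM[OF i] y g by (metis G_hom(1))
        also have "w i \<otimes> (g (b i) \<otimes> g y) = g y \<otimes> (w i \<otimes> g (b i))"
          using wM bM g y i M_comm[of "w i \<otimes> g (b i)" "g y"] by (simp add: m_assoc)
        finally show "(\<Oplus>j\<in>{..<d}. w i \<otimes> c i j \<otimes> g (b j)) = g y \<otimes> (w i \<otimes> g (b i))" .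
      qed
      also have "\<dots> = g y \<otimes> (\<Oplus>i\<in>{..<d}. w i \<otimes> g (b i))"
        using wM bM g y by (intro finsum_rdistr[symmetric]) auto
      finally show ?thesis .
    qed
    have "(\<Oplus>j\<in>{..<d}. w' j \<otimes> g (b j))
        = (\<Oplus>j\<in>{..<d}. r \<otimes> ((\<Oplus>i\<in>{..<d}. w i \<otimes> c i j) \<otimes> g (b j) \<ominus> \<rho> y \<otimes> (w j \<otimes> g (b j))))"
      unfolding w'_def a_minus_def using wM cF bM g r y \<rho>
      by (intro finsum_eqI) (auto simp: m_assoc l_distr l_minus)
    also have "\<dots> = r \<otimes> (\<Oplus>j\<in>{..<d}. (\<Oplus>i\<in>{..<d}. w i \<otimes> c i j) \<otimes> g (b j) \<ominus> \<rho> y \<otimes> (w j \<otimes> g (b j)))"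
      using wM cF bM g r y \<rho> by (intro finsum_rdistr[symmetric]) auto
    also have "(\<Oplus>j\<in>{..<d}. (\<Oplus>i\<in>{..<d}. w i \<otimes> c i j) \<otimes> g (b j) \<ominus> \<rho> y \<otimes> (w j \<otimes> g (b j)))
        = (\<Oplus>j\<in>{..<d}. (\<Oplus>i\<in>{..<d}. w i \<otimes> c i j) \<otimes> g (b j)) \<ominus> (\<Oplus>j\<in>{..<d}. \<rho> y \<otimes> (w j \<otimes> g (b j)))"
      using wM cF bM g r y \<rho> by (intro finsum_diff) auto
    also have "(\<Oplus>j\<in>{..<d}. \<rho> y \<otimes> (w j \<otimes> g (b j))) = \<rho> y \<otimes> (\<Oplus>j\<in>{..<d}. w j \<otimes> g (b j))"
      using wM cF bM g r y \<rho> by (intro finsum_rdistr[symmetric]) auto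
    also have "(\<Oplus>j\<in>{..<d}. (\<Oplus>i\<in>{..<d}. w i \<otimes> c i j) \<otimes> g (b j)) \<ominus> \<dots>
        = (g y \<ominus> \<rho> y) \<otimes> (\<Oplus>i\<in>{..<d}. w i \<otimes> g (b i))"
    proof -
      have "(\<Oplus>i\<in>{..<d}. w i \<otimes> g (b i)) \<in> M" using wM bM g by auto
      then show ?thesis unfolding * a_minus_def using g \<rho> y by (simp add: l_distr l_minus)
    qed
    finally show ?thesis .
  qed
  have bc: "(\<Oplus>i\<in>{..<d}. w i \<otimes> \<one>\<^bsub>G\<^esub> (b i)) = (\<Oplus>i\<in>{..<d}. w i \<otimes> b i)" if "w \<in> {..<d} \<rightarrow> M" for w
    using that bM by (intro finsum_eqI) (auto simp: Pi_def)
  have "(\<Oplus>j\<in>{..<d}. w' j \<otimes> b j) = \<one>"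
    using sum[OF H(2)] y r w \<rho> unfolding bc[OF w'M] bc[OF w(1)] by simp
  moreover have "(\<Oplus>j\<in>{..<d}. w' j \<otimes> g (b j)) = \<zero>" if "g \<in> insert \<rho> S" for g
  proof -
    have gH: "g \<in> H" and g: "g \<in> carrier G" using that insert H by auto
    have s: "(\<Oplus>i\<in>{..<d}. w i \<otimes> g (b i)) \<in> M" using wM bM g by auto
    have "(g y \<ominus> \<rho> y) \<otimes> (\<Oplus>i\<in>{..<d}. w i \<otimes> g (b i)) = \<zero>"
    proof (cases "g = \<rho>")
      case True
      have "\<rho> y \<ominus> \<rho> y = \<zero>" using \<rho> y by (simp add: a_minus_def r_neg)
      then show ?thesis using True s by simp
    next
      case False
      then show ?thesis using w(3) that g \<rho> y by simp
    qed
    then show ?thesis using sum[OF gH] r by simp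
  qed
  ultimately show ?case using w'M by blast
qed

lemma coordinates_exist:
  assumes H: "subgroup H G" and d: "dimension d (fixed H) M"
  shows "\<exists>e w. coordinates H d e w"
proof -
  note HG = subgroup.subset[OF H]
  note K = subfield_fixed[OF HG]
  obtain b where b: "b \<in> {..<d} \<rightarrow> carrier A" "free_family (fixed H) {..<d} b" "span_family (fixed H) {..<d} b = M"
    using dimension_imp_basis[OF K d] by blast
  have bM: "b i \<in> M" if "i < d" for i
    using span_family_base[OF subfieldE(1)[OF K] _ b(1), of i] that b by simp
  obtain w where w: "w \<in> {..<d} \<rightarrow> M" "(\<Oplus>i\<in>{..<d}. w i \<otimes> b i) = \<one>"
      "\<forall>\<rho>\<in>H - {\<one>\<^bsub>G\<^esub>}. (\<Oplus>i\<in>{..<d}. w i \<otimes> \<rho> (b i)) = \<zero>"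
    using coordinates_avoiding[OF HG subgroup.one_closed[OF H] b(1,3), of "H - {\<one>\<^bsub>G\<^esub>}"]
      finite_subset[OF HG finite_G] by blast
  have "(\<Oplus>i\<in>{..<d}. w i \<otimes> \<one>\<^bsub>G\<^esub> (b i)) = (\<Oplus>i\<in>{..<d}. w i \<otimes> b i)"
    using bM by (intro finsum_eqI) auto
  then show ?thesis unfolding coordinates_def using w b bM by (intro exI[of _ b] exI[of _ w]) auto
qed

definition trace :: "('a \<Rightarrow> 'a) set \<Rightarrow> 'a \<Rightarrow> 'a" where
  "trace H y = (\<Oplus>h\<in>H. h y)"

lemma trace_M:
  assumes "H \<subseteq> carrier G" "y \<in> M"
  shows "trace H y \<in> M"
  unfolding trace_def using assms finite_subset[OF assms(1) finite_G] by (intro M_finsum) auto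

lemma trace_fixed:
  assumes "subgroup H G" "y \<in> M"
  shows "trace H y \<in> fixed H"
proof (rule fixedI)
  note HG = subgroup.mem_carrier[OF assms(1)]
  have fin: "finite H" using finite_subset[OF subgroup.subset[OF assms(1)] finite_G] .
  show "trace H y \<in> M" using trace_M[OF subgroup.subset[OF assms(1)] assms(2)] .
  fix g assume g: "g \<in> H"
  have bij: "(\<lambda>h. g \<otimes>\<^bsub>G\<^esub> h) ` H = H"
  proof
    show "(\<lambda>h. g \<otimes>\<^bsub>G\<^esub> h) ` H \<subseteq> H" using subgroup.m_closed[OF assms(1) g] by auto
    show "H \<subseteq> (\<lambda>h. g \<otimes>\<^bsub>G\<^esub> h) ` H"
    proof
      fix h assume h: "h \<in> H"
      have "h = g \<otimes>\<^bsub>G\<^esub> (inv\<^bsub>G\<^esub> g \<otimes>\<^bsub>G\<^esub> h)"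
        using HG[OF g] HG[OF h] by (simp add: Gr.m_assoc[symmetric])
      then show "h \<in> (\<lambda>h. g \<otimes>\<^bsub>G\<^esub> h) ` H"
        using subgroup.m_closed[OF assms(1) subgroup.m_inv_closed[OF assms(1) g] h] by blast
    qed
  qed
  have inj: "inj_on (\<lambda>h. g \<otimes>\<^bsub>G\<^esub> h) H"
    using HG g by (intro inj_onI) (metis Gr.l_cancel)
  have "g (trace H y) = (\<Oplus>h\<in>H. g (h y))"
    unfolding trace_def using HG g fin assms(2) by (intro G_finsum) auto
  also have "\<dots> = (\<Oplus>h\<in>H. (g \<otimes>\<^bsub>G\<^esub> h) y)"
    using HG g assms(2) by (intro finsum_eqI) auto
  also have "\<dots> = (\<Oplus>h\<in>(\<lambda>h. g \<otimes>\<^bsub>G\<^esub> h) ` H. h y)"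
    using HG g assms(2) inj by (subst finsum_reindex) auto
  finally show "g (trace H y) = trace H y" unfolding bij trace_def .
qed

context
  fixes H d e w
  assumes H: "subgroup H G" and co: "coordinates H d e w"
begin

lemma coordinates_mem: "i < d \<Longrightarrow> e i \<in> M" "i < d \<Longrightarrow> w i \<in> M"
  using co unfolding coordinates_def by auto

text \<open>Apply \<open>g\<close> to the defining relation of coordinates for \<open>g\<^sup>-\<^sup>1 h\<close>.\<close>

lemma duality:
  assumes "g \<in> H" "h \<in> H"
  shows "(\<Oplus>i\<in>{..<d}. g (w i) \<otimes> h (e i)) = (if h = g then \<one> else \<zero>)"
proof -
  let ?k = "inv\<^bsub>G\<^esub> g \<otimes>\<^bsub>G\<^esub> h"
  note HG = subgroup.mem_carrier[OF H]
  have k: "?k \<in> H" using H assms by (simp add: subgroup.m_closed subgroup.m_inv_closed)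
  have "(\<Oplus>i\<in>{..<d}. g (w i) \<otimes> h (e i)) = (\<Oplus>i\<in>{..<d}. g (w i \<otimes> ?k (e i)))"
    using assms HG coordinates_mem by (intro finsum_eqI) auto
  also have "\<dots> = g (\<Oplus>i\<in>{..<d}. w i \<otimes> ?k (e i))"
    using assms HG coordinates_mem by (intro G_finsum[symmetric]) auto
  also have "\<dots> = g (if ?k = \<one>\<^bsub>G\<^esub> then \<one> else \<zero>)" using co k unfolding coordinates_def by simp
  also have "?k = \<one>\<^bsub>G\<^esub> \<longleftrightarrow> h = g" using assms HG
    by (metis Gr.inv_closed Gr.inv_equality Gr.inv_inv Gr.l_inv)
  finally show ?thesis using assms HG by auto
qed

text \<open>By duality, summing \<open>h (w i) * e i\<close> over \<open>i\<close> singles out the summand \<open>h = 1\<close> of the trace.\<close>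

lemma trace_expansion:
  assumes y: "y \<in> M"
  shows "(\<Oplus>i\<in>{..<d}. trace H (w i \<otimes> y) \<otimes> e i) = y"
proof -
  note HG = subgroup.mem_carrier[OF H]
  note closed = HG coordinates_mem y
  have fin: "finite H" using finite_subset[OF subgroup.subset[OF H] finite_G] .
  have "(\<Oplus>i\<in>{..<d}. trace H (w i \<otimes> y) \<otimes> e i) = (\<Oplus>i\<in>{..<d}. \<Oplus>h\<in>H. h (w i \<otimes> y) \<otimes> e i)"
    unfolding trace_def using closed fin by (intro finsum_eqI finsum_ldistr) auto
  also have "\<dots> = (\<Oplus>h\<in>H. \<Oplus>i\<in>{..<d}. h (w i \<otimes> y) \<otimes> e i)"
    using closed fin by (intro finsum_swap) auto
  also have "\<dots> = (\<Oplus>h\<in>H. h y \<otimes> (if h = \<one>\<^bsub>G\<^esub> then \<one> else \<zero>))"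
  proof (rule finsum_eqI)
    fix h assume h: "h \<in> H"
    have "(\<Oplus>i\<in>{..<d}. h (w i \<otimes> y) \<otimes> e i) = (\<Oplus>i\<in>{..<d}. h y \<otimes> (h (w i) \<otimes> \<one>\<^bsub>G\<^esub> (e i)))"
    proof (rule finsum_eqI)
      fix i assume "i \<in> {..<d}"
      then show "h (w i \<otimes> y) \<otimes> e i = h y \<otimes> (h (w i) \<otimes> \<one>\<^bsub>G\<^esub> (e i))"
        using closed h M_comm[of "h (w i)" "h y"] by (simp add: m_assoc)
    qed
    also have "\<dots> = h y \<otimes> (\<Oplus>i\<in>{..<d}. h (w i) \<otimes> \<one>\<^bsub>G\<^esub> (e i))"
      using closed h by (intro finsum_rdistr[symmetric]) auto
    finally show "(\<Oplus>i\<in>{..<d}. h (w i \<otimes> y) \<otimes> e i) = h y \<otimes> (if h = \<one>\<^bsub>G\<^esub> then \<one> else \<zero>)"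
      using duality[OF h subgroup.one_closed[OF H]] by auto
  qed
  also have "\<dots> = \<one>\<^bsub>G\<^esub> y \<otimes> (if \<one>\<^bsub>G\<^esub> = \<one>\<^bsub>G\<^esub> then \<one> else \<zero>)"
    using closed fin subgroup.one_closed[OF H] by (intro finsum_delta) auto
  finally show ?thesis using y by simp
qed

text \<open>The matrices \<open>h (w i)\<close> and \<open>h (e i)\<close> are inverse to each other on both sides, one side being
  duality and the other the trace expansion of the basis; hence they are square.\<close>

lemma degree_eq_card: "d = card H"
proof (rule antisym)
  note HG = subgroup.mem_carrier[OF H]
  note K = subfield_fixed[OF subgroup.subset[OF H]]
  have fin: "finite H" using finite_subset[OF subgroup.subset[OF H] finite_G] .
  have free: "free_family (fixed H) {..<d} e" using co unfolding coordinates_def by blast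
  have tr: "(\<Oplus>h\<in>H. h (w i) \<otimes> h (e j)) = (if i = j then \<one> else \<zero>)" if ij: "i < d" "j < d" for i j
  proof -
    have "(\<Oplus>i\<in>{..<d}. trace H (w i \<otimes> e j) \<otimes> e i) = e j"
      using trace_expansion coordinates_mem ij by simp
    also have "\<dots> = (\<Oplus>i\<in>{..<d}. (if i = j then \<one> else \<zero>) \<otimes> e i)"
      using coordinates_mem ij by (subst finsum_delta[of _ j]) auto
    finally have eq: "(\<Oplus>i\<in>{..<d}. trace H (w i \<otimes> e j) \<otimes> e i) = (\<Oplus>i\<in>{..<d}. (if i = j then \<one> else \<zero>) \<otimes> e i)" .
    have c: "(\<lambda>i. trace H (w i \<otimes> e j)) \<in> {..<d} \<rightarrow> fixed H"
      using coordinates_mem ij by (auto intro!: trace_fixed[OF H])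
    have c': "(\<lambda>i. if i = j then \<one> else \<zero>) \<in> {..<d} \<rightarrow> fixed H"
      using subringE(2,3)[OF subfieldE(1)[OF K]] by auto
    have "e \<in> {..<d} \<rightarrow> carrier A" using coordinates_mem by auto
    from free_family_unique[OF K finite_lessThan this free c c' eq, of i]
    have "trace H (w i \<otimes> e j) = (if i = j then \<one> else \<zero>)" using ij by simp
    moreover have "trace H (w i \<otimes> e j) = (\<Oplus>h\<in>H. h (w i) \<otimes> h (e j))"
      unfolding trace_def using HG coordinates_mem ij by (intro finsum_eqI) auto
    ultimately show ?thesis by simp
  qed
  have "card {..<d} \<le> card H"
    using HG coordinates_mem fin tr
    by (intro card_le_if_right_inverse[OF subfield_M, of H "{..<d}" "\<lambda>i h. h (w i)" "\<lambda>h i. h (e i)"]) auto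
  then show "d \<le> card H" by simp
  have "card H \<le> card {..<d}"
    using HG coordinates_mem fin duality
    by (intro card_le_if_right_inverse[OF subfield_M, of "{..<d}" H "\<lambda>h i. h (w i)" "\<lambda>i h. h (e i)"]) auto
  then show "card H \<le> d" by simp
qed

end

text \<open>Artin's theorem. A basis over \<open>F\<close> still spans \<open>M\<close> over the fixed field, so the degree is finite,
  and then coordinates exist and compute it.\<close>

lemma dimension_over_fixed:
  assumes H: "subgroup H G"
  shows "dimension (card H) (fixed H) M"
proof -
  note K = subfield_fixed[OF subgroup.subset[OF H]]
  obtain b where b: "b \<in> {..<n} \<rightarrow> carrier A" "span_family F {..<n} b = M"
    using dimension_imp_basis[OF subfield_F dimension_M] by blast
  have bM: "b i \<in> M" if "i < n" for i
    using span_family_base[OF subfieldE(1)[OF subfield_F] _ b(1), of i] that b by simp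
  have "span_family (fixed H) {..<n} b = M"
  proof
    show "span_family (fixed H) {..<n} b \<subseteq> M"
      unfolding span_family_def using fixed_M bM by (auto simp: Pi_def intro!: M_finsum)
    have "F \<subseteq> fixed H" using fixed_field_G fixed_antimono[OF subgroup.subset[OF H]] by simp
    then show "M \<subseteq> span_family (fixed H) {..<n} b" using span_family_mono b(2) by blast
  qed
  then obtain d where d: "dimension d (fixed H) M"
    using finite_dimension_span_family[OF K _ b(1)] by auto
  then show ?thesis using coordinates_exist[OF H d] degree_eq_card[OF H] by blast
qed

lemma degree_eq_card_G: "n = card (carrier G)"
  using dimension_is_inj[OF subfield_F dimension_M] dimension_over_fixed[OF Gr.subgroup_self]
  unfolding fixed_field_G .

text \<open>The automorphisms that fix the fixed field of \<open>H\<close> form a group with the same fixed field as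
  \<open>H\<close>, hence, by Artin's theorem, of the same order.\<close>

lemma fixing_imp_mem:
  assumes H: "subgroup H G" and g: "g \<in> carrier G" "\<And>x. x \<in> fixed H \<Longrightarrow> g x = x"
  shows "g \<in> H"
proof -
  let ?K = "{f \<in> carrier G. \<forall>x\<in>fixed H. f x = x}"
  have K: "subgroup ?K G"
  proof (rule Gr.subgroupI)
    show "inv\<^bsub>G\<^esub> f \<in> ?K" if "f \<in> ?K" for f
      using that fixed_M G_inv_apply(2)[of f] by fastforce
    show "f \<otimes>\<^bsub>G\<^esub> f' \<in> ?K" if "f \<in> ?K" "f' \<in> ?K" for f f'
      using that fixed_M by auto
    have "\<one>\<^bsub>G\<^esub> \<in> ?K" using fixed_M by auto
    then show "?K \<noteq> {}" by blast
  qed auto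
  have HK: "H \<subseteq> ?K" using subgroup.mem_carrier[OF H] fixedD by auto
  have eq: "fixed ?K = fixed H"
    using fixed_antimono[OF HK] fixed_M by (auto intro!: fixedI)
  have "card ?K = card H"
    using dimension_is_inj[OF subfield_fixed[OF subgroup.subset[OF H]]
        dimension_over_fixed[OF K, unfolded eq] dimension_over_fixed[OF H]] .
  moreover have "finite ?K" using finite_G by simp
  ultimately have "H = ?K" using card_subset_eq[OF _ HK] by simp
  then show ?thesis using g by blast
qed

lemma dimension_between_fixed:
  assumes H: "subgroup H G" "subgroup H' G" "H \<subseteq> H'" and q: "card H' = q * card H"
  shows "dimension q (fixed H') (fixed H)"
proof -
  have sub: "H \<subseteq> carrier G" "H' \<subseteq> carrier G" using H subgroup.subset by auto
  note K = subfield_fixed[OF sub(1)] and K' = subfield_fixed[OF sub(2)]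
  note KM = fixed_M[of _ H] and K'K = fixed_antimono[OF H(3)]
  have "subalgebra (fixed H') (fixed H) A"
    using subring.axioms(1)[OF subfieldE(1)[OF K]] subringE(6)[OF subfieldE(1)[OF K]] K'K
    unfolding subalgebra_def subalgebra_axioms_def by auto
  then obtain d where d: "dimension d (fixed H') (fixed H)"
    using subalbegra_incl_imp_finite_dimension[OF K' finite_dimensionI[OF dimension_over_fixed[OF H(2)]]]
      KM unfolding finite_dimension_def by blast
  have "dimension (d * card H) (fixed H') M"
    using telescopic_base[OF K' K d dimension_over_fixed[OF H(1)]] .
  then have "d * card H = q * card H"
    using dimension_is_inj[OF K'] dimension_over_fixed[OF H(2)] q by metis
  moreover have "card H > 0"
    using finite_subset[OF sub(1) finite_G] subgroup.one_closed[OF H(1)] by (auto simp: card_gt_0_iff)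
  ultimately show ?thesis using d by simp
qed

definition e :: "nat \<Rightarrow> 'a" where
  "e = (SOME e. \<exists>w. coordinates (carrier G) n e w)"

definition w :: "nat \<Rightarrow> 'a" where
  "w = (SOME w. coordinates (carrier G) n e w)"

lemma coordinates_G: "coordinates (carrier G) n e w"
  unfolding w_def e_def using coordinates_exist[OF Gr.subgroup_self, of n] dimension_M
  unfolding fixed_field_G by (metis (mono_tags, lifting) someI_ex)

lemmas e_mem = coordinates_mem(1)[OF Gr.subgroup_self coordinates_G]
  and w_mem = coordinates_mem(2)[OF Gr.subgroup_self coordinates_G]
  and duality_G = duality[OF Gr.subgroup_self coordinates_G]

lemma free_e: "free_family F {..<n} e"
  using coordinates_G unfolding coordinates_def fixed_field_G by blast

lemma duality_one:
  "g \<in> carrier G \<Longrightarrow> (\<Oplus>i\<in>{..<n}. w i \<otimes> g (e i)) = (if g = \<one>\<^bsub>G\<^esub> then \<one> else \<zero>)"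
  using coordinates_G unfolding coordinates_def by blast

end

section \<open>Centralizers\<close>

lemma (in ring) centralizer_subring:
  assumes "S \<subseteq> carrier R"
  shows "subring (centralizer R S) R"
proof (rule subringI)
  have Sc: "s \<in> carrier R" if "s \<in> S" for s using assms that by auto
  show "centralizer R S \<subseteq> carrier R" unfolding centralizer_def by auto
  show "\<one> \<in> centralizer R S" unfolding centralizer_def using Sc by auto
  show "\<ominus> h \<in> centralizer R S" if "h \<in> centralizer R S" for h
    using that Sc unfolding centralizer_def by (auto simp: l_minus r_minus)
  show "h1 \<otimes> h2 \<in> centralizer R S" if "h1 \<in> centralizer R S" "h2 \<in> centralizer R S" for h1 h2
  proof -
    have "h1 \<otimes> h2 \<otimes> s = s \<otimes> (h1 \<otimes> h2)" if s: "s \<in> S" for s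
    proof -
      have h: "h1 \<in> carrier R" "h2 \<in> carrier R" "h1 \<otimes> s = s \<otimes> h1" "h2 \<otimes> s = s \<otimes> h2"
        using that \<open>h1 \<in> _\<close> \<open>h2 \<in> _\<close> unfolding centralizer_def by auto
      have "h1 \<otimes> h2 \<otimes> s = h1 \<otimes> (h2 \<otimes> s)" using h(1,2) Sc[OF s] by (rule m_assoc)
      also have "\<dots> = h1 \<otimes> s \<otimes> h2" unfolding h(4) using h(1,2) Sc[OF s] by (simp only: m_assoc)
      also have "\<dots> = s \<otimes> h1 \<otimes> h2" by (simp only: h)
      finally show ?thesis using h(1,2) Sc[OF s] by (simp add: m_assoc)
    qed
    then show ?thesis using that unfolding centralizer_def by auto
  qed
  show "h1 \<oplus> h2 \<in> centralizer R S" if "h1 \<in> centralizer R S" "h2 \<in> centralizer R S" for h1 h2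
    using that Sc unfolding centralizer_def by (auto simp: l_distr r_distr)
qed

lemma (in ring) centralizer_inverse:
  assumes "S \<subseteq> carrier R" "x \<in> centralizer R S" "x \<in> Units R"
  shows "inv x \<in> centralizer R S"
proof -
  have x: "x \<in> carrier R" "inv x \<in> carrier R" using assms(3) by auto
  have "inv x \<otimes> s = s \<otimes> inv x" if "s \<in> S" for s
  proof -
    have s: "s \<in> carrier R" "x \<otimes> s = s \<otimes> x" using that assms unfolding centralizer_def by auto
    have "inv x \<otimes> s = inv x \<otimes> (s \<otimes> x) \<otimes> inv x" using x s(1) assms(3) by (simp add: m_assoc)
    also have "\<dots> = inv x \<otimes> (x \<otimes> s) \<otimes> inv x" using s by simp
    also have "\<dots> = (inv x \<otimes> x) \<otimes> s \<otimes> inv x" using x s(1) by (simp add: m_assoc)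
    finally show ?thesis using x s(1) assms(3) by simp
  qed
  then show ?thesis using x unfolding centralizer_def by auto
qed

lemma (in ring) subfield_in_subring:
  assumes "subfield K R" "subring S R" "K \<subseteq> S"
  shows "subfield K (R\<lparr>carrier := S\<rparr>)"
  using ring.subfield_iff(1)[OF subring_is_ring[OF assms(2)], of K] subfield_iff(2)[OF assms(1)] assms(3)
  by simp

lemma (in ring) dimension_in_subring:
  assumes K: "subfield K R" "K \<subseteq> S" and S: "subring S R" and d: "dimension d K E" "E \<subseteq> S"
  shows "ring.dimension (R\<lparr>carrier := S\<rparr>) d K E"
proof -
  interpret S: ring "R\<lparr>carrier := S\<rparr>" by (rule subring_is_ring[OF S])
  show ?thesis
    using d
  proof (induction d arbitrary: E)
    case 0
    then have "E = {\<zero>}" using dimension_zero[OF K(1)] by blast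
    then show ?case using S.zero_dim[of K] by simp
  next
    case (Suc d)
    obtain v E' where v: "v \<in> carrier R" "dimension d K E'" "v \<notin> E'" "E = line_extension K v E'"
      using dimension_backwards[OF K(1) Suc.prems(1)] by blast
    note E' = space_subgroup_props[OF K(1) v(2)]
    note Kr = subringE[OF subfieldE(1)[OF K(1)]]
    have "\<one> \<otimes> v \<oplus> \<zero> \<in> E"
      unfolding v(4) line_extension_mem_iff using Kr(3) E'(2) by blast
    then have "v \<in> S" using Suc.prems(2) v(1) by auto
    moreover have "E' \<subseteq> S"
    proof
      fix x assume x: "x \<in> E'"
      then have "\<zero> \<otimes> v \<oplus> x \<in> E" unfolding v(4) line_extension_mem_iff using Kr(2) by blast
      moreover have "\<zero> \<otimes> v \<oplus> x = x" using v(1) x E'(1) by auto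
      ultimately show "x \<in> S" using Suc.prems(2) by auto
    qed
    ultimately have "S.dimension (Suc d) K (S.line_extension K v E')"
      using Suc.IH[OF v(2)] v(3) by (intro S.Suc_dim) auto
    then show ?case unfolding v(4) line_extension_consistent[OF S] .
  qed
qed

section \<open>Central simple algebras\<close>

text \<open>A central simple algebra acts faithfully on itself from both sides: \<open>x \<mapsto> \<Sum>i. a i * x * b i\<close>
  with independent \<open>b\<close> vanishes only if all \<open>a i\<close> do. The \<open>j\<close>-th coefficients of such relations form
  a two-sided ideal; were it nonzero, some relation would have \<open>j\<close>-th coefficient one, and its
  commutators with elements of the algebra are relations of smaller length.\<close>

lemma (in ring) two_sided_relation_trivial:
  assumes csa: "central_simple_algebra R F" and "finite I"
    and "a \<in> I \<rightarrow> carrier R" "b \<in> I \<rightarrow> carrier R" "free_family F I b"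
    and "\<And>x. x \<in> carrier R \<Longrightarrow> (\<Oplus>i\<in>I. a i \<otimes> x \<otimes> b i) = \<zero>"
  shows "\<forall>i\<in>I. a i = \<zero>"
  using assms(2-)
proof (induction I arbitrary: a)
  case empty
  then show ?case by simp
next
  case (insert j J)
  have F: "subfield F R" and centre: "centralizer R (carrier R) = F"
    and simple: "\<And>T. ideal T R \<Longrightarrow> T = {\<zero>} \<or> T = carrier R"
    using csa unfolding central_simple_algebra_def by auto
  note Fc = subsetD[OF subfieldE(3)[OF F]]
  let ?I = "insert j J"
  have fin: "finite ?I" using insert by simp
  have bc: "b i \<in> carrier R" if "i \<in> ?I" for i using insert.prems(2) that by auto
  define rel where "rel a \<longleftrightarrow> a \<in> ?I \<rightarrow> carrier R \<and> (\<forall>x\<in>carrier R. (\<Oplus>i\<in>?I. a i \<otimes> x \<otimes> b i) = \<zero>)" for a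
  have relD: "a i \<in> carrier R" if "rel a" "i \<in> ?I" for a i using that unfolding rel_def by auto
  have rel0: "(\<Oplus>i\<in>?I. a i \<otimes> x \<otimes> b i) = \<zero>" if "rel a" "x \<in> carrier R" for a x
    using that unfolding rel_def by auto
  have rel_l: "rel (\<lambda>i. r \<otimes> a i)" if a: "rel a" and r: "r \<in> carrier R" for a r
    unfolding rel_def
  proof (intro conjI ballI)
    show "(\<lambda>i. r \<otimes> a i) \<in> ?I \<rightarrow> carrier R" using relD[OF a] r by auto
    fix x assume x: "x \<in> carrier R"
    have "(\<Oplus>i\<in>?I. r \<otimes> a i \<otimes> x \<otimes> b i) = (\<Oplus>i\<in>?I. r \<otimes> (a i \<otimes> x \<otimes> b i))"
      using relD[OF a] r x bc by (intro finsum_eqI) (auto simp: m_assoc)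
    also have "\<dots> = r \<otimes> (\<Oplus>i\<in>?I. a i \<otimes> x \<otimes> b i)"
      using relD[OF a] r x bc fin by (intro finsum_rdistr[symmetric]) auto
    finally show "(\<Oplus>i\<in>?I. r \<otimes> a i \<otimes> x \<otimes> b i) = \<zero>" using rel0[OF a x] r by simp
  qed
  have rel_r: "rel (\<lambda>i. a i \<otimes> r)" if a: "rel a" and r: "r \<in> carrier R" for a r
    unfolding rel_def
  proof (intro conjI ballI)
    show "(\<lambda>i. a i \<otimes> r) \<in> ?I \<rightarrow> carrier R" using relD[OF a] r by auto
    fix x assume x: "x \<in> carrier R"
    have "(\<Oplus>i\<in>?I. a i \<otimes> r \<otimes> x \<otimes> b i) = (\<Oplus>i\<in>?I. a i \<otimes> (r \<otimes> x) \<otimes> b i)"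
      using relD[OF a] r x bc by (intro finsum_eqI) (auto simp: m_assoc)
    then show "(\<Oplus>i\<in>?I. a i \<otimes> r \<otimes> x \<otimes> b i) = \<zero>" using rel0[OF a, of "r \<otimes> x"] r x by simp
  qed
  have rel_add: "rel (\<lambda>i. a i \<oplus> a' i)" if a: "rel a" and a': "rel a'" for a a'
    unfolding rel_def
  proof (intro conjI ballI)
    show "(\<lambda>i. a i \<oplus> a' i) \<in> ?I \<rightarrow> carrier R" using relD[OF a] relD[OF a'] by auto
    fix x assume x: "x \<in> carrier R"
    have "(\<Oplus>i\<in>?I. (a i \<oplus> a' i) \<otimes> x \<otimes> b i) = (\<Oplus>i\<in>?I. a i \<otimes> x \<otimes> b i \<oplus> a' i \<otimes> x \<otimes> b i)"
      using relD[OF a] relD[OF a'] x bc by (intro finsum_eqI) (auto simp: l_distr)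
    also have "\<dots> = (\<Oplus>i\<in>?I. a i \<otimes> x \<otimes> b i) \<oplus> (\<Oplus>i\<in>?I. a' i \<otimes> x \<otimes> b i)"
      using relD[OF a] relD[OF a'] x bc by (intro finsum_addf) auto
    finally show "(\<Oplus>i\<in>?I. (a i \<oplus> a' i) \<otimes> x \<otimes> b i) = \<zero>" using rel0[OF a x] rel0[OF a' x] by simp
  qed
  have short: "\<forall>i\<in>J. a i = \<zero>" if a: "rel a" and aj: "a j = \<zero>" for a
  proof (rule insert.IH)
    show "a \<in> J \<rightarrow> carrier R" "b \<in> J \<rightarrow> carrier R" using relD[OF a] bc by auto
    show "free_family F J b"
      unfolding free_family_def
    proof (intro ballI impI)
      fix c i assume c: "c \<in> J \<rightarrow> F" "(\<Oplus>i\<in>J. c i \<otimes> b i) = \<zero>" and i: "i \<in> J"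
      let ?c = "c(j := \<zero>)"
      have "?c \<in> ?I \<rightarrow> F" using c(1) subringE(2)[OF subfieldE(1)[OF F]] by auto
      moreover have "(\<Oplus>i\<in>J. ?c i \<otimes> b i) = (\<Oplus>i\<in>J. c i \<otimes> b i)"
        using c(1) Fc bc insert.hyps by (intro finsum_eqI) (auto simp: Pi_def)
      then have "(\<Oplus>i\<in>?I. ?c i \<otimes> b i) = \<zero>"
        using c Fc bc insert.hyps by (subst finsum_insert) (auto simp: Pi_def)
      ultimately have "\<forall>i\<in>?I. ?c i = \<zero>" using insert.prems(3) unfolding free_family_def by blast
      then have "?c i = \<zero>" using i by blast
      then show "c i = \<zero>" using i insert.hyps by (auto split: if_splits)
    qed
    fix x assume x: "x \<in> carrier R"
    have "(\<Oplus>i\<in>?I. a i \<otimes> x \<otimes> b i) = a j \<otimes> x \<otimes> b j \<oplus> (\<Oplus>i\<in>J. a i \<otimes> x \<otimes> b i)"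
      using relD[OF a] bc x insert.hyps by (intro finsum_insert) auto
    moreover have "(\<Oplus>i\<in>J. a i \<otimes> x \<otimes> b i) \<in> carrier R"
      using relD[OF a] bc x by (intro finsum_closed) auto
    ultimately show "(\<Oplus>i\<in>J. a i \<otimes> x \<otimes> b i) = \<zero>" using rel0[OF a x] aj x bc by simp
  qed
  have a: "rel a" unfolding rel_def using insert.prems by auto
  have "a j = \<zero>"
  proof (rule ccontr)
    assume nz: "a j \<noteq> \<zero>"
    define T where "T = {a j |a. rel a}"
    have "ideal T R"
    proof (rule idealI[OF ring_axioms])
      show "subgroup T (add_monoid R)"
      proof (rule add.subgroupI)
        show "T \<subseteq> carrier R" "T \<noteq> {}" unfolding T_def using relD a by auto
        show "\<ominus> t \<in> T" if t: "t \<in> T" for t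
        proof -
          obtain a where "rel a" "t = a j" using t unfolding T_def by blast
          then show ?thesis unfolding T_def using rel_l[of a "\<ominus> \<one>"] relD[of a j]
            by (intro CollectI exI[of _ "\<lambda>i. \<ominus> \<one> \<otimes> a i"]) (auto simp: l_minus)
        qed
        show "t \<oplus> t' \<in> T" if tT: "t \<in> T" "t' \<in> T" for t t'
        proof -
          obtain a a' where aa: "rel a" "rel a'" "t = a j" "t' = a' j" using tT unfolding T_def by blast
          show ?thesis unfolding T_def aa(3,4)
            by (intro CollectI exI[of _ "\<lambda>i. a i \<oplus> a' i"] conjI refl rel_add aa)
        qed
      qed
      show "x \<otimes> t \<in> T" "t \<otimes> x \<in> T" if tT: "t \<in> T" "x \<in> carrier R" for t x
      proof -
        obtain a where aa: "rel a" "t = a j" using tT unfolding T_def by blast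
        show "x \<otimes> t \<in> T" unfolding T_def aa(2)
          by (intro CollectI exI[of _ "\<lambda>i. x \<otimes> a i"] conjI refl rel_l aa tT)
        show "t \<otimes> x \<in> T" unfolding T_def aa(2)
          by (intro CollectI exI[of _ "\<lambda>i. a i \<otimes> x"] conjI refl rel_r aa tT)
      qed
    qed
    moreover have "a j \<in> T" using a unfolding T_def by blast
    ultimately have "\<one> \<in> T" using simple nz by blast
    then obtain e where e: "rel e" "e j = \<one>" unfolding T_def by auto
    have "e i \<in> F" if i: "i \<in> ?I" for i
    proof -
      have "e i \<otimes> y = y \<otimes> e i" if y: "y \<in> carrier R" for y
      proof -
        have r: "rel (\<lambda>i. y \<otimes> e i \<oplus> (e i \<otimes> \<ominus> y))"
          using rel_add[OF rel_l[OF e(1) y] rel_r[OF e(1), of "\<ominus> y"]] y by simp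
        have "y \<otimes> e j \<oplus> (e j \<otimes> \<ominus> y) = \<zero>" using e(2) y by (simp add: r_neg)
        with r have "y \<otimes> e i \<oplus> (e i \<otimes> \<ominus> y) = \<zero>"
          using short[OF r] i by auto
        then have "y \<otimes> e i \<ominus> e i \<otimes> y = \<zero>"
          using relD[OF e(1) i] y by (simp add: r_minus a_minus_def)
        then show ?thesis using relD[OF e(1) i] y by simp
      qed
      then have "e i \<in> centralizer R (carrier R)"
        unfolding centralizer_def using relD[OF e(1) i] by auto
      then show ?thesis using centre by simp
    qed
    then have "e \<in> ?I \<rightarrow> F" by auto
    moreover have "(\<Oplus>i\<in>?I. e i \<otimes> b i) = (\<Oplus>i\<in>?I. e i \<otimes> \<one> \<otimes> b i)"
      using relD[OF e(1)] bc by (intro finsum_eqI) auto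
    then have "(\<Oplus>i\<in>?I. e i \<otimes> b i) = \<zero>" using rel0[OF e(1) one_closed] by simp
    ultimately have "e j = \<zero>" using insert.prems(3) unfolding free_family_def by blast
    then show False using e(2) subfieldE(6)[OF F] by simp
  qed
  then show ?case using short[OF a] by auto
qed

section \<open>Crossed products\<close>

locale crossed_product = galois_subfield +
  assumes csa: "csa_degree A F n"
begin

lemma central_simple: "central_simple_algebra A F" and dimension_A: "dimension (n\<^sup>2) F (carrier A)"
  using csa unfolding csa_degree_def by auto

lemma centre: "centralizer A (carrier A) = F"
  and simple: "\<And>T. ideal T A \<Longrightarrow> T = {\<zero>} \<or> T = carrier A"
  using central_simple unfolding central_simple_algebra_def by auto

lemma F_central: "z \<in> F \<Longrightarrow> a \<in> carrier A \<Longrightarrow> z \<otimes> a = a \<otimes> z"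
  using centre unfolding centralizer_def by auto

text \<open>\<open>A\<close> is graded by the Galois group: \<open>component g\<close> is the \<open>g\<close>-isotypic part of \<open>A\<close> as an
  \<open>M\<close>-bimodule, and the coordinates \<open>e\<close>, \<open>w\<close> project onto it.\<close>

definition component :: "('a \<Rightarrow> 'a) \<Rightarrow> 'a set" where
  "component g = {a \<in> carrier A. \<forall>x\<in>M. a \<otimes> x = g x \<otimes> a}"

definition proj :: "('a \<Rightarrow> 'a) \<Rightarrow> 'a \<Rightarrow> 'a" where
  "proj g a = (\<Oplus>i\<in>{..<n}. g (w i) \<otimes> a \<otimes> e i)"

lemma componentD: "a \<in> component g \<Longrightarrow> a \<in> carrier A" "a \<in> component g \<Longrightarrow> x \<in> M \<Longrightarrow> a \<otimes> x = g x \<otimes> a"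
  unfolding component_def by auto

lemma componentI: "a \<in> carrier A \<Longrightarrow> (\<And>x. x \<in> M \<Longrightarrow> a \<otimes> x = g x \<otimes> a) \<Longrightarrow> a \<in> component g"
  unfolding component_def by auto

lemma proj_closed [simp]: "g \<in> carrier G \<Longrightarrow> a \<in> carrier A \<Longrightarrow> proj g a \<in> carrier A"
  unfolding proj_def using e_mem w_mem by (auto intro!: finsum_closed)

lemma proj_add:
  assumes "g \<in> carrier G" "a \<in> carrier A" "a' \<in> carrier A"
  shows "proj g (a \<oplus> a') = proj g a \<oplus> proj g a'"
proof -
  have "proj g (a \<oplus> a') = (\<Oplus>i\<in>{..<n}. g (w i) \<otimes> a \<otimes> e i
      \<oplus> g (w i) \<otimes> a' \<otimes> e i)"
    unfolding proj_def using assms e_mem w_mem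
    by (intro finsum_eqI) (auto simp: r_distr l_distr)
  also have "\<dots> = proj g a \<oplus> proj g a'"
    unfolding proj_def using assms e_mem w_mem by (intro finsum_addf) auto
  finally show ?thesis .
qed

lemma proj_zero: "g \<in> carrier G \<Longrightarrow> proj g \<zero> = \<zero>"
  using proj_add[of g \<zero> \<zero>] proj_closed[of g \<zero>] by (metis add.l_cancel_one' l_zero zero_closed)

lemma proj_finsum:
  assumes "g \<in> carrier G" "finite I" "f \<in> I \<rightarrow> carrier A"
  shows "proj g (\<Oplus>i\<in>I. f i) = (\<Oplus>i\<in>I. proj g (f i))"
  using additive_finsum[OF abelian_monoid_axioms assms(2,3), of "proj g"] proj_add proj_zero assms(1)
  by auto

text \<open>On \<open>component f\<close> the right factors \<open>e i\<close> move to the left as \<open>f (e i)\<close>, where duality applies.\<close>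

lemma proj_component:
  assumes "g \<in> carrier G" "f \<in> carrier G" "a \<in> component f"
  shows "proj g a = (if f = g then a else \<zero>)"
proof -
  note a = componentD[OF assms(3)]
  have "proj g a = (\<Oplus>i\<in>{..<n}. g (w i) \<otimes> f (e i) \<otimes> a)"
    unfolding proj_def using assms a e_mem w_mem
    by (intro finsum_eqI) (auto simp: m_assoc)
  also have "\<dots> = (\<Oplus>i\<in>{..<n}. g (w i) \<otimes> f (e i)) \<otimes> a"
    using assms a e_mem w_mem by (intro finsum_ldistr[symmetric]) auto
  finally show ?thesis using duality_G[OF assms(1,2)] a(1) by simp
qed

lemma proj_M_left:
  assumes "g \<in> carrier G" "a \<in> carrier A" "z \<in> M"
  shows "proj g (z \<otimes> a) = z \<otimes> proj g a"
proof -
  have "proj g (z \<otimes> a) = (\<Oplus>i\<in>{..<n}. z \<otimes> (g (w i) \<otimes> a \<otimes> e i))"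
    unfolding proj_def
  proof (rule finsum_eqI)
    fix i assume i: "i \<in> {..<n}"
    have "g (w i) \<otimes> z = z \<otimes> g (w i)"
      using assms w_mem i by (intro M_comm) auto
    then have "g (w i) \<otimes> z \<otimes> (a \<otimes> e i) = z \<otimes> g (w i) \<otimes> (a \<otimes> e i)"
      by simp
    then show "g (w i) \<otimes> (z \<otimes> a) \<otimes> e i = z \<otimes> (g (w i) \<otimes> a \<otimes> e i)"
      using assms e_mem w_mem i by (simp add: m_assoc)
  qed
  also have "\<dots> = z \<otimes> proj g a"
    unfolding proj_def using assms e_mem w_mem by (intro finsum_rdistr[symmetric]) auto
  finally show ?thesis .
qed

lemma proj_M_right:
  assumes "g \<in> carrier G" "a \<in> carrier A" "z \<in> M"
  shows "proj g (a \<otimes> z) = proj g a \<otimes> z"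
proof -
  have "proj g (a \<otimes> z) = (\<Oplus>i\<in>{..<n}. g (w i) \<otimes> a \<otimes> e i \<otimes> z)"
    unfolding proj_def
  proof (rule finsum_eqI)
    fix i assume i: "i \<in> {..<n}"
    have "z \<otimes> e i = e i \<otimes> z"
      using assms e_mem i by (intro M_comm) auto
    then show "g (w i) \<otimes> (a \<otimes> z) \<otimes> e i = g (w i) \<otimes> a \<otimes> e i \<otimes> z"
      using assms e_mem w_mem i by (simp add: m_assoc)
  qed
  also have "\<dots> = proj g a \<otimes> z"
    unfolding proj_def using assms e_mem w_mem by (intro finsum_ldistr[symmetric]) auto
  finally show ?thesis .
qed

text \<open>The trace expands \<open>e i * z\<close> in the basis and, by duality, \<open>g (w j * z)\<close> in the conjugates
  \<open>g (w i)\<close>, with one and the same matrix of coefficients.\<close>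

lemma proj_in_component:
  assumes g: "g \<in> carrier G" and a: "a \<in> carrier A"
  shows "proj g a \<in> component g"
proof (rule componentI)
  show "proj g a \<in> carrier A" using assms by simp
  fix z assume z: "z \<in> M"
  let ?t = "\<lambda>j i. trace (carrier G) (w j \<otimes> (e i \<otimes> z))"
  have tF: "?t j i \<in> F" if "j < n" "i < n" for i j
    using trace_fixed[OF Gr.subgroup_self] w_mem e_mem z that
    unfolding fixed_field_G by auto
  have tM: "?t j i \<in> M" if "j < n" "i < n" for i j using tF[OF that] F_subset_M by auto
  note cl = g a z e_mem w_mem tM
  have "proj g a \<otimes> z = (\<Oplus>i\<in>{..<n}. g (w i) \<otimes> a \<otimes> (e i \<otimes> z))"
    unfolding proj_M_right[OF g a z, symmetric]
    unfolding proj_def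
  proof (rule finsum_eqI)
    fix i assume i: "i \<in> {..<n}"
    have "z \<otimes> e i = e i \<otimes> z" using cl i by (intro M_comm) auto
    then show "g (w i) \<otimes> (a \<otimes> z) \<otimes> e i = g (w i) \<otimes> a \<otimes> (e i \<otimes> z)"
      using cl i by (simp add: m_assoc)
  qed
  also have "\<dots> = (\<Oplus>i\<in>{..<n}. \<Oplus>j\<in>{..<n}. ?t j i \<otimes> g (w i) \<otimes> (a \<otimes> e j))"
  proof (rule finsum_eqI)
    fix i assume i: "i \<in> {..<n}"
    have "e i \<otimes> z = (\<Oplus>j\<in>{..<n}. ?t j i \<otimes> e j)"
      using trace_expansion[OF Gr.subgroup_self coordinates_G, of "e i \<otimes> z"] cl i by simp
    then have "g (w i) \<otimes> a \<otimes> (e i \<otimes> z)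
        = g (w i) \<otimes> a \<otimes> (\<Oplus>j\<in>{..<n}. ?t j i \<otimes> e j)" by simp
    also have "\<dots> = (\<Oplus>j\<in>{..<n}. g (w i) \<otimes> a \<otimes> (?t j i \<otimes> e j))"
      using cl i by (intro finsum_rdistr) auto
    also have "\<dots> = (\<Oplus>j\<in>{..<n}. ?t j i \<otimes> g (w i) \<otimes> (a \<otimes> e j))"
    proof (rule finsum_eqI)
      fix j assume j: "j \<in> {..<n}"
      have "g (w i) \<otimes> a \<otimes> ?t j i = ?t j i \<otimes> (g (w i) \<otimes> a)"
        using tF cl i j by (intro F_central[symmetric]) auto
      then have "g (w i) \<otimes> a \<otimes> ?t j i \<otimes> e j
          = ?t j i \<otimes> (g (w i) \<otimes> a) \<otimes> e j" by simp
      then show "g (w i) \<otimes> a \<otimes> (?t j i \<otimes> e j)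
          = ?t j i \<otimes> g (w i) \<otimes> (a \<otimes> e j)"
        using cl i j by (simp add: m_assoc)
    qed
    finally show "g (w i) \<otimes> a \<otimes> (e i \<otimes> z)
        = (\<Oplus>j\<in>{..<n}. ?t j i \<otimes> g (w i) \<otimes> (a \<otimes> e j))" .
  qed
  also have "\<dots> = (\<Oplus>j\<in>{..<n}. \<Oplus>i\<in>{..<n}. ?t j i \<otimes> g (w i) \<otimes> (a \<otimes> e j))"
    using cl by (intro finsum_swap) auto
  also have "\<dots> = (\<Oplus>j\<in>{..<n}. g z \<otimes> (g (w j) \<otimes> a \<otimes> e j))"
  proof (rule finsum_eqI)
    fix j assume j: "j \<in> {..<n}"
    have fin: "finite (carrier G)" by (rule finite_G)
    have "(\<Oplus>i\<in>{..<n}. ?t j i \<otimes> g (w i))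
        = (\<Oplus>i\<in>{..<n}. \<Oplus>h\<in>carrier G. h (w j \<otimes> (e i \<otimes> z)) \<otimes> g (w i))"
      unfolding trace_def using cl j fin by (intro finsum_eqI finsum_ldistr) auto
    also have "\<dots> = (\<Oplus>h\<in>carrier G. \<Oplus>i\<in>{..<n}. h (w j \<otimes> (e i \<otimes> z)) \<otimes> g (w i))"
      using cl j fin by (intro finsum_swap) auto
    also have "\<dots> = (\<Oplus>h\<in>carrier G. h (w j \<otimes> z) \<otimes> (if h = g then \<one> else \<zero>))"
    proof (rule finsum_eqI)
      fix h assume h: "h \<in> carrier G"
      have "(\<Oplus>i\<in>{..<n}. h (w j \<otimes> (e i \<otimes> z)) \<otimes> g (w i))
          = (\<Oplus>i\<in>{..<n}. h (w j \<otimes> z) \<otimes> (g (w i) \<otimes> h (e i)))"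
      proof (rule finsum_eqI)
        fix i assume i: "i \<in> {..<n}"
        have "e i \<otimes> z = z \<otimes> e i" using cl i by (intro M_comm) auto
        then have "h (w j \<otimes> (e i \<otimes> z)) = h (w j \<otimes> z) \<otimes> h (e i)"
          using cl j h i by (simp add: m_assoc)
        moreover have "h (e i) \<otimes> g (w i) = g (w i) \<otimes> h (e i)"
          using cl h i by (intro M_comm) auto
        moreover have "h (w j \<otimes> z) \<in> carrier A" using cl j h by auto
        ultimately show "h (w j \<otimes> (e i \<otimes> z)) \<otimes> g (w i)
            = h (w j \<otimes> z) \<otimes> (g (w i) \<otimes> h (e i))"
          using cl h i by (simp del: G_hom add: m_assoc)
      qed
      also have "\<dots> = h (w j \<otimes> z) \<otimes> (\<Oplus>i\<in>{..<n}. g (w i) \<otimes> h (e i))"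
        using cl j h by (intro finsum_rdistr[symmetric]) auto
      finally show "(\<Oplus>i\<in>{..<n}. h (w j \<otimes> (e i \<otimes> z)) \<otimes> g (w i))
          = h (w j \<otimes> z) \<otimes> (if h = g then \<one> else \<zero>)"
        using duality_G[OF g h] by simp
    qed
    also have "\<dots> = g (w j \<otimes> z) \<otimes> (if g = g then \<one> else \<zero>)"
      using cl j fin by (intro finsum_delta) auto
    also have "\<dots> = g (z \<otimes> w j)" using cl j M_comm[of z "w j"] by simp
    also have "\<dots> = g z \<otimes> g (w j)" using cl j by simp
    finally have "(\<Oplus>i\<in>{..<n}. ?t j i \<otimes> g (w i)) = g z \<otimes> g (w j)" .
    moreover have "(\<Oplus>i\<in>{..<n}. ?t j i \<otimes> g (w i) \<otimes> (a \<otimes> e j))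
        = (\<Oplus>i\<in>{..<n}. ?t j i \<otimes> g (w i)) \<otimes> (a \<otimes> e j)"
      using cl j by (intro finsum_ldistr[symmetric]) auto
    ultimately show "(\<Oplus>i\<in>{..<n}. ?t j i \<otimes> g (w i) \<otimes> (a \<otimes> e j))
        = g z \<otimes> (g (w j) \<otimes> a \<otimes> e j)"
      using cl j by (simp add: m_assoc)
  qed
  also have "\<dots> = g z \<otimes> proj g a"
    unfolding proj_def using cl by (intro finsum_rdistr[symmetric]) auto
  finally show "proj g a \<otimes> z = g z \<otimes> proj g a" .
qed

lemma w_nonzero: "\<exists>i\<in>{..<n}. w i \<noteq> \<zero>"
proof (rule ccontr)
  assume "\<not> ?thesis"
  then have "(\<Oplus>i\<in>{..<n}. w i \<otimes> \<one>\<^bsub>G\<^esub> (e i)) = (\<Oplus>i\<in>{..<n}. \<zero>)"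
    using e_mem by (intro finsum_eqI) auto
  then show False using duality_one[OF Gr.one_closed] by simp
qed

text \<open>Otherwise the projection \<open>\<Sum>i. g (w i) * x * e i\<close> would vanish for all \<open>x\<close>, which the independence
  of \<open>e\<close> forbids in a central simple algebra.\<close>

lemma component_nonzero:
  assumes g: "g \<in> carrier G"
  shows "\<exists>a\<in>component g. a \<noteq> \<zero>"
proof (rule ccontr)
  assume "\<not> ?thesis"
  then have "proj g x = \<zero>" if "x \<in> carrier A" for x using proj_in_component[OF g that] by auto
  then have "\<forall>i\<in>{..<n}. g (w i) = \<zero>"
    using e_mem w_mem free_e g unfolding proj_def
    by (intro two_sided_relation_trivial[OF central_simple, of "{..<n}" _ e]) auto
  then show False using w_nonzero G_nonzero[OF g w_mem] by auto
qed

text \<open>A generator of the component of degree \<open>g\<close>, which turns out to be a line over \<open>M\<close>.\<close>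

definition u :: "('a \<Rightarrow> 'a) \<Rightarrow> 'a" where
  "u g = (SOME a. a \<in> component g \<and> a \<noteq> \<zero>)"

lemma u: "g \<in> carrier G \<Longrightarrow> u g \<in> component g" "g \<in> carrier G \<Longrightarrow> u g \<noteq> \<zero>"
  using someI_ex[of "\<lambda>a. a \<in> component g \<and> a \<noteq> \<zero>"] component_nonzero[of g] unfolding u_def by blast+

lemma u_carrier [simp]: "g \<in> carrier G \<Longrightarrow> u g \<in> carrier A"
  using u componentD by blast

lemma component_mult:
  assumes "f \<in> carrier G" "g \<in> carrier G" "a \<in> component f" "b \<in> component g"
  shows "a \<otimes> b \<in> component (f \<otimes>\<^bsub>G\<^esub> g)"
proof (rule componentI)
  note a = componentD[OF assms(3)] and b = componentD[OF assms(4)]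
  show "a \<otimes> b \<in> carrier A" using a b by simp
  fix x assume x: "x \<in> M"
  have "a \<otimes> b \<otimes> x = a \<otimes> g x \<otimes> b" using a(1) b x assms by (simp add: m_assoc)
  also have "\<dots> = f (g x) \<otimes> a \<otimes> b" using a(2)[of "g x"] x assms by simp
  finally show "a \<otimes> b \<otimes> x = (f \<otimes>\<^bsub>G\<^esub> g) x \<otimes> (a \<otimes> b)" using a(1) b(1) x assms by (simp add: m_assoc)
qed

lemma component_smult:
  assumes "g \<in> carrier G" "m \<in> M" "a \<in> component g"
  shows "m \<otimes> a \<in> component g"
proof (rule componentI)
  note a = componentD[OF assms(3)]
  show "m \<otimes> a \<in> carrier A" using a assms by simp
  fix x assume x: "x \<in> M"
  have "m \<otimes> a \<otimes> x = m \<otimes> g x \<otimes> a" using a x assms by (simp add: m_assoc)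
  also have "m \<otimes> g x = g x \<otimes> m" using x assms by (intro M_comm) auto
  finally show "m \<otimes> a \<otimes> x = g x \<otimes> (m \<otimes> a)" using a(1) x assms by (simp add: m_assoc)
qed

lemma smult_eq_zero:
  assumes "m \<in> M" "a \<in> carrier A" "m \<otimes> a = \<zero>"
  shows "m = \<zero> \<or> a = \<zero>"
proof (rule disjCI)
  assume "a \<noteq> \<zero>"
  show "m = \<zero>"
  proof (rule ccontr)
    assume "m \<noteq> \<zero>"
    then have m: "inv m \<in> M" "inv m \<otimes> m = \<one>" using M_inv assms by auto
    have "a = inv m \<otimes> m \<otimes> a" using m assms by simp
    also have "\<dots> = inv m \<otimes> (m \<otimes> a)" using m(1) assms by (simp only: m_assoc M_carrier)
    finally show False using assms m \<open>a \<noteq> \<zero>\<close> by simp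
  qed
qed

lemma free_u:
  assumes "H \<subseteq> carrier G"
  shows "free_family M H u"
  unfolding free_family_def
proof (intro ballI impI)
  have fin: "finite H" using finite_subset[OF assms finite_G] .
  have HG: "h \<in> carrier G" if "h \<in> H" for h using assms that by auto
  fix c h assume c: "c \<in> H \<rightarrow> M" "(\<Oplus>g\<in>H. c g \<otimes> u g) = \<zero>" and h: "h \<in> H"
  have cM: "c g \<in> M" if "g \<in> H" for g using c that by auto
  have "\<zero> = proj h (\<Oplus>g\<in>H. c g \<otimes> u g)" using c proj_zero HG[OF h] by simp
  also have "\<dots> = (\<Oplus>g\<in>H. proj h (c g \<otimes> u g))"
    using cM HG h fin by (intro proj_finsum) auto
  also have "\<dots> = proj h (c h \<otimes> u h)"
  proof (rule finsum_delta[OF fin h])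
    show "(\<lambda>g. proj h (c g \<otimes> u g)) \<in> H \<rightarrow> carrier A" using cM HG h by auto
    fix g assume "g \<in> H" "g \<noteq> h"
    then show "proj h (c g \<otimes> u g) = \<zero>"
      using proj_component[OF HG[OF h] HG component_smult[OF HG cM u(1)[OF HG]]] by auto
  qed
  also have "\<dots> = c h \<otimes> u h"
    using proj_component[OF HG[OF h] HG[OF h] component_smult[OF HG[OF h] cM[OF h] u(1)[OF HG[OF h]]]] by simp
  finally have "c h \<otimes> u h = \<zero>" by (rule sym)
  then show "c h = \<zero>" using smult_eq_zero[OF cM[OF h] u_carrier[OF HG[OF h]]] u(2)[OF HG[OF h]] by blast
qed

text \<open>The tower law: \<open>A\<close> has dimension \<open>n\<^sup>2\<close> over \<open>F\<close> and \<open>M\<close> has dimension \<open>n\<close>.\<close>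

lemma dimension_A_over_M: "dimension n M (carrier A)"
proof -
  obtain b where b: "b \<in> {..<n\<^sup>2} \<rightarrow> carrier A" "span_family F {..<n\<^sup>2} b = carrier A"
    using dimension_imp_basis[OF subfield_F dimension_A] by blast
  have "span_family M {..<n\<^sup>2} b = carrier A"
  proof
    show "span_family M {..<n\<^sup>2} b \<subseteq> carrier A"
      unfolding span_family_def using b(1) by (auto simp: Pi_def intro!: finsum_closed)
    have "span_family F {..<n\<^sup>2} b \<subseteq> span_family M {..<n\<^sup>2} b"
      unfolding span_family_def using F_subset_M by blast
    then show "carrier A \<subseteq> span_family M {..<n\<^sup>2} b" using b by simp
  qed
  then obtain m where m: "dimension m M (carrier A)"
    using finite_dimension_span_family[OF subfield_M, of "{..<n\<^sup>2}" b] b(1) by auto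
  have "n * m = n\<^sup>2"
    using dimension_is_inj[OF subfield_F telescopic_base[OF subfield_F subfield_M dimension_M m] dimension_A] .
  moreover have "n > 0" unfolding degree_eq_card_G
    using finite_G Gr.one_closed by (auto simp: card_gt_0_iff)
  ultimately show ?thesis using m by (simp add: power2_eq_square)
qed

text \<open>The \<open>u g\<close> are independent over \<open>M\<close> and there are \<open>n\<close> of them, as many as the dimension of \<open>A\<close>
  over \<open>M\<close>.\<close>

lemma span_u: "span_family M (carrier G) u = carrier A"
  using free_family_spans[OF subfield_M _ finite_G, of "carrier A" u] dimension_A_over_M free_u
  unfolding degree_eq_card_G by auto

lemma decomposition:
  assumes a: "a \<in> carrier A"
  obtains m where "m \<in> carrier G \<rightarrow> M" "a = (\<Oplus>g\<in>carrier G. m g \<otimes> u g)"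
    "\<And>g. g \<in> carrier G \<Longrightarrow> proj g a = m g \<otimes> u g"
proof -
  obtain m where m: "m \<in> carrier G \<rightarrow> M" "a = (\<Oplus>g\<in>carrier G. m g \<otimes> u g)"
    using span_family_coeff[of a M "carrier G" u] a unfolding span_u by blast
  have mM: "m g \<in> M" if "g \<in> carrier G" for g using m that by auto
  have "proj h a = m h \<otimes> u h" if h: "h \<in> carrier G" for h
  proof -
    have "proj h a = (\<Oplus>g\<in>carrier G. proj h (m g \<otimes> u g))"
      unfolding m(2) using mM h finite_G by (intro proj_finsum) auto
    also have "\<dots> = proj h (m h \<otimes> u h)"
    proof (rule finsum_delta[OF finite_G h])
      show "(\<lambda>g. proj h (m g \<otimes> u g)) \<in> carrier G \<rightarrow> carrier A" using mM h by auto
      fix g assume "g \<in> carrier G" "g \<noteq> h"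
      then show "proj h (m g \<otimes> u g) = \<zero>"
        using proj_component[OF h _ component_smult[OF _ mM u(1)]] by auto
    qed
    also have "\<dots> = m h \<otimes> u h"
      using proj_component[OF h h component_smult[OF h mM[OF h] u(1)[OF h]]] by simp
    finally show ?thesis .
  qed
  then show thesis using that m by blast
qed

lemma decomposition_proj:
  assumes "a \<in> carrier A"
  shows "a = (\<Oplus>g\<in>carrier G. proj g a)"
proof -
  obtain m where m: "m \<in> carrier G \<rightarrow> M" "a = (\<Oplus>g\<in>carrier G. m g \<otimes> u g)"
    "\<And>g. g \<in> carrier G \<Longrightarrow> proj g a = m g \<otimes> u g" using decomposition[OF assms] by blast
  have "(\<Oplus>g\<in>carrier G. proj g a) = (\<Oplus>g\<in>carrier G. m g \<otimes> u g)"
    using m(1,3) by (intro finsum_eqI) (auto simp: Pi_def)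
  then show ?thesis using m(2) by simp
qed

lemma component_eq:
  assumes g: "g \<in> carrier G" and a: "a \<in> component g"
  shows "\<exists>m\<in>M. a = m \<otimes> u g"
proof -
  obtain m where m: "m \<in> carrier G \<rightarrow> M"
    "\<And>g. g \<in> carrier G \<Longrightarrow> proj g a = m g \<otimes> u g" using decomposition[OF componentD(1)[OF a]] by blast
  then show ?thesis using proj_component[OF g g a] g by auto
qed

text \<open>The component of degree one is the centralizer of \<open>M\<close>. It is a line over \<open>M\<close> and contains one.\<close>

lemma component_one: "component \<one>\<^bsub>G\<^esub> = M"
proof
  show "M \<subseteq> component \<one>\<^bsub>G\<^esub>" by (auto intro!: componentI M_comm)
  then have "\<one> \<in> component \<one>\<^bsub>G\<^esub>" by auto
  then obtain m where m: "m \<in> M" "\<one> = m \<otimes> u \<one>\<^bsub>G\<^esub>" using component_eq[OF Gr.one_closed] by blast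
  then have "m \<noteq> \<zero>" by auto
  then have i: "inv m \<in> M" "inv m \<otimes> m = \<one>" using M_inv m by auto
  have "inv m = inv m \<otimes> (m \<otimes> u \<one>\<^bsub>G\<^esub>)" using m i by (metis M_carrier r_one)
  also have "\<dots> = inv m \<otimes> m \<otimes> u \<one>\<^bsub>G\<^esub>" using m(1) i(1) by (simp add: m_assoc)
  finally have "u \<one>\<^bsub>G\<^esub> \<in> M" using i by simp
  then show "component \<one>\<^bsub>G\<^esub> \<subseteq> M"
    using component_eq[OF Gr.one_closed] M_closed(1)[of _ "u \<one>\<^bsub>G\<^esub>"] by (metis subsetI)
qed

end

context crossed_product
begin

text \<open>In complementary degrees a nonzero product is a nonzero element of \<open>M\<close>, so it provides
  one-sided inverses, and then so does the product in the other order.\<close>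

lemma unit_if_product_nonzero:
  assumes f: "f \<in> carrier G" "g \<in> carrier G" "f \<otimes>\<^bsub>G\<^esub> g = \<one>\<^bsub>G\<^esub>"
    and ab: "a \<in> component f" "b \<in> component g" "a \<otimes> b \<noteq> \<zero>"
  shows "a \<in> Units A"
proof -
  have ac: "a \<in> carrier A" "b \<in> carrier A" using ab componentD by blast+
  have gf: "g \<otimes>\<^bsub>G\<^esub> f = \<one>\<^bsub>G\<^esub>" using f by (metis Gr.inv_equality Gr.inv_inv Gr.l_inv)
  define m where "m = a \<otimes> b"
  define m' where "m' = b \<otimes> a"
  have m: "m \<in> M" "m \<noteq> \<zero>"
    using component_mult[OF f(1,2) ab(1,2)] f(3) ab(3) component_one unfolding m_def by auto
  have m': "m' \<in> M"
    using component_mult[OF f(2,1) ab(2,1)] gf component_one unfolding m'_def by auto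
  have "a \<noteq> \<zero>" using ab(3) ac by auto
  then have "m \<otimes> a \<noteq> \<zero>" using smult_eq_zero[OF m(1) ac(1)] m(2) by blast
  moreover have "m \<otimes> a = a \<otimes> m'" unfolding m_def m'_def using ac by (simp add: m_assoc)
  ultimately have m'0: "m' \<noteq> \<zero>" using ac by auto
  have r: "b \<otimes> inv m \<in> carrier A" "a \<otimes> (b \<otimes> inv m) = \<one>"
    using M_inv[OF m] ac unfolding m_def[symmetric]
    by (simp_all add: m_assoc[symmetric] m_def[symmetric])
  have l: "inv m' \<otimes> b \<in> carrier A" "inv m' \<otimes> b \<otimes> a = \<one>"
    using M_inv[OF m' m'0] ac by (simp_all add: m_assoc m'_def[symmetric])
  have "b \<otimes> inv m = inv m' \<otimes> b"
    using inv_unique[OF l(2) r(2) ac(1) l(1) r(1)] by simp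
  then show ?thesis unfolding Units_def using l r ac by auto
qed

text \<open>If \<open>u g\<close> were annihilated from the right by the component of degree \<open>g\<^sup>-\<^sup>1\<close>, then
  \<open>proj 1 (u g * y) = \<Sum>i. w i * u g * y * e i\<close> would vanish for all \<open>y\<close>, contrary to the independence of
  \<open>e\<close>.\<close>

lemma u_Units:
  assumes g: "g \<in> carrier G"
  shows "u g \<in> Units A"
proof -
  note cl = e_mem w_mem u_carrier[OF g]
  have "\<exists>y\<in>carrier A. proj \<one>\<^bsub>G\<^esub> (u g \<otimes> y) \<noteq> \<zero>"
  proof (rule ccontr)
    assume none: "\<not> ?thesis"
    have "(\<Oplus>i\<in>{..<n}. w i \<otimes> u g \<otimes> y \<otimes> e i) = \<zero>" if y: "y \<in> carrier A" for y
    proof -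
      have "(\<Oplus>i\<in>{..<n}. w i \<otimes> u g \<otimes> y \<otimes> e i) = proj \<one>\<^bsub>G\<^esub> (u g \<otimes> y)"
        unfolding proj_def using cl y by (intro finsum_eqI) (auto simp: m_assoc)
      then show ?thesis using none y by simp
    qed
    then have "\<forall>i\<in>{..<n}. w i \<otimes> u g = \<zero>"
      using cl free_e by (intro two_sided_relation_trivial[OF central_simple, of "{..<n}" _ e]) auto
    then show False using w_nonzero smult_eq_zero[OF w_mem cl(3)] u(2)[OF g] by auto
  qed
  then obtain y where y: "y \<in> carrier A" "proj \<one>\<^bsub>G\<^esub> (u g \<otimes> y) \<noteq> \<zero>" by blast
  let ?h = "inv\<^bsub>G\<^esub> g"
  have "u g \<otimes> proj ?h y \<noteq> \<zero>"
  proof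
    assume zero: "u g \<otimes> proj ?h y = \<zero>"
    have "u g \<otimes> y = u g \<otimes> (\<Oplus>h\<in>carrier G. proj h y)" using decomposition_proj[OF y(1)] by simp
    also have "\<dots> = (\<Oplus>h\<in>carrier G. u g \<otimes> proj h y)"
      using y cl finite_G by (intro finsum_rdistr) auto
    finally have "proj \<one>\<^bsub>G\<^esub> (u g \<otimes> y) = (\<Oplus>h\<in>carrier G. proj \<one>\<^bsub>G\<^esub> (u g \<otimes> proj h y))"
      using proj_finsum[OF Gr.one_closed finite_G, of "\<lambda>h. u g \<otimes> proj h y"] y cl by auto
    also have "\<dots> = (\<Oplus>h\<in>carrier G. \<zero>)"
    proof (rule finsum_eqI)
      fix h assume h: "h \<in> carrier G"
      show "proj \<one>\<^bsub>G\<^esub> (u g \<otimes> proj h y) = \<zero>"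
      proof (cases "g \<otimes>\<^bsub>G\<^esub> h = \<one>\<^bsub>G\<^esub>")
        case True
        then have "h = ?h" using g h by (metis Gr.inv_equality Gr.inv_inv)
        then show ?thesis using zero proj_zero[OF Gr.one_closed] by simp
      next
        case False
        then show ?thesis
          using proj_component[OF Gr.one_closed _ component_mult[OF g h u(1)[OF g] proj_in_component[OF h y(1)]]] g h
          by simp
      qed
    qed
    finally show False using y(2) by simp
  qed
  then show ?thesis
    using unit_if_product_nonzero[OF g Gr.inv_closed[OF g] Gr.r_inv[OF g] u(1)[OF g]
        proj_in_component[OF Gr.inv_closed[OF g] y(1)]] by blast
qed

lemma conj_component:
  assumes f: "f \<in> carrier G" and x: "x \<in> component f" "x \<in> Units A" and z: "z \<in> M"
  shows "x \<otimes> z \<otimes> inv x = f z"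
proof -
  have xc: "x \<in> carrier A" "inv x \<in> carrier A" using x by auto
  have "x \<otimes> z \<otimes> inv x = f z \<otimes> x \<otimes> inv x" using componentD(2)[OF x(1) z] by simp
  then show ?thesis using xc x f z by (simp add: m_assoc)
qed

lemma component_Units:
  assumes "g \<in> carrier G" "a \<in> component g" "a \<noteq> \<zero>"
  shows "a \<in> Units A"
proof -
  obtain m where m: "m \<in> M" "a = m \<otimes> u g" using component_eq[OF assms(1,2)] by blast
  have "m \<noteq> \<zero>" using m assms by auto
  then have "m \<in> Units A" unfolding Units_def using M_inv[OF m(1)] m(1) by auto
  then show ?thesis using m u_Units[OF assms(1)] by auto
qed

section \<open>Centralizers of intermediate fields\<close>

abbreviation C :: "('a \<Rightarrow> 'a) set \<Rightarrow> 'a set" where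
  "C H \<equiv> centralizer A (fixed H)"

lemma subring_C: "subring (C H) A"
  using fixed_M by (intro centralizer_subring) auto

lemma C_carrier: "a \<in> C H \<Longrightarrow> a \<in> carrier A"
  unfolding centralizer_def by auto

lemma C_I: "a \<in> carrier A \<Longrightarrow> (\<And>z. z \<in> fixed H \<Longrightarrow> a \<otimes> z = z \<otimes> a) \<Longrightarrow> a \<in> C H"
  unfolding centralizer_def by auto

lemma C_D: "a \<in> C H \<Longrightarrow> z \<in> fixed H \<Longrightarrow> a \<otimes> z = z \<otimes> a"
  unfolding centralizer_def by auto

lemma C_mono: "H \<subseteq> H' \<Longrightarrow> C H \<subseteq> C H'"
  using fixed_antimono unfolding centralizer_def by blast

lemma M_subset_C: "M \<subseteq> C H"
  using fixed_M M_comm by (auto intro!: C_I)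

lemma component_subset_C: "g \<in> H \<Longrightarrow> component g \<subseteq> C H"
  using componentD fixed_M fixedD by (auto intro!: C_I) metis

text \<open>A nonzero element of degree \<open>g\<close> that commutes with \<open>z\<close> forces \<open>g z = z\<close>; by the Galois
  correspondence, \<open>g\<close> lies in \<open>H\<close> if this happens for the whole fixed field.\<close>

lemma component_meets_C:
  assumes H: "subgroup H G" and g: "g \<in> carrier G" and a: "a \<in> component g" "a \<in> C H" "a \<noteq> \<zero>"
  shows "g \<in> H"
proof (rule fixing_imp_mem[OF H g])
  fix z assume z: "z \<in> fixed H"
  have zM: "z \<in> M" using z fixed_M by blast
  have ac: "a \<in> carrier A" using a componentD by blast
  have "g z \<otimes> a = z \<otimes> a" using C_D[OF a(2) z] componentD(2)[OF a(1) zM] by simp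
  then have "(g z \<ominus> z) \<otimes> a = \<zero>" using g zM ac by (simp add: a_minus_def l_distr l_minus r_neg)
  then have "g z \<ominus> z = \<zero>" using smult_eq_zero[of "g z \<ominus> z" a] g zM ac a(3) by simp
  then show "g z = z" using g zM by simp
qed

lemma proj_C:
  assumes "g \<in> carrier G" "a \<in> C H"
  shows "proj g a \<in> C H"
proof (rule C_I)
  have a: "a \<in> carrier A" using assms C_carrier by blast
  show "proj g a \<in> carrier A" using a assms by simp
  fix z assume z: "z \<in> fixed H"
  have zM: "z \<in> M" using z fixed_M by blast
  show "proj g a \<otimes> z = z \<otimes> proj g a"
    using proj_M_left[OF assms(1) a zM] proj_M_right[OF assms(1) a zM] C_D[OF assms(2) z] by simp
qed

lemma C_decomposition:
  assumes H: "subgroup H G" and a: "a \<in> C H"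
  shows "a = (\<Oplus>g\<in>H. proj g a)"
proof -
  have ac: "a \<in> carrier A" using a C_carrier by blast
  have "proj g a = \<zero>" if "g \<in> carrier G - H" for g
    using component_meets_C[OF H, of g "proj g a"] proj_in_component[of g a] proj_C[of g a H] a ac that by auto
  then have "(\<Oplus>g\<in>carrier G. proj g a) = (\<Oplus>g\<in>H. proj g a)"
    using subgroup.subset[OF H] ac
    by (intro add.finprod_mono_neutral_cong_right[OF finite_G]) auto
  then show ?thesis using decomposition_proj[OF ac] by simp
qed

lemma C_eq_span:
  assumes H: "subgroup H G"
  shows "span_family M H u = C H"
proof
  note HG = subgroup.mem_carrier[OF H]
  have fin: "finite H" using finite_subset[OF subgroup.subset[OF H] finite_G] .
  show "span_family M H u \<subseteq> C H"
  proof
    fix a assume "a \<in> span_family M H u"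
    then obtain m where m: "m \<in> H \<rightarrow> M" "a = (\<Oplus>g\<in>H. m g \<otimes> u g)" by (rule span_family_coeff)
    have "m g \<otimes> u g \<in> C H" if g: "g \<in> H" for g
      using component_subset_C[OF g] component_smult[OF HG[OF g] _ u(1)[OF HG[OF g]], of "m g"] m(1) g by auto
    then show "a \<in> C H" unfolding m(2) using finsum_mem_subring[OF subring_C fin] by auto
  qed
  show "C H \<subseteq> span_family M H u"
  proof
    fix a assume a: "a \<in> C H"
    obtain m where m: "m \<in> carrier G \<rightarrow> M" "\<And>g. g \<in> carrier G \<Longrightarrow> proj g a = m g \<otimes> u g"
      using decomposition[OF C_carrier[OF a]] by blast
    have "a = (\<Oplus>g\<in>H. m g \<otimes> u g)"
      using C_decomposition[OF H a] m HG
      by (metis (no_types, lifting) add.finprod_cong' C_carrier Pi_I a proj_closed)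
    moreover have "m \<in> H \<rightarrow> M" using m(1) HG by auto
    ultimately show "a \<in> span_family M H u" unfolding span_family_def by blast
  qed
qed

lemma C_one: "C {\<one>\<^bsub>G\<^esub>} = M"
proof
  have "component \<one>\<^bsub>G\<^esub> \<subseteq> M" using component_one by simp
  moreover have "C {\<one>\<^bsub>G\<^esub>} \<subseteq> component \<one>\<^bsub>G\<^esub>"
    unfolding fixed_one by (auto intro!: componentI simp: centralizer_def)
  ultimately show "C {\<one>\<^bsub>G\<^esub>} \<subseteq> M" by blast
qed (rule M_subset_C)

lemma C_G: "C (carrier G) = carrier A"
  unfolding fixed_field_G centralizer_def using F_central by auto

lemma dimension_C:
  assumes H: "subgroup H G"
  shows "dimension ((card H)\<^sup>2) (fixed H) (C H)"
proof -
  note HG = subgroup.mem_carrier[OF H]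
  have fin: "finite H" using finite_subset[OF subgroup.subset[OF H] finite_G] .
  have "dimension (card H) M (C H)"
    using dimension_span_free_family[OF subfield_M fin _ free_u[OF subgroup.subset[OF H]]] HG C_eq_span[OF H]
    by auto
  then show ?thesis
    using telescopic_base[OF subfield_fixed[OF subgroup.subset[OF H]] subfield_M dimension_over_fixed[OF H]]
    by (simp add: power2_eq_square)
qed

text \<open>The projections of an element of an ideal stay in the ideal, because they are combinations with
  coefficients in \<open>M\<close> on both sides; a nonzero one is a unit.\<close>

lemma simple_C:
  assumes H: "subgroup H G" and T: "ideal T (A\<lparr>carrier := C H\<rparr>)" and nz: "T \<noteq> {\<zero>}"
  shows "T = C H"
proof -
  interpret T: ideal T "A\<lparr>carrier := C H\<rparr>" by (rule T)
  note HG = subgroup.mem_carrier[OF H]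
  have TC: "T \<subseteq> C H" using T.a_subset by simp
  have T0: "\<zero> \<in> T" using additive_subgroup.zero_closed[OF ideal.axioms(1)[OF T]] by simp
  have Tadd: "x \<oplus> y \<in> T" if "x \<in> T" "y \<in> T" for x y using additive_subgroup.a_closed[OF ideal.axioms(1)[OF T] that] by simp
  have Tl: "r \<otimes> x \<in> T" "x \<otimes> r \<in> T" if "x \<in> T" "r \<in> C H" for x r
    using T.I_l_closed[of x r] T.I_r_closed[of x r] that by simp_all
  obtain a where a: "a \<in> T" "a \<noteq> \<zero>" using nz T0 by blast
  have aC: "a \<in> C H" using a TC by blast
  have "\<exists>g\<in>H. proj g a \<noteq> \<zero>"
  proof (rule ccontr)
    assume "\<not> ?thesis"
    then have "(\<Oplus>g\<in>H. proj g a) = (\<Oplus>g\<in>H. \<zero>)" by (intro finsum_eqI) auto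
    then show False using C_decomposition[OF H aC] a by simp
  qed
  then obtain g where g: "g \<in> H" "proj g a \<noteq> \<zero>" by blast
  have "proj g a \<in> T"
    unfolding proj_def
  proof -
    have "g (w i) \<otimes> a \<otimes> e i \<in> T" if "i < n" for i
    proof -
      have "g (w i) \<in> C H" "e i \<in> C H"
        using e_mem[OF that] G_M[OF HG[OF g(1)] w_mem[OF that]] M_subset_C by auto
      then show ?thesis by (intro Tl a)
    qed
    moreover have "T \<subseteq> carrier A" using TC C_carrier by blast
    ultimately show "(\<Oplus>i\<in>{..<n}. g (w i) \<otimes> a \<otimes> e i) \<in> T"
      using additive_finsum[OF abelian_monoid_axioms, of "{..<n}" "\<lambda>i. g (w i) \<otimes> a \<otimes> e i" T "\<lambda>x. x"]
        T0 Tadd by auto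
  qed
  moreover have U: "proj g a \<in> Units A"
    using component_Units[OF HG[OF g(1)] proj_in_component[OF HG[OF g(1)] C_carrier[OF aC]] g(2)] .
  moreover have "inv (proj g a) \<in> C H"
    using centralizer_inverse[OF _ proj_C[OF HG[OF g(1)] aC] U] fixed_M by (simp add: subset_iff)
  ultimately have "inv (proj g a) \<otimes> proj g a \<in> T" using Tl by blast
  then have "\<one> \<in> T" using U by simp
  then show ?thesis using TC Tl(1)[of \<one>] C_carrier by (metis r_one subsetI subset_antisym)
qed

text \<open>An element that commutes with the whole centralizer commutes with \<open>M\<close>, so it lies in \<open>M\<close>, and it
  commutes with \<open>u g\<close> for \<open>g \<in> H\<close>, so it is fixed by \<open>H\<close>.\<close>

lemma csa_C:
  assumes H: "subgroup H G"
  shows "csa_degree (A\<lparr>carrier := C H\<rparr>) (fixed H) (card H)"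
proof -
  let ?C = "A\<lparr>carrier := C H\<rparr>"
  note HG = subgroup.mem_carrier[OF H]
  note K = subfield_fixed[OF subgroup.subset[OF H]]
  have KC: "fixed H \<subseteq> C H" using fixed_M M_subset_C by blast
  have dim: "ring.dimension ?C ((card H)\<^sup>2) (fixed H) (C H)"
    using dimension_in_subring[OF K KC subring_C dimension_C[OF H]] by simp
  have "centralizer ?C (C H) = fixed H"
  proof
    show "fixed H \<subseteq> centralizer ?C (C H)"
      using KC C_D unfolding centralizer_def[of ?C] by (auto simp del: G_M)
    show "centralizer ?C (C H) \<subseteq> fixed H"
    proof
      fix a assume "a \<in> centralizer ?C (C H)"
      then have a: "a \<in> C H" "\<And>s. s \<in> C H \<Longrightarrow> a \<otimes> s = s \<otimes> a" unfolding centralizer_def[of ?C] by auto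
      have ac: "a \<in> carrier A" using a C_carrier by blast
      have "a \<in> component \<one>\<^bsub>G\<^esub>" using ac a(2)[OF subsetD[OF M_subset_C]] by (auto intro!: componentI)
      then have aM: "a \<in> M" using component_one by simp
      show "a \<in> fixed H"
      proof (rule fixedI[OF aM])
        fix g assume g: "g \<in> H"
        have "u g \<in> C H" using component_subset_C[OF g] u(1)[OF HG[OF g]] by blast
        then have "u g \<otimes> a = a \<otimes> u g" using a(2) by simp
        then have "g a = a \<otimes> u g \<otimes> inv (u g)" using conj_component[OF HG[OF g] u(1)[OF HG[OF g]] u_Units[OF HG[OF g]] aM] by simp
        then show "g a = a" using ac u_Units[OF HG[OF g]] HG[OF g] by (simp add: m_assoc)
      qed
    qed
  qed
  moreover have "ring ?C" using subring_is_ring[OF subring_C] .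
  moreover have "subfield (fixed H) ?C" using subfield_in_subring[OF K subring_C KC] .
  moreover have "\<forall>I. ideal I ?C \<longrightarrow> I = {\<zero>\<^bsub>?C\<^esub>} \<or> I = carrier ?C" using simple_C[OF H] by auto
  ultimately show ?thesis
    unfolding csa_degree_def central_simple_algebra_def using dim by auto
qed

end

section \<open>Twisted polynomial rings\<close>

locale twisted = ring B for B (structure) +
  fixes \<tau> :: "'a \<Rightarrow> 'a"
  assumes twist: "\<tau> \<in> ring_hom B B"
begin

abbreviation TP :: "(nat \<Rightarrow> 'a) ring" where
  "TP \<equiv> twisted_poly B \<tau>"

lemma twist_pow_closed: "x \<in> carrier B \<Longrightarrow> (\<tau> ^^ i) x \<in> carrier B"
  using ring_hom_closed[OF twist] by (induction i) auto

lemma twist_pow: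
  "x \<in> carrier B \<Longrightarrow> (\<tau> ^^ i) x \<in> carrier B"
  "x \<in> carrier B \<Longrightarrow> y \<in> carrier B \<Longrightarrow> (\<tau> ^^ i) (x \<oplus> y) = (\<tau> ^^ i) x \<oplus> (\<tau> ^^ i) y"
  "x \<in> carrier B \<Longrightarrow> y \<in> carrier B \<Longrightarrow> (\<tau> ^^ i) (x \<otimes> y) = (\<tau> ^^ i) x \<otimes> (\<tau> ^^ i) y"
  "(\<tau> ^^ i) \<one> = \<one>"
  using twist_pow_closed ring_hom_add[OF twist] ring_hom_mult[OF twist] ring_hom_one[OF twist]
  by (auto intro: twist_pow_closed) (induction i; simp add: twist_pow_closed)+

lemma twist_pow_zero: "(\<tau> ^^ i) \<zero> = \<zero>"
  using twist_pow(2)[of \<zero> \<zero> i] twist_pow(1)[of \<zero> i] by (simp add: add.l_cancel_one)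

lemma twist_pow_finsum:
  assumes "finite I" "f \<in> I \<rightarrow> carrier B"
  shows "(\<tau> ^^ k) (\<Oplus>i\<in>I. f i) = (\<Oplus>i\<in>I. (\<tau> ^^ k) (f i))"
  using additive_finsum[OF abelian_monoid_axioms assms, of "\<tau> ^^ k"] twist_pow twist_pow_zero by auto

lemma TP_simps:
  "carrier TP = up B" "\<one>\<^bsub>TP\<^esub> = (\<lambda>i. if i = 0 then \<one> else \<zero>)" "\<zero>\<^bsub>TP\<^esub> = (\<lambda>i. \<zero>)"
  "p \<oplus>\<^bsub>TP\<^esub> q = (\<lambda>i. p i \<oplus> q i)"
  "p \<otimes>\<^bsub>TP\<^esub> q = (\<lambda>n. \<Oplus>i\<in>{..n}. p i \<otimes> (\<tau> ^^ i) (q (n - i)))"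
  unfolding twisted_poly_def by simp_all

lemma up_mem: "p \<in> up B \<Longrightarrow> p i \<in> carrier B"
  by (rule mem_upD)

lemma up_bound: 
  assumes "p \<in> up B" 
  obtains N where "\<And>i. i > N \<Longrightarrow> p i = \<zero>"
  using bound_upD[OF assms] by (auto simp: bound_def)

lemma up_I:
  assumes "\<And>i. p i \<in> carrier B" "\<And>i. i > N \<Longrightarrow> p i = \<zero>"
  shows "p \<in> up B"
  using assms by (intro mem_upI exI[of _ N]) (auto simp: bound_def)

lemma TP_mult_closed:
  assumes p: "p \<in> up B" and q: "q \<in> up B"
  shows "p \<otimes>\<^bsub>TP\<^esub> q \<in> up B"
proof -
  obtain N where N: "\<And>i. i > N \<Longrightarrow> p i = \<zero>" using up_bound[OF p] by blast
  obtain L where L: "\<And>i. i > L \<Longrightarrow> q i = \<zero>" using up_bound[OF q] by blast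
  have "(\<Oplus>i\<in>{..n}. p i \<otimes> (\<tau> ^^ i) (q (n - i))) = \<zero>" if n: "n > N + L" for n
  proof -
    have "p i \<otimes> (\<tau> ^^ i) (q (n - i)) = \<zero>" for i
    proof (cases "i > N")
      case True
      then show ?thesis using N twist_pow(1) up_mem[OF q] by simp
    next
      case False
      then have "q (n - i) = \<zero>" using n by (intro L) simp
      then show ?thesis using twist_pow_zero up_mem[OF p] by simp
    qed
    then show ?thesis by simp
  qed
  then show ?thesis unfolding TP_simps
    using up_mem[OF p] up_mem[OF q] twist_pow(1) by (intro up_I) (auto intro!: finsum_closed)
qed

text \<open>Both products have the coefficients \<open>\<Sum> p i * \<tau>\<^sup>i (q j) * \<tau>\<^sup>i\<^sup>+\<^sup>j (r k)\<close>, summed over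
  \<open>i + j + k = n\<close>.\<close>

lemma TP_assoc:
  assumes "p \<in> up B" "q \<in> up B" "r \<in> up B"
  shows "(p \<otimes>\<^bsub>TP\<^esub> q) \<otimes>\<^bsub>TP\<^esub> r = p \<otimes>\<^bsub>TP\<^esub> (q \<otimes>\<^bsub>TP\<^esub> r)"
proof
  fix n
  note cl = up_mem[OF assms(1)] up_mem[OF assms(2)] up_mem[OF assms(3)] twist_pow(1)
  let ?F = "\<lambda>i j. p i \<otimes> (\<tau> ^^ i) (q j) \<otimes> (\<tau> ^^ (i + j)) (r (n - (i + j)))"
  have "((p \<otimes>\<^bsub>TP\<^esub> q) \<otimes>\<^bsub>TP\<^esub> r) n = (\<Oplus>k\<in>{..n}. \<Oplus>i\<in>{..k}. ?F i (k - i))"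
    unfolding TP_simps
  proof (rule finsum_eqI)
    fix k
    have "(\<Oplus>i\<in>{..k}. p i \<otimes> (\<tau> ^^ i) (q (k - i))) \<otimes> (\<tau> ^^ k) (r (n - k))
        = (\<Oplus>i\<in>{..k}. p i \<otimes> (\<tau> ^^ i) (q (k - i)) \<otimes> (\<tau> ^^ k) (r (n - k)))"
      using cl by (intro finsum_ldistr) auto
    also have "\<dots> = (\<Oplus>i\<in>{..k}. ?F i (k - i))" using cl by (intro finsum_eqI) auto
    finally show "(\<Oplus>i\<in>{..k}. p i \<otimes> (\<tau> ^^ i) (q (k - i))) \<otimes> (\<tau> ^^ k) (r (n - k)) = (\<Oplus>i\<in>{..k}. ?F i (k - i))" .
  qed
  also have "\<dots> = (\<Oplus>i\<in>{..n}. \<Oplus>j\<in>{..n - i}. ?F i j)"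
    using cl by (intro finsum_triangle) auto
  also have "\<dots> = (p \<otimes>\<^bsub>TP\<^esub> (q \<otimes>\<^bsub>TP\<^esub> r)) n"
    unfolding TP_simps
  proof (rule finsum_eqI)
    fix i
    have "(\<tau> ^^ i) (\<Oplus>j\<in>{..n - i}. q j \<otimes> (\<tau> ^^ j) (r (n - i - j)))
        = (\<Oplus>j\<in>{..n - i}. (\<tau> ^^ i) (q j \<otimes> (\<tau> ^^ j) (r (n - i - j))))"
      using cl by (intro twist_pow_finsum) auto
    then have "p i \<otimes> (\<tau> ^^ i) (\<Oplus>j\<in>{..n - i}. q j \<otimes> (\<tau> ^^ j) (r (n - i - j)))
        = (\<Oplus>j\<in>{..n - i}. p i \<otimes> (\<tau> ^^ i) (q j \<otimes> (\<tau> ^^ j) (r (n - i - j))))"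
      using cl by (subst finsum_rdistr[symmetric]) auto
    also have "\<dots> = (\<Oplus>j\<in>{..n - i}. ?F i j)"
      using cl by (intro finsum_eqI) (auto simp: twist_pow(3) m_assoc funpow_add)
    finally show "(\<Oplus>j\<in>{..n - i}. ?F i j)
        = p i \<otimes> (\<tau> ^^ i) (\<Oplus>j\<in>{..n - i}. q j \<otimes> (\<tau> ^^ j) (r (n - i - j)))" by (rule sym)
  qed
  finally show "((p \<otimes>\<^bsub>TP\<^esub> q) \<otimes>\<^bsub>TP\<^esub> r) n = (p \<otimes>\<^bsub>TP\<^esub> (q \<otimes>\<^bsub>TP\<^esub> r)) n" .
qed

lemma ring_TP: "ring TP"
proof (rule ringI)
  show "abelian_group TP"
  proof (rule abelian_groupI)
    show "p \<oplus>\<^bsub>TP\<^esub> q \<in> carrier TP" if "p \<in> carrier TP" "q \<in> carrier TP" for p q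
      using up_add_closed[of p q] that unfolding TP_simps by blast
    show "\<zero>\<^bsub>TP\<^esub> \<in> carrier TP" unfolding TP_simps by (rule up_I) auto
    show "p \<oplus>\<^bsub>TP\<^esub> q \<oplus>\<^bsub>TP\<^esub> r = p \<oplus>\<^bsub>TP\<^esub> (q \<oplus>\<^bsub>TP\<^esub> r)"
      if "p \<in> carrier TP" "q \<in> carrier TP" "r \<in> carrier TP" for p q r
      using that unfolding TP_simps by (auto simp: up_mem a_assoc)
    show "p \<oplus>\<^bsub>TP\<^esub> q = q \<oplus>\<^bsub>TP\<^esub> p" if "p \<in> carrier TP" "q \<in> carrier TP" for p q
      using that unfolding TP_simps by (auto simp: up_mem a_comm)
    show "\<zero>\<^bsub>TP\<^esub> \<oplus>\<^bsub>TP\<^esub> p = p" if "p \<in> carrier TP" for p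
      using that unfolding TP_simps by (auto simp: up_mem)
    show "\<exists>q\<in>carrier TP. q \<oplus>\<^bsub>TP\<^esub> p = \<zero>\<^bsub>TP\<^esub>" if p: "p \<in> carrier TP" for p
      using p up_a_inv_closed[of p] unfolding TP_simps
      by (intro bexI[of _ "\<lambda>i. \<ominus> p i"]) (auto simp: up_mem l_neg)
  qed
  show "monoid TP"
  proof (rule monoidI)
    show "p \<otimes>\<^bsub>TP\<^esub> q \<in> carrier TP" if "p \<in> carrier TP" "q \<in> carrier TP" for p q
      using TP_mult_closed[of p q] that TP_simps(1) by simp
    show "\<one>\<^bsub>TP\<^esub> \<in> carrier TP" unfolding TP_simps by (rule up_I[of _ 0]) auto
    show "p \<otimes>\<^bsub>TP\<^esub> q \<otimes>\<^bsub>TP\<^esub> r = p \<otimes>\<^bsub>TP\<^esub> (q \<otimes>\<^bsub>TP\<^esub> r)"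
      if "p \<in> carrier TP" "q \<in> carrier TP" "r \<in> carrier TP" for p q r
      using TP_assoc[of p q r] that TP_simps(1) by simp
    show "\<one>\<^bsub>TP\<^esub> \<otimes>\<^bsub>TP\<^esub> p = p" if p: "p \<in> carrier TP" for p
    proof
      fix n
      have p: "p i \<in> carrier B" for i using p up_mem unfolding TP_simps by blast
      have "(\<Oplus>i\<in>{..n}. (if i = 0 then \<one> else \<zero>) \<otimes> (\<tau> ^^ i) (p (n - i)))
          = (if (0::nat) = 0 then \<one> else \<zero>) \<otimes> (\<tau> ^^ 0) (p (n - 0))"
        using p twist_pow(1) by (intro finsum_delta) auto
      then show "(\<one>\<^bsub>TP\<^esub> \<otimes>\<^bsub>TP\<^esub> p) n = p n" unfolding TP_simps using p by simp
    qed
    show "p \<otimes>\<^bsub>TP\<^esub> \<one>\<^bsub>TP\<^esub> = p" if p: "p \<in> carrier TP" for p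
    proof
      fix n
      have p: "p i \<in> carrier B" for i using p up_mem unfolding TP_simps by blast
      have "(\<Oplus>i\<in>{..n}. p i \<otimes> (\<tau> ^^ i) (if n - i = 0 then \<one> else \<zero>))
          = p n \<otimes> (\<tau> ^^ n) (if n - n = 0 then \<one> else \<zero>)"
        using p by (intro finsum_delta) (auto simp: twist_pow(4) twist_pow_zero)
      then show "(p \<otimes>\<^bsub>TP\<^esub> \<one>\<^bsub>TP\<^esub>) n = p n" unfolding TP_simps using p by (simp add: twist_pow(4))
    qed
  qed
  show "(p \<oplus>\<^bsub>TP\<^esub> q) \<otimes>\<^bsub>TP\<^esub> r = p \<otimes>\<^bsub>TP\<^esub> r \<oplus>\<^bsub>TP\<^esub> q \<otimes>\<^bsub>TP\<^esub> r"
    if "p \<in> carrier TP" "q \<in> carrier TP" "r \<in> carrier TP" for p q r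
    using that unfolding TP_simps
    by (subst finsum_addf[symmetric]) (auto simp: up_mem twist_pow l_distr intro!: finsum_eqI)
  show "r \<otimes>\<^bsub>TP\<^esub> (p \<oplus>\<^bsub>TP\<^esub> q) = r \<otimes>\<^bsub>TP\<^esub> p \<oplus>\<^bsub>TP\<^esub> r \<otimes>\<^bsub>TP\<^esub> q"
    if "p \<in> carrier TP" "q \<in> carrier TP" "r \<in> carrier TP" for p q r
    using that unfolding TP_simps
    by (subst finsum_addf[symmetric]) (auto simp: up_mem twist_pow r_distr intro!: finsum_eqI)
qed

lemma TP_minus:
  assumes "p \<in> up B" "q \<in> up B"
  shows "p \<ominus>\<^bsub>TP\<^esub> q = (\<lambda>i. p i \<ominus> q i)"
proof -
  interpret T: ring TP by (rule ring_TP)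
  have q': "(\<lambda>i. \<ominus> q i) \<in> carrier TP" using up_a_inv_closed[OF assms(2)] TP_simps(1) by simp
  have "\<ominus>\<^bsub>TP\<^esub> q = (\<lambda>i. \<ominus> q i)"
    using assms(2) q' by (intro T.minus_equality) (auto simp: TP_simps up_mem l_neg)
  then show ?thesis unfolding a_minus_def TP_simps by simp
qed

lemma monomial_up: "a \<in> carrier B \<Longrightarrow> monomial B a k \<in> up B"
  unfolding monomial_def by (rule up_I[of _ k]) auto

lemma cyclic_poly_coeff:
  assumes "c \<in> carrier B"
  shows "cyclic_poly B \<tau> q c = (\<lambda>i. (if i = q then \<one> else \<zero>) \<ominus> (if i = 0 then c else \<zero>))"
  unfolding cyclic_poly_def using TP_minus[OF monomial_up[OF one_closed] monomial_up[OF assms]]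
  unfolding monomial_def .

lemma cyclic_poly_up:
  assumes "c \<in> carrier B"
  shows "cyclic_poly B \<tau> q c \<in> up B"
  unfolding cyclic_poly_coeff[OF assms] using assms by (intro up_I[of _ q]) auto

end

section \<open>Recognising generalised cyclic algebras\<close>

text \<open>The relation \<open>u * b = \<tau> b * u\<close> is the one of the variable \<open>t\<close>, so \<open>t \<mapsto> u\<close> extends to a ring
  homomorphism from twisted polynomials over \<open>S\<close> to \<open>E\<close>. The image is a quotient of the polynomial
  ring, and the generalised cyclic algebra arises when the kernel is generated by \<open>t ^ q - c\<close>.\<close>

locale twisted_evaluation = ring E for E (structure) +
  fixes S :: "'a set" and \<tau> :: "'a \<Rightarrow> 'a" and u :: 'a
  assumes subring_S: "subring S E"
    and twist_S: "\<tau> \<in> ring_hom (E\<lparr>carrier := S\<rparr>) (E\<lparr>carrier := S\<rparr>)"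
    and u_closed: "u \<in> carrier E"
    and u_comm: "\<And>b. b \<in> S \<Longrightarrow> u \<otimes> b = \<tau> b \<otimes> u"
begin

abbreviation B where "B \<equiv> E\<lparr>carrier := S\<rparr>"

sublocale T: twisted B \<tau>
  unfolding twisted_def twisted_axioms_def using subring_is_ring[OF subring_S] twist_S by simp

sublocale TP: ring "twisted_poly B \<tau>"
  by (rule T.ring_TP)

definition evaluate :: "(nat \<Rightarrow> 'a) \<Rightarrow> 'a" where
  "evaluate p = (\<Oplus>i\<in>{i. p i \<noteq> \<zero>}. p i \<otimes> u [^] i)"

lemma S_carrier: "x \<in> S \<Longrightarrow> x \<in> carrier E"
  using subringE(1)[OF subring_S] by auto

lemma coeff_S: "p \<in> up B \<Longrightarrow> p i \<in> S"
  using T.up_mem by simp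

lemma evaluate_bound:
  assumes "p \<in> up B" "\<And>i. i \<notin> J \<Longrightarrow> p i = \<zero>" "finite J"
  shows "evaluate p = (\<Oplus>i\<in>J. p i \<otimes> u [^] i)"
  unfolding evaluate_def
  using assms(2,3) coeff_S[OF assms(1)] S_carrier u_closed
  by (intro add.finprod_mono_neutral_cong_left) auto

lemma u_pow_comm: "b \<in> S \<Longrightarrow> u [^] i \<otimes> b = (\<tau> ^^ i) b \<otimes> u [^] i"
proof (induction i)
  case 0
  then show ?case using S_carrier by simp
next
  case (Suc i)
  have tS: "(\<tau> ^^ i) b \<in> S" "\<tau> ((\<tau> ^^ i) b) \<in> S"
    using T.twist_pow(1)[of b i] T.twist_pow(1)[of b "Suc i"] Suc.prems by simp_all
  have "u [^] Suc i \<otimes> b = u \<otimes> (u [^] i \<otimes> b)"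
    using u_closed S_carrier[OF Suc.prems] nat_pow_Suc2[OF u_closed, of i] by (simp add: m_assoc)
  also have "\<dots> = u \<otimes> (\<tau> ^^ i) b \<otimes> u [^] i"
    using Suc u_closed S_carrier[OF tS(1)] by (simp add: m_assoc)
  also have "\<dots> = \<tau> ((\<tau> ^^ i) b) \<otimes> u \<otimes> u [^] i" using u_comm[OF tS(1)] by simp
  also have "\<dots> = (\<tau> ^^ Suc i) b \<otimes> u [^] Suc i"
    using u_closed S_carrier[OF tS(2)] nat_pow_Suc2[OF u_closed, of i] by (simp add: m_assoc)
  finally show ?case .
qed

lemma evaluate_closed: 
  assumes "p \<in> up B" shows "evaluate p \<in> carrier E"
  unfolding evaluate_def using coeff_S[OF assms] S_carrier u_closed by (intro finsum_closed) auto

lemma evaluate_add: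
  assumes p: "p \<in> up B" and r: "r \<in> up B"
  shows "evaluate (p \<oplus>\<^bsub>twisted_poly B \<tau>\<^esub> r) = evaluate p \<oplus> evaluate r"
proof -
  obtain N where N: "\<And>i. i > N \<Longrightarrow> p i = \<zero>" using T.up_bound[OF p] by auto
  obtain L where L: "\<And>i. i > L \<Longrightarrow> r i = \<zero>" using T.up_bound[OF r] by auto
  note cl = coeff_S[OF p, THEN S_carrier] coeff_S[OF r, THEN S_carrier]
  have pr: "(\<lambda>i. p i \<oplus> r i) \<in> up B" using T.up_add_closed[OF p r] by simp
  have "evaluate (\<lambda>i. p i \<oplus> r i) = (\<Oplus>i\<in>{..N + L}. (p i \<oplus> r i) \<otimes> u [^] i)"
    using N L by (intro evaluate_bound[OF pr]) auto
  also have "\<dots> = (\<Oplus>i\<in>{..N + L}. p i \<otimes> u [^] i \<oplus> r i \<otimes> u [^] i)"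
    using cl u_closed by (intro finsum_eqI) (auto simp: l_distr)
  also have "\<dots> = (\<Oplus>i\<in>{..N + L}. p i \<otimes> u [^] i) \<oplus> (\<Oplus>i\<in>{..N + L}. r i \<otimes> u [^] i)"
    using cl u_closed by (intro finsum_addf) auto
  also have "(\<Oplus>i\<in>{..N + L}. p i \<otimes> u [^] i) = evaluate p"
    using N by (intro evaluate_bound[OF p, symmetric]) auto
  also have "(\<Oplus>i\<in>{..N + L}. r i \<otimes> u [^] i) = evaluate r"
    using L by (intro evaluate_bound[OF r, symmetric]) auto
  finally show ?thesis unfolding T.TP_simps by simp
qed

lemma evaluate_mult:
  assumes p: "p \<in> up B" and r: "r \<in> up B"
  shows "evaluate (p \<otimes>\<^bsub>twisted_poly B \<tau>\<^esub> r) = evaluate p \<otimes> evaluate r"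
proof -
  obtain N where N: "\<And>i. i > N \<Longrightarrow> p i = \<zero>" using T.up_bound[OF p] by auto
  obtain L where L: "\<And>i. i > L \<Longrightarrow> r i = \<zero>" using T.up_bound[OF r] by auto
  have tS: "(\<tau> ^^ i) (r j) \<in> S" for i j using T.twist_pow(1) coeff_S[OF r] by simp
  note cl = coeff_S[OF p, THEN S_carrier] coeff_S[OF r, THEN S_carrier] tS[THEN S_carrier]
  note pS = coeff_S[OF p] 
  let ?F = "\<lambda>i j. p i \<otimes> (\<tau> ^^ i) (r j) \<otimes> u [^] (i + j)"
  let ?pr = "p \<otimes>\<^bsub>twisted_poly B \<tau>\<^esub> r"
  have mS: "p i \<otimes> (\<tau> ^^ i) (r j) \<in> S" for i j using subringE(6)[OF subring_S pS tS] .
  have coeff: "?pr k = (\<Oplus>i\<in>{..k}. p i \<otimes> (\<tau> ^^ i) (r (k - i)))" for k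
    unfolding T.TP_simps using finsum_subring[OF subring_S, of "{..k}"] mS by simp
  have zero: "?pr k = \<zero>" if k: "k > N + L" for k
  proof -
    have "p i \<otimes> (\<tau> ^^ i) (r (k - i)) = \<zero>" for i
    proof (cases "i > N")
      case True
      then show ?thesis using N cl by simp
    next
      case False
      then have "r (k - i) = \<zero>" using k by (intro L) simp
      then show ?thesis using T.twist_pow_zero[of i] cl by simp
    qed
    then show ?thesis unfolding coeff by simp
  qed
  have "evaluate ?pr = (\<Oplus>k\<in>{..N + L}. ?pr k \<otimes> u [^] k)"
    using zero by (intro evaluate_bound[OF T.TP_mult_closed[OF p r]]) auto
  also have "\<dots> = (\<Oplus>k\<in>{..N + L}. \<Oplus>i\<in>{..k}. ?F i (k - i))"
  proof (rule finsum_eqI)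
    fix k
    have "?pr k \<otimes> u [^] k = (\<Oplus>i\<in>{..k}. p i \<otimes> (\<tau> ^^ i) (r (k - i)) \<otimes> u [^] k)"
      unfolding coeff using cl u_closed by (intro finsum_ldistr) auto
    also have "\<dots> = (\<Oplus>i\<in>{..k}. ?F i (k - i))" using cl u_closed by (intro finsum_eqI) auto
    finally show "?pr k \<otimes> u [^] k = (\<Oplus>i\<in>{..k}. ?F i (k - i))" .
  qed
  also have "\<dots> = (\<Oplus>i\<in>{..N + L}. \<Oplus>j\<in>{..N + L - i}. ?F i j)"
    using cl u_closed by (intro finsum_triangle) auto
  also have "\<dots> = (\<Oplus>i\<in>{..N + L}. p i \<otimes> u [^] i \<otimes> evaluate r)"
  proof (rule finsum_eqI)
    fix i assume "i \<in> {..N + L}"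
    show "(\<Oplus>j\<in>{..N + L - i}. ?F i j) = p i \<otimes> u [^] i \<otimes> evaluate r"
    proof (cases "i > N")
      case True
      then show ?thesis using N cl u_closed evaluate_closed[OF r] by simp
    next
      case False
      have "evaluate r = (\<Oplus>j\<in>{..N + L - i}. r j \<otimes> u [^] j)"
        using L False by (intro evaluate_bound[OF r]) auto
      then have "p i \<otimes> u [^] i \<otimes> evaluate r = (\<Oplus>j\<in>{..N + L - i}. p i \<otimes> u [^] i \<otimes> (r j \<otimes> u [^] j))"
        using cl u_closed by (subst finsum_rdistr[symmetric]) auto
      also have "\<dots> = (\<Oplus>j\<in>{..N + L - i}. ?F i j)"
      proof (rule finsum_eqI)
        fix j
        have "p i \<otimes> u [^] i \<otimes> (r j \<otimes> u [^] j) = p i \<otimes> (u [^] i \<otimes> r j) \<otimes> u [^] j"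
          using cl u_closed by (simp add: m_assoc)
        also have "\<dots> = p i \<otimes> ((\<tau> ^^ i) (r j) \<otimes> u [^] i) \<otimes> u [^] j"
          using u_pow_comm[OF coeff_S[OF r]] by simp
        also have "\<dots> = ?F i j" using cl u_closed by (simp add: m_assoc nat_pow_mult)
        finally show "p i \<otimes> u [^] i \<otimes> (r j \<otimes> u [^] j) = ?F i j" .
      qed
      finally show ?thesis by (rule sym)
    qed
  qed
  also have "\<dots> = (\<Oplus>i\<in>{..N + L}. p i \<otimes> u [^] i) \<otimes> evaluate r"
    using cl u_closed evaluate_closed[OF r] by (intro finsum_ldistr[symmetric]) auto
  also have "(\<Oplus>i\<in>{..N + L}. p i \<otimes> u [^] i) = evaluate p"
    using N by (intro evaluate_bound[OF p, symmetric]) auto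
  finally show ?thesis .
qed

lemma evaluate_monomial:
  assumes "b \<in> S"
  shows "evaluate (monomial B b k) = b \<otimes> u [^] k"
proof -
  have "evaluate (monomial B b k) = (\<Oplus>i\<in>{k}. monomial B b k i \<otimes> u [^] i)"
    using assms by (intro evaluate_bound T.monomial_up) (auto simp: monomial_def)
  also have "\<dots> = b \<otimes> u [^] k" using S_carrier[OF assms] u_closed by (simp add: monomial_def)
  finally show ?thesis .
qed

lemma evaluate_ring_hom: "evaluate \<in> ring_hom (twisted_poly B \<tau>) E"
proof (rule ring_hom_memI)
  have "\<one>\<^bsub>twisted_poly B \<tau>\<^esub> = monomial B \<one> 0" unfolding T.TP_simps monomial_def by (auto simp: fun_eq_iff)
  then show "evaluate \<one>\<^bsub>twisted_poly B \<tau>\<^esub> = \<one>"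
    using evaluate_monomial[OF subringE(3)[OF subring_S], of 0] by simp
qed (use evaluate_closed evaluate_mult evaluate_add T.TP_simps(1) in auto)

sublocale ev: ring_hom_ring "twisted_poly B \<tau>" E evaluate
  by (intro ring_hom_ringI2 TP.ring_axioms ring_axioms evaluate_ring_hom)

text \<open>The data of a generalised cyclic algebra inside \<open>E\<close>: every element of \<open>E\<close> is uniquely a
  polynomial of degree below \<open>q\<close> in \<open>u\<close> with coefficients in \<open>S\<close>, and \<open>u ^ q\<close> is one of the
  coefficients.\<close>

context
  fixes q :: nat and c :: 'a
  assumes q: "0 < q" and c: "c \<in> S" "u [^] q = c"
    and free: "free_family S {..<q} (\<lambda>i. u [^] i)"
    and span: "span_family S {..<q} (\<lambda>i. u [^] i) = carrier E"
begin

abbreviation cpoly where "cpoly \<equiv> cyclic_poly B \<tau> q c"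

lemma cpoly_up: "cpoly \<in> up B"
  using T.cyclic_poly_up c by simp

lemma evaluate_cpoly: "evaluate cpoly = \<zero>"
proof -
  have 1: "\<one> \<in> S" using subringE(3)[OF subring_S] .
  have m: "monomial B \<one>\<^bsub>B\<^esub> q \<in> carrier (twisted_poly B \<tau>)" "monomial B c 0 \<in> carrier (twisted_poly B \<tau>)"
    using T.monomial_up[of \<one> q] T.monomial_up[of c 0] 1 c(1) unfolding T.TP_simps(1) by simp_all
  have "evaluate cpoly = evaluate (monomial B \<one>\<^bsub>B\<^esub> q) \<ominus> evaluate (monomial B c 0)"
    unfolding cyclic_poly_def a_minus_def
    using ev.hom_add[OF m(1) TP.a_inv_closed[OF m(2)]] ev.hom_a_inv[OF m(2)] by simp
  also have "\<dots> = u [^] q \<ominus> c"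
    using evaluate_monomial[OF 1, of q] evaluate_monomial[OF c(1), of 0] S_carrier[OF c(1)] u_closed by simp
  finally show ?thesis using c S_carrier[OF c(1)] by (simp add: a_minus_def r_neg)
qed

lemma polys_below_up: "p \<in> polys_below B q \<Longrightarrow> p \<in> up B"
  unfolding polys_below_def by simp

lemma evaluate_below:
  assumes "p \<in> polys_below B q"
  shows "evaluate p = (\<Oplus>i\<in>{..<q}. p i \<otimes> u [^] i)"
  using assms by (intro evaluate_bound) (auto simp: polys_below_def)

lemma below_I: "(\<And>i. p i \<in> S) \<Longrightarrow> (\<And>i. i \<ge> q \<Longrightarrow> p i = \<zero>) \<Longrightarrow> p \<in> polys_below B q"
  unfolding polys_below_def by (auto intro!: T.up_I[of _ q])

lemma below_coeff: "p \<in> polys_below B q \<Longrightarrow> p i \<in> S" "p \<in> polys_below B q \<Longrightarrow> i \<ge> q \<Longrightarrow> p i = \<zero>"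
  by (simp_all add: coeff_S polys_below_def)

lemma evaluate_below_zero:
  assumes p: "p \<in> polys_below B q" and "evaluate p = \<zero>"
  shows "p = (\<lambda>i. \<zero>)"
proof
  fix i
  have "p \<in> {..<q} \<rightarrow> S" using below_coeff[OF p] by auto
  then have "\<forall>i\<in>{..<q}. p i = \<zero>"
    using bspec[OF free[unfolded free_family_def]] evaluate_below[OF p] assms(2) by simp
  then show "p i = \<zero>" using below_coeff(2)[OF p, of i] by (cases "i < q") auto
qed

lemma evaluate_bij: "bij_betw evaluate (polys_below B q) (carrier E)"
  unfolding bij_betw_def
proof
  show "inj_on evaluate (polys_below B q)"
  proof (rule inj_onI)
    fix p r assume p: "p \<in> polys_below B q" and r: "r \<in> polys_below B q" and eq: "evaluate p = evaluate r"
    note pu = polys_below_up[OF p] and ru = polys_below_up[OF r]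
    note puc = pu[folded T.TP_simps(1)] and ruc = ru[folded T.TP_simps(1)]
    let ?d = "p \<ominus>\<^bsub>twisted_poly B \<tau>\<^esub> r"
    have d: "?d = (\<lambda>i. p i \<ominus>\<^bsub>B\<^esub> r i)" using T.TP_minus[OF pu ru] .
    have "?d \<in> polys_below B q"
    proof (rule below_I)
      show "?d i \<in> S" for i using T.minus_closed[of "p i" "r i"] below_coeff(1)[OF p] below_coeff(1)[OF r]
        unfolding d by simp
      show "?d i = \<zero>" if "i \<ge> q" for i
        using below_coeff(2)[OF p that] below_coeff(2)[OF r that] T.r_right_minus_eq[of \<zero> \<zero>]
          subringE(2)[OF subring_S] unfolding d by simp
    qed
    moreover have "evaluate ?d = \<zero>"
      using ev.hom_add[OF puc TP.a_inv_closed[OF ruc]] ev.hom_a_inv[OF ruc] eq evaluate_closed[OF ru]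
      unfolding a_minus_def by (simp add: r_neg)
    ultimately have "?d = \<zero>\<^bsub>twisted_poly B \<tau>\<^esub>"
      using evaluate_below_zero unfolding T.TP_simps by simp
    then show "p = r" using TP.r_right_minus_eq[OF puc ruc] by simp
  qed
  show "evaluate ` polys_below B q = carrier E"
  proof
    show "evaluate ` polys_below B q \<subseteq> carrier E" using evaluate_closed polys_below_up by auto
    show "carrier E \<subseteq> evaluate ` polys_below B q"
    proof
      fix x assume "x \<in> carrier E"
      then obtain p where p: "p \<in> {..<q} \<rightarrow> S" "x = (\<Oplus>i\<in>{..<q}. p i \<otimes> u [^] i)"
        using span unfolding span_family_def by blast
      let ?p = "\<lambda>i. if i < q then p i else \<zero>"
      have below: "?p \<in> polys_below B q"
        using p(1) subringE(2)[OF subring_S] by (intro below_I) auto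
      have "evaluate ?p = x"
        unfolding evaluate_below[OF below] p(2) using p(1) S_carrier u_closed
        by (intro finsum_eqI) (auto simp: Pi_def)
      then show "x \<in> evaluate ` polys_below B q" using below by blast
    qed
  qed
qed

text \<open>Division by \<open>t ^ q - c\<close> from the right, degree by degree; below degree \<open>q\<close> only zero evaluates
  to zero.\<close>

lemma evaluate_zero_imp_multiple:
  assumes "p \<in> up B" "\<And>i. i \<ge> q + N \<Longrightarrow> p i = \<zero>" "evaluate p = \<zero>"
  shows "\<exists>s\<in>carrier (twisted_poly B \<tau>). p = s \<otimes>\<^bsub>twisted_poly B \<tau>\<^esub> cpoly"
  using assms
proof (induction N arbitrary: p)
  case 0
  then have "p \<in> polys_below B q" unfolding polys_below_def by simp
  then have "p = \<zero>\<^bsub>twisted_poly B \<tau>\<^esub>" using evaluate_below_zero 0 unfolding T.TP_simps by simp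
  also have "\<dots> = \<zero>\<^bsub>twisted_poly B \<tau>\<^esub> \<otimes>\<^bsub>twisted_poly B \<tau>\<^esub> cpoly"
    using cpoly_up unfolding T.TP_simps(1)[symmetric] by simp
  finally show ?case by blast
next
  case (Suc N)
  let ?P = "twisted_poly B \<tau>"
  let ?m = "monomial B (p (q + N)) N"
  let ?p = "p \<ominus>\<^bsub>?P\<^esub> ?m \<otimes>\<^bsub>?P\<^esub> cpoly"
  have cl: "p \<in> carrier ?P" "?m \<in> carrier ?P" "cpoly \<in> carrier ?P"
    using Suc.prems(1) T.monomial_up[of "p (q + N)" N] coeff_S[OF Suc.prems(1)] cpoly_up
    unfolding T.TP_simps(1) by simp_all
  have mc: "?m \<otimes>\<^bsub>?P\<^esub> cpoly \<in> carrier ?P" "?p \<in> carrier ?P" using cl by simp_all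
  have cS: "c \<in> carrier B" using c by simp
  have coeff: "(?m \<otimes>\<^bsub>?P\<^esub> cpoly) i = p i" if i: "i \<ge> q + N" for i
  proof -
    have "(?m \<otimes>\<^bsub>?P\<^esub> cpoly) i = ?m N \<otimes>\<^bsub>B\<^esub> (\<tau> ^^ N) (cpoly (i - N))"
      unfolding T.TP_simps
    proof (rule T.finsum_delta)
      show "N \<in> {..i}" using i by simp
      show "(\<lambda>j. ?m j \<otimes>\<^bsub>B\<^esub> (\<tau> ^^ j) (cpoly (i - j))) \<in> {..i} \<rightarrow> carrier B"
        using T.up_mem[OF cpoly_up] T.up_mem[OF cl(2)[unfolded T.TP_simps(1)]] T.twist_pow(1)
        by (intro Pi_I T.m_closed) auto
      fix j assume "j \<noteq> N"
      then have "?m j = \<zero>\<^bsub>B\<^esub>" unfolding monomial_def by simp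
      then show "?m j \<otimes>\<^bsub>B\<^esub> (\<tau> ^^ j) (cpoly (i - j)) = \<zero>\<^bsub>B\<^esub>"
        using T.l_null[OF T.twist_pow(1)[OF T.up_mem[OF cpoly_up]]] by simp
    qed simp
    also have "cpoly (i - N) = (if i = q + N then \<one>\<^bsub>B\<^esub> else \<zero>\<^bsub>B\<^esub>)"
      unfolding T.cyclic_poly_coeff[OF cS] using q i T.minus_zero by (auto simp: T.minus_eq)
    also have "?m N = p (q + N)" unfolding monomial_def by simp
    also have "p (q + N) \<otimes>\<^bsub>B\<^esub> (\<tau> ^^ N) (if i = q + N then \<one>\<^bsub>B\<^esub> else \<zero>\<^bsub>B\<^esub>) = p i"
    proof (cases "i = q + N")
      case True
      then show ?thesis using T.twist_pow(4)[of N] S_carrier[OF coeff_S[OF Suc.prems(1)]] by simp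
    next
      case False
      then show ?thesis using T.twist_pow_zero[of N] S_carrier[OF coeff_S[OF Suc.prems(1)]] Suc.prems(2)[of i] i
        by simp
    qed
    finally show ?thesis .
  qed
  have "?p i = \<zero>" if i: "i \<ge> q + N" for i
  proof -
    have "?p i = p i \<ominus>\<^bsub>B\<^esub> p i"
      using fun_cong[OF T.TP_minus[OF Suc.prems(1) mc(1)[unfolded T.TP_simps(1)]], of i] coeff[OF i] by simp
    then show ?thesis using T.r_right_minus_eq[of "p i" "p i"] coeff_S[OF Suc.prems(1), of i] by simp
  qed
  moreover have "evaluate ?p = \<zero>"
    using ev.hom_add[OF cl(1) TP.a_inv_closed[OF mc(1)]] ev.hom_a_inv[OF mc(1)] ev.hom_mult[OF cl(2,3)]
      evaluate_cpoly Suc.prems(3) ev.hom_closed[OF cl(2)] unfolding a_minus_def by simp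
  ultimately obtain s where s: "s \<in> carrier ?P" "?p = s \<otimes>\<^bsub>?P\<^esub> cpoly"
    using Suc.IH[of ?p] mc(2) unfolding T.TP_simps(1) by blast
  have "p = ?p \<oplus>\<^bsub>?P\<^esub> ?m \<otimes>\<^bsub>?P\<^esub> cpoly"
    using cl mc by (simp add: a_minus_def TP.a_assoc TP.l_neg)
  also have "\<dots> = (s \<oplus>\<^bsub>?P\<^esub> ?m) \<otimes>\<^bsub>?P\<^esub> cpoly"
    unfolding s(2) using TP.l_distr[OF s(1) cl(2,3)] by simp
  finally show ?case using s(1) cl(2) by blast
qed

lemma kernel_evaluate: "a_kernel (twisted_poly B \<tau>) E evaluate = PIdl\<^bsub>twisted_poly B \<tau>\<^esub> cpoly"
proof
  show "a_kernel (twisted_poly B \<tau>) E evaluate \<subseteq> PIdl\<^bsub>twisted_poly B \<tau>\<^esub> cpoly"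
  proof
    fix p assume "p \<in> a_kernel (twisted_poly B \<tau>) E evaluate"
    then have p: "p \<in> up B" "evaluate p = \<zero>"
      unfolding a_kernel_def kernel_def by (auto simp: T.TP_simps(1))
    obtain N where N: "\<And>i. i > N \<Longrightarrow> p i = \<zero>" using T.up_bound[OF p(1)] by auto
    have "\<exists>s\<in>carrier (twisted_poly B \<tau>). p = s \<otimes>\<^bsub>twisted_poly B \<tau>\<^esub> cpoly"
      using q by (intro evaluate_zero_imp_multiple[OF p(1) _ p(2), of N] N) simp
    then show "p \<in> PIdl\<^bsub>twisted_poly B \<tau>\<^esub> cpoly" unfolding cgenideal_def by blast
  qed
  show "PIdl\<^bsub>twisted_poly B \<tau>\<^esub> cpoly \<subseteq> a_kernel (twisted_poly B \<tau>) E evaluate"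
  proof
    fix p assume "p \<in> PIdl\<^bsub>twisted_poly B \<tau>\<^esub> cpoly"
    then obtain s where s: "s \<in> carrier (twisted_poly B \<tau>)" "p = s \<otimes>\<^bsub>twisted_poly B \<tau>\<^esub> cpoly"
      unfolding cgenideal_def by blast
    have f: "cpoly \<in> carrier (twisted_poly B \<tau>)" using cpoly_up unfolding T.TP_simps(1) .
    have "evaluate p = \<zero>" unfolding s(2) using ev.hom_mult[OF s(1) f] evaluate_cpoly ev.hom_closed[OF s(1)] by simp
    then show "p \<in> a_kernel (twisted_poly B \<tau>) E evaluate"
      unfolding a_kernel_def kernel_def using TP.m_closed[OF s(1) f] s(2) by simp
  qed
qed

text \<open>The left ideal generated by \<open>t ^ q - c\<close> is two-sided because it is a kernel.\<close>

lemma right_invariant_cpoly: "right_invariant B \<tau> cpoly"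
  unfolding right_invariant_def kernel_evaluate[symmetric] by (rule ev.kernel_is_ideal)

text \<open>The remainder modulo \<open>t ^ q - c\<close> is the polynomial of degree below \<open>q\<close> with the same value at \<open>u\<close>;
  this makes multiplication of remainders the multiplication of values.\<close>

lemma remainder_iff:
  assumes g: "g \<in> up B" and r: "r \<in> polys_below B q"
  shows "(\<exists>s\<in>carrier (twisted_poly B \<tau>).
      g = s \<otimes>\<^bsub>twisted_poly B \<tau>\<^esub> cpoly \<oplus>\<^bsub>twisted_poly B \<tau>\<^esub> r) \<longleftrightarrow> evaluate g = evaluate r"
proof
  let ?P = "twisted_poly B \<tau>"
  have f: "cpoly \<in> carrier ?P" using cpoly_up unfolding T.TP_simps(1) .
  have gc: "g \<in> carrier ?P" "r \<in> carrier ?P" using g polys_below_up[OF r] unfolding T.TP_simps(1) by auto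
  have ec: "evaluate g \<in> carrier E" "evaluate r \<in> carrier E" using gc by auto
  show "evaluate g = evaluate r" if ex: "\<exists>s\<in>carrier ?P. g = s \<otimes>\<^bsub>?P\<^esub> cpoly \<oplus>\<^bsub>?P\<^esub> r"
  proof -
    obtain s where s: "s \<in> carrier ?P" "g = s \<otimes>\<^bsub>?P\<^esub> cpoly \<oplus>\<^bsub>?P\<^esub> r" using ex by blast
    show ?thesis unfolding s(2)
      using ev.hom_add[OF TP.m_closed[OF s(1) f] gc(2)] ev.hom_mult[OF s(1) f] evaluate_cpoly
        ev.hom_closed[OF s(1)] ec by simp
  qed
  show "\<exists>s\<in>carrier ?P. g = s \<otimes>\<^bsub>?P\<^esub> cpoly \<oplus>\<^bsub>?P\<^esub> r" if eq: "evaluate g = evaluate r"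
  proof -
    have "evaluate (g \<ominus>\<^bsub>?P\<^esub> r) = \<zero>"
      using ev.hom_add[OF gc(1) TP.a_inv_closed[OF gc(2)]] ev.hom_a_inv[OF gc(2)] eq ec
      unfolding a_minus_def by (simp add: r_neg)
    then have "g \<ominus>\<^bsub>?P\<^esub> r \<in> PIdl\<^bsub>?P\<^esub> cpoly"
      unfolding kernel_evaluate[symmetric] a_kernel_def kernel_def using TP.minus_closed[OF gc] by simp
    then obtain s where s: "s \<in> carrier ?P" "g \<ominus>\<^bsub>?P\<^esub> r = s \<otimes>\<^bsub>?P\<^esub> cpoly"
      unfolding cgenideal_def by blast
    have "g = g \<ominus>\<^bsub>?P\<^esub> r \<oplus>\<^bsub>?P\<^esub> r" using gc by (simp add: a_minus_def TP.a_assoc TP.l_neg)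
    then show ?thesis using s by auto
  qed
qed

lemma right_remainder_eqI:
  assumes "g \<in> up B" "r \<in> polys_below B q" "evaluate g = evaluate r"
  shows "right_remainder B \<tau> cpoly q g = r"
  unfolding right_remainder_def
proof (rule the_equality)
  show "r \<in> polys_below B q \<and> (\<exists>s\<in>carrier (twisted_poly B \<tau>).
      g = s \<otimes>\<^bsub>twisted_poly B \<tau>\<^esub> cpoly \<oplus>\<^bsub>twisted_poly B \<tau>\<^esub> r)"
    using remainder_iff[OF assms(1,2)] assms by blast
  fix r' assume r': "r' \<in> polys_below B q \<and> (\<exists>s\<in>carrier (twisted_poly B \<tau>).
      g = s \<otimes>\<^bsub>twisted_poly B \<tau>\<^esub> cpoly \<oplus>\<^bsub>twisted_poly B \<tau>\<^esub> r')"
  then have "evaluate r' = evaluate r" using remainder_iff[OF assms(1), of r'] assms(3) by auto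
  then show "r' = r"
    using inj_onD[OF bij_betw_imp_inj_on[OF evaluate_bij]] r' assms(2) by blast
qed

theorem iso_generalised_cyclic_algebra:
  "\<exists>h\<in>ring_iso E (generalised_cyclic_algebra B \<tau> q c). \<forall>z\<in>S. h z = monomial B z 0"
proof -
  let ?P = "twisted_poly B \<tau>" and ?Q = "generalised_cyclic_algebra B \<tau> q c"
  have Q: "carrier ?Q = polys_below B q" "\<one>\<^bsub>?Q\<^esub> = \<one>\<^bsub>?P\<^esub>" "x \<oplus>\<^bsub>?Q\<^esub> y = x \<oplus>\<^bsub>?P\<^esub> y"
    "x \<otimes>\<^bsub>?Q\<^esub> y = right_remainder B \<tau> cpoly q (x \<otimes>\<^bsub>?P\<^esub> y)" for x y
    unfolding generalised_cyclic_algebra_def twisted_quotient_def by simp_all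
  define h where "h = the_inv_into (polys_below B q) evaluate"
  have bij: "bij_betw h (carrier E) (polys_below B q)"
    unfolding h_def by (rule bij_betw_the_inv_into[OF evaluate_bij])
  have eh: "evaluate (h x) = x" if "x \<in> carrier E" for x
    unfolding h_def using f_the_inv_into_f_bij_betw[OF evaluate_bij] that by blast
  have hb: "h x \<in> polys_below B q" if "x \<in> carrier E" for x
    using bij that by (auto simp: bij_betw_def)
  have he: "h x = p" if "p \<in> polys_below B q" "evaluate p = x" for p x
    unfolding h_def using the_inv_into_f_f[OF bij_betw_imp_inj_on[OF evaluate_bij] that(1)] that(2) by simp
  have monomial_below: "monomial B z 0 \<in> polys_below B q" if "z \<in> S" for z
    unfolding monomial_def using that q subringE(2)[OF subring_S] by (intro below_I) auto
  have hz: "h z = monomial B z 0" if "z \<in> S" for z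
    using evaluate_monomial[OF that, of 0] S_carrier[OF that] by (intro he monomial_below that) simp
  have "h \<in> ring_hom E ?Q"
  proof (rule ring_hom_memI)
    show "h x \<in> carrier ?Q" if "x \<in> carrier E" for x using hb that Q by simp
    show "h (x \<otimes> y) = h x \<otimes>\<^bsub>?Q\<^esub> h y" if "x \<in> carrier E" "y \<in> carrier E" for x y
      unfolding Q
    proof (rule right_remainder_eqI[symmetric])
      have u: "h x \<in> up B" "h y \<in> up B" using hb that polys_below_up by auto
      show "h x \<otimes>\<^bsub>?P\<^esub> h y \<in> up B" using T.TP_mult_closed[OF u] .
      show "h (x \<otimes> y) \<in> polys_below B q" using hb that by simp
      show "evaluate (h x \<otimes>\<^bsub>?P\<^esub> h y) = evaluate (h (x \<otimes> y))"
        using evaluate_mult[OF u] eh that by simp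
    qed
    show "h (x \<oplus> y) = h x \<oplus>\<^bsub>?Q\<^esub> h y" if "x \<in> carrier E" "y \<in> carrier E" for x y
      unfolding Q
    proof (rule he)
      have u: "h x \<in> up B" "h y \<in> up B" using hb that polys_below_up by auto
      show "evaluate (h x \<oplus>\<^bsub>?P\<^esub> h y) = x \<oplus> y" using evaluate_add[OF u] eh that by simp
      show "h x \<oplus>\<^bsub>?P\<^esub> h y \<in> polys_below B q"
      proof (rule below_I)
        note hx = hb[OF that(1)] and hy = hb[OF that(2)]
        show "(h x \<oplus>\<^bsub>?P\<^esub> h y) i \<in> S" for i
          unfolding T.TP_simps using subringE(7)[OF subring_S below_coeff(1)[OF hx] below_coeff(1)[OF hy]] by simp
        show "(h x \<oplus>\<^bsub>?P\<^esub> h y) i = \<zero>" if "i \<ge> q" for i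
          unfolding T.TP_simps using below_coeff(2)[OF hx that] below_coeff(2)[OF hy that] by simp
      qed
    qed
    show "h \<one> = \<one>\<^bsub>?Q\<^esub>"
      unfolding Q T.TP_simps hz[OF subringE(3)[OF subring_S]] monomial_def by (auto simp: fun_eq_iff)
  qed
  then have "h \<in> ring_iso E ?Q" unfolding ring_iso_def using bij Q by simp
  then show ?thesis using hz by blast
qed

end

end

section \<open>Normal subgroups of prime index\<close>

lemma (in group) finite_if_finite_index:
  assumes H: "subgroup H G" and fin: "finite H" "finite (rcosets H)"
  shows "finite (carrier G)"
proof -
  have "finite K" if "K \<in> rcosets H" for K
    using that fin(1) unfolding RCOSETS_def r_coset_def by auto
  then have "finite (\<Union>(rcosets H))" using fin(2) by blast
  then show ?thesis using rcosets_part_G[OF H] by simp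
qed

text \<open>The coset of \<open>g\<close> is a nontrivial element of a group of prime order \<open>q\<close>, so it has order \<open>q\<close>.\<close>

lemma (in normal) pow_mem_iff_dvd:
  assumes q: "Factorial_Ring.prime q" "order (G Mod H) = q" and g: "g \<in> carrier G" "g \<notin> H"
  shows "g [^] (d::nat) \<in> H \<longleftrightarrow> q dvd d"
proof -
  interpret Q: group "G Mod H" by (rule factorgroup_is_group)
  interpret nat_hom: group_hom G "G Mod H" "\<lambda>a. H #> a"
    unfolding group_hom_def group_hom_axioms_def
    using r_coset_hom_Mod is_group Q.is_group by blast
  have one: "\<one>\<^bsub>G Mod H\<^esub> = H" unfolding FactGroup_def by simp
  have mem: "a \<in> H \<longleftrightarrow> H #> a = \<one>\<^bsub>G Mod H\<^esub>" if "a \<in> carrier G" for a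
    using coset_join1[of H a] coset_join2[of a H] that subset subgroup_axioms unfolding one by auto
  let ?x = "H #> g"
  have x: "?x \<in> carrier (G Mod H)" using g by simp
  have "Q.ord ?x dvd q" using Q.ord_dvd_group_order[OF x] q by simp
  moreover have "Q.ord ?x \<noteq> 1"
  proof
    assume "Q.ord ?x = 1"
    then have "?x = \<one>\<^bsub>G Mod H\<^esub>" using Q.pow_ord_eq_1[OF x] Q.nat_pow_eone[OF x] by metis
    then show False using mem[OF g(1)] g(2) by blast
  qed
  ultimately have "Q.ord ?x = q" using q(1) prime_nat_iff by blast
  then show ?thesis
    using Q.pow_eq_id[OF x, of d] mem[of "g [^] d"] g nat_hom.hom_nat_pow[OF g(1), of d] by simp
qed

text \<open>The elements \<open>h * g ^ d\<close> with \<open>h \<in> H\<close> and \<open>d < q\<close> are distinct, and there are as many of them as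
  elements of \<open>H'\<close>.\<close>

lemma (in group) normal_prime_index:
  assumes H': "subgroup H' G" and N: "H \<lhd> (G\<lparr>carrier := H'\<rparr>)"
    and q: "Factorial_Ring.prime q" "order ((G\<lparr>carrier := H'\<rparr>) Mod H) = q"
    and fin: "finite H'" and g: "g \<in> H'" "g \<notin> H"
  shows "g [^] (d::nat) \<in> H \<longleftrightarrow> q dvd d"
    and "f \<in> H' \<Longrightarrow> \<exists>h\<in>H. \<exists>d<q. f = h \<otimes> g [^] d"
    and "f \<in> H' \<Longrightarrow> h \<in> H \<Longrightarrow> f \<otimes> h \<otimes> inv f \<in> H"
    and "card H' = q * card H"
    and "h \<in> H \<Longrightarrow> h' \<in> H \<Longrightarrow> i < q \<Longrightarrow> j < q \<Longrightarrow> h \<otimes> g [^] (i::nat) = h' \<otimes> g [^] (j::nat) \<Longrightarrow> i = j"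
proof -
  interpret N: normal H "G\<lparr>carrier := H'\<rparr>" by (rule N)
  have HH': "H \<subseteq> H'" using N.subset by simp
  have sub: "x \<in> carrier G" if "x \<in> H'" for x using subgroup.mem_carrier[OF H' that] .
  have H: "subgroup H G"
    using N.subgroup_axioms by (metis H' group.incl_subgroup is_group)
  show pow: "g [^] (d::nat) \<in> H \<longleftrightarrow> q dvd d" for d
    using N.pow_mem_iff_dvd[OF q, of g d] g unfolding nat_pow_consistent[of g d H'] by simp
  show "f \<otimes> h \<otimes> inv f \<in> H" if f: "f \<in> H'" and h: "h \<in> H" for f h
    using N.inv_op_closed2[of f h] f h m_inv_consistent[OF H' f] by simp
  show card: "card H' = q * card H"
    using N.lagrange[OF N.subgroup_axioms] q(2) unfolding order_def FactGroup_def by simp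
  have no: "\<not> (i < j \<and> h \<otimes> g [^] i = h' \<otimes> g [^] j)"
    if "h \<in> H" "h' \<in> H" "i < q" "j < q" for h h' and i j :: nat
  proof
    assume ij: "i < j \<and> h \<otimes> g [^] i = h' \<otimes> g [^] j"
    have c: "h \<in> carrier G" "h' \<in> carrier G" "g \<in> carrier G" using that HH' sub g by auto
    have "g [^] j = g [^] (j - i) \<otimes> g [^] i" using c ij by (simp add: nat_pow_mult)
    then have "h \<otimes> g [^] i = h' \<otimes> g [^] (j - i) \<otimes> g [^] i" using ij c by (simp add: m_assoc)
    then have "h = h' \<otimes> g [^] (j - i)" using c by simp
    then have "inv h' \<otimes> h = g [^] (j - i)" using c by (simp add: m_assoc[symmetric])
    moreover have "inv h' \<otimes> h \<in> H"
      using subgroup.m_closed[OF H subgroup.m_inv_closed[OF H \<open>h' \<in> H\<close>] \<open>h \<in> H\<close>] .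
    ultimately have "q dvd j - i" using pow by simp
    then show False using ij that(4) by (auto dest!: dvd_imp_le)
  qed
  show uniq: "i = j" if "h \<in> H" "h' \<in> H" "i < q" "j < q" "h \<otimes> g [^] i = h' \<otimes> g [^] j"
    for h h' and i j :: nat
    using no[OF that(1-4)] no[OF that(2,1,4,3)] that(5) by (metis linorder_neqE_nat)
  show "\<exists>h\<in>H. \<exists>d<q. f = h \<otimes> g [^] d" if f: "f \<in> H'"
  proof -
    let ?\<phi> = "\<lambda>(h, d). h \<otimes> g [^] (d::nat)"
    have gpow: "g [^] (d::nat) \<in> H'" for d
      using N.nat_pow_closed[of g d] g unfolding nat_pow_consistent[of g d H'] by simp
    have "inj_on ?\<phi> (H \<times> {..<q})"
    proof (rule inj_onI, clarify)
      fix h i h' j assume a: "h \<in> H" "h' \<in> H" "i < q" "j < q" "h \<otimes> g [^] i = h' \<otimes> g [^] (j::nat)"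
      have "i = j" using uniq[OF a] .
      moreover have "h \<in> carrier G" "h' \<in> carrier G" "g \<in> carrier G" using a HH' sub g by auto
      ultimately show "h = h' \<and> i = j" using a(5) by simp
    qed
    then have "card (?\<phi> ` (H \<times> {..<q})) = card H'"
      using card by (simp add: card_image card_cartesian_product)
    moreover have "?\<phi> ` (H \<times> {..<q}) \<subseteq> H'"
      using HH' gpow subgroup.m_closed[OF H'] by auto
    ultimately have "?\<phi> ` (H \<times> {..<q}) = H'" using card_subset_eq[OF fin] by blast
    then have "f \<in> ?\<phi> ` (H \<times> {..<q})" using f by simp
    then show ?thesis by auto
  qed
qed

section \<open>One step of the chain\<close>

context crossed_product
begin

lemma proj_mult_component:
  assumes f: "f \<in> carrier G" "k \<in> carrier G" and a: "a \<in> carrier A" and b: "b \<in> component k"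
  shows "proj (f \<otimes>\<^bsub>G\<^esub> k) (a \<otimes> b) = proj f a \<otimes> b"
proof -
  have bc: "b \<in> carrier A" using b componentD by blast
  have "a \<otimes> b = (\<Oplus>h\<in>carrier G. proj h a) \<otimes> b" using decomposition_proj[OF a] by simp
  also have "\<dots> = (\<Oplus>h\<in>carrier G. proj h a \<otimes> b)" using a bc finite_G by (intro finsum_ldistr) auto
  finally have "proj (f \<otimes>\<^bsub>G\<^esub> k) (a \<otimes> b) = (\<Oplus>h\<in>carrier G. proj (f \<otimes>\<^bsub>G\<^esub> k) (proj h a \<otimes> b))"
    using proj_finsum[of "f \<otimes>\<^bsub>G\<^esub> k" "carrier G" "\<lambda>h. proj h a \<otimes> b"] f a bc finite_G by auto
  also have "\<dots> = proj (f \<otimes>\<^bsub>G\<^esub> k) (proj f a \<otimes> b)"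
  proof (rule finsum_delta[OF finite_G f(1)])
    show "(\<lambda>h. proj (f \<otimes>\<^bsub>G\<^esub> k) (proj h a \<otimes> b)) \<in> carrier G \<rightarrow> carrier A" using f a bc by auto
    fix h assume h: "h \<in> carrier G" "h \<noteq> f"
    then show "proj (f \<otimes>\<^bsub>G\<^esub> k) (proj h a \<otimes> b) = \<zero>"
      using proj_component[OF _ _ component_mult[OF h(1) f(2) proj_in_component[OF h(1) a] b], of "f \<otimes>\<^bsub>G\<^esub> k"] f
      by simp
  qed
  also have "\<dots> = proj f a \<otimes> b"
    using proj_component[OF _ _ component_mult[OF f proj_in_component[OF f(1) a] b], of "f \<otimes>\<^bsub>G\<^esub> k"] f by simp
  finally show ?thesis .
qed

lemma u_pow:
  assumes g: "g \<in> carrier G"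
  shows "u g [^] (d::nat) \<in> component (g [^]\<^bsub>G\<^esub> d)" "u g [^] (d::nat) \<in> Units A"
proof -
  show "u g [^] (d::nat) \<in> component (g [^]\<^bsub>G\<^esub> d)"
  proof (induction d)
    case 0
    then show ?case using component_one by simp
  next
    case (Suc d)
    then show ?case using component_mult[OF _ g Suc u(1)[OF g]] g by simp
  qed
  show "u g [^] (d::nat) \<in> Units A" using u_Units[OF g] by (rule Units_pow_closed)
qed

lemma inv_component:
  assumes f: "f \<in> carrier G" and x: "x \<in> component f" "x \<in> Units A"
  shows "inv x \<in> component (inv\<^bsub>G\<^esub> f)"
proof (rule componentI)
  have xc: "x \<in> carrier A" "inv x \<in> carrier A" using x by auto
  show "inv x \<in> carrier A" by (rule xc)
  fix z assume z: "z \<in> M"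
  let ?y = "(inv\<^bsub>G\<^esub> f) z"
  have y: "?y \<in> M" "f ?y = z" using f z by simp_all
  have "inv x \<otimes> z = inv x \<otimes> (x \<otimes> ?y \<otimes> inv x)" using conj_component[OF f x y(1)] y(2) by simp
  also have "\<dots> = (inv x \<otimes> x) \<otimes> ?y \<otimes> inv x" using xc y(1) by (simp only: m_assoc M_carrier m_closed)
  finally show "inv x \<otimes> z = ?y \<otimes> inv x" using x(2) xc y(1) by simp
qed

text \<open>If \<open>f\<close> normalizes \<open>H\<close>, it permutes the fixed field of \<open>H\<close>, and conjugation by an element of degree
  \<open>f\<close> induces \<open>f\<close> there; it therefore preserves the centralizer.\<close>

lemma conj_C:
  assumes f: "f \<in> carrier G" and x: "x \<in> component f" "x \<in> Units A"
    and H: "H \<subseteq> carrier G" and norm: "\<And>h. h \<in> H \<Longrightarrow> f \<otimes>\<^bsub>G\<^esub> h \<otimes>\<^bsub>G\<^esub> inv\<^bsub>G\<^esub> f \<in> H"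
    and norm': "\<And>h. h \<in> H \<Longrightarrow> inv\<^bsub>G\<^esub> f \<otimes>\<^bsub>G\<^esub> h \<otimes>\<^bsub>G\<^esub> f \<in> H" and a: "a \<in> C H"
  shows "x \<otimes> a \<otimes> inv x \<in> C H"
proof (rule C_I)
  have xc: "x \<in> carrier A" "inv x \<in> carrier A" "a \<in> carrier A" using x a C_carrier by auto
  show "x \<otimes> a \<otimes> inv x \<in> carrier A" using xc by simp
  fix z assume z: "z \<in> fixed H"
  have zM: "z \<in> M" using z fixed_M by blast
  let ?y = "(inv\<^bsub>G\<^esub> f) z"
  have y: "?y \<in> M" using f zM by simp
  have yf: "?y \<in> fixed H"
  proof (rule fixedI[OF y])
    fix h assume h: "h \<in> H"
    have hG: "h \<in> carrier G" using h H by auto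
    have "f (h ?y) = (f \<otimes>\<^bsub>G\<^esub> h \<otimes>\<^bsub>G\<^esub> inv\<^bsub>G\<^esub> f) z" using f hG zM by simp
    also have "\<dots> = z" using fixedD[OF z norm[OF h]] .
    finally have "(inv\<^bsub>G\<^esub> f) (f (h ?y)) = ?y" by simp
    then show "h ?y = ?y" using f hG y by simp
  qed
  have 1: "inv x \<otimes> z = ?y \<otimes> inv x" using componentD(2)[OF inv_component[OF f x] zM] .
  have 2: "x \<otimes> ?y = z \<otimes> x" using componentD(2)[OF x(1) y] f zM by simp
  have zc: "z \<in> carrier A" "?y \<in> carrier A" using zM y by auto
  have "x \<otimes> a \<otimes> inv x \<otimes> z = x \<otimes> a \<otimes> (inv x \<otimes> z)" using xc zc by (simp only: m_assoc m_closed)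
  also have "\<dots> = x \<otimes> (a \<otimes> ?y) \<otimes> inv x" unfolding 1 using xc zc by (simp only: m_assoc m_closed)
  also have "\<dots> = (x \<otimes> ?y) \<otimes> a \<otimes> inv x"
    unfolding C_D[OF a yf] using xc zc by (simp only: m_assoc m_closed)
  also have "\<dots> = z \<otimes> (x \<otimes> a \<otimes> inv x)" unfolding 2 using xc zc by (simp only: m_assoc m_closed)
  finally show "x \<otimes> a \<otimes> inv x \<otimes> z = z \<otimes> (x \<otimes> a \<otimes> inv x)" .
qed

end

text \<open>Two consecutive groups \<open>H\<close> and \<open>H'\<close> of the chain, with an element \<open>g\<close> whose powers represent the
  cosets of \<open>H\<close>. Conjugation by \<open>u g\<close> will be the twist and \<open>u g ^ q\<close> the constant \<open>c\<close>.\<close>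

locale prime_step = crossed_product +
  fixes H H' :: "('a \<Rightarrow> 'a) set" and q :: nat and g :: "'a \<Rightarrow> 'a"
  assumes subgroup_H: "subgroup H G" and subgroup_H': "subgroup H' G"
    and normal: "H \<lhd> (G\<lparr>carrier := H'\<rparr>)"
    and prime_q: "Factorial_Ring.prime q"
    and order_q: "order ((G\<lparr>carrier := H'\<rparr>) Mod H) = q"
    and g_mem: "g \<in> H'" "g \<notin> H"
begin

lemma finite_H': "finite H'"
  using finite_subset[OF subgroup.subset[OF subgroup_H'] finite_G] .

lemma q_pos: "0 < q"
  using prime_q prime_gt_0_nat by blast

lemmas index = Gr.normal_prime_index[OF subgroup_H' normal prime_q order_q finite_H' g_mem]

lemma HH': "H \<subseteq> H'"
  using normal.axioms(1)[OF normal] subgroup.subset by fastforce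

lemma H_G: "h \<in> H \<Longrightarrow> h \<in> carrier G" and H'_G: "h \<in> H' \<Longrightarrow> h \<in> carrier G"
  using subgroup.mem_carrier[OF subgroup_H] subgroup.mem_carrier[OF subgroup_H'] by auto

lemma g_G: "g \<in> carrier G"
  using g_mem H'_G by blast

abbreviation v :: 'a where "v \<equiv> u g"

lemma v: "v \<in> component g" "v \<in> Units A" "v \<in> carrier A" "inv v \<in> carrier A"
  "inv v \<otimes> v = \<one>" "v \<otimes> inv v = \<one>"
  using u[OF g_G] u_Units[OF g_G] by auto

definition conj_v :: "'a \<Rightarrow> 'a" where
  "conj_v x = v \<otimes> x \<otimes> inv v"

lemma conj_v_C: "a \<in> C H \<Longrightarrow> conj_v a \<in> C H" "a \<in> C H \<Longrightarrow> inv v \<otimes> a \<otimes> v \<in> C H"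
proof -
  have ginv: "inv\<^bsub>G\<^esub> g \<in> H'" using subgroup.m_inv_closed[OF subgroup_H' g_mem(1)] .
  have n1: "g \<otimes>\<^bsub>G\<^esub> h \<otimes>\<^bsub>G\<^esub> inv\<^bsub>G\<^esub> g \<in> H" if "h \<in> H" for h using index(3)[OF g_mem(1) that] .
  have n2: "inv\<^bsub>G\<^esub> g \<otimes>\<^bsub>G\<^esub> h \<otimes>\<^bsub>G\<^esub> g \<in> H" if "h \<in> H" for h using index(3)[OF ginv that] g_G by simp
  show "conj_v a \<in> C H" if "a \<in> C H"
    unfolding conj_v_def using conj_C[OF g_G v(1,2) subgroup.subset[OF subgroup_H] n1 n2 that] .
  have iU: "inv v \<in> Units A" using v(2) by simp
  have "inv v \<otimes> a \<otimes> inv (inv v) \<in> C H" if "a \<in> C H"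
    using conj_C[OF _ inv_component[OF g_G v(1,2)] iU subgroup.subset[OF subgroup_H] _ _ that] n1 n2 g_G by simp
  then show "inv v \<otimes> a \<otimes> v \<in> C H" if "a \<in> C H" using that v(2) by simp
qed

lemma conj_v_pow:
  assumes "x \<in> carrier A"
  shows "(conj_v ^^ d) x = v [^] d \<otimes> x \<otimes> inv (v [^] d)"
proof (induction d)
  case 0
  then show ?case using assms by simp
next
  case (Suc d)
  have vd: "v [^] d \<in> Units A" "v [^] d \<in> carrier A" "inv (v [^] d) \<in> carrier A"
    using u_pow(2)[OF g_G, of d] by auto
  have s: "v [^] Suc d = v \<otimes> v [^] d" using nat_pow_Suc2[OF v(3)] .
  have "inv (v [^] Suc d) = inv (v [^] d) \<otimes> inv v"
    unfolding s
  proof (rule inv_char)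
    show "v \<otimes> v [^] d \<otimes> (inv (v [^] d) \<otimes> inv v) = \<one>"
    proof -
      have "v \<otimes> v [^] d \<otimes> (inv (v [^] d) \<otimes> inv v) = v \<otimes> (v [^] d \<otimes> inv (v [^] d)) \<otimes> inv v"
        using v(3,4) vd(2,3) by (simp only: m_assoc m_closed)
      then show ?thesis using v vd(1) by simp
    qed
    show "inv (v [^] d) \<otimes> inv v \<otimes> (v \<otimes> v [^] d) = \<one>"
    proof -
      have "inv (v [^] d) \<otimes> inv v \<otimes> (v \<otimes> v [^] d) = inv (v [^] d) \<otimes> (inv v \<otimes> v) \<otimes> v [^] d"
        using v(3,4) vd(2,3) by (simp only: m_assoc m_closed)
      then show ?thesis using v vd by simp
    qed
  qed (use v vd in auto)
  then have "v [^] Suc d \<otimes> x \<otimes> inv (v [^] Suc d) = v \<otimes> v [^] d \<otimes> x \<otimes> (inv (v [^] d) \<otimes> inv v)"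
    unfolding s by simp
  then show ?case using Suc v(3,4) vd(2,3) assms by (simp add: conj_v_def m_assoc)
qed

lemma conj_v_pow_M: "z \<in> M \<Longrightarrow> (conj_v ^^ d) z = (g [^]\<^bsub>G\<^esub> d) z"
  using conj_v_pow[of z d] conj_component[OF _ u_pow[OF g_G, of d]] g_G by simp

lemma v_pow_C: "v [^] q \<in> C H"
  using component_subset_C[of "g [^]\<^bsub>G\<^esub> q" H] u_pow(1)[OF g_G, of q] index(1)[of q] by auto

lemma v_C': "v \<in> C H'"
  using component_subset_C[OF g_mem(1)] v(1) by blast

lemma proj_other_power:
  assumes h: "h \<in> H" and j: "j < q" and i: "i < q" "i \<noteq> j" and s: "s \<in> C H"
  shows "proj (h \<otimes>\<^bsub>G\<^esub> g [^]\<^bsub>G\<^esub> j) (s \<otimes> v [^] i) = \<zero>"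
proof -
  let ?f = "h \<otimes>\<^bsub>G\<^esub> g [^]\<^bsub>G\<^esub> j"
  let ?k = "?f \<otimes>\<^bsub>G\<^esub> inv\<^bsub>G\<^esub> (g [^]\<^bsub>G\<^esub> i)"
  have fG: "?f \<in> carrier G" using H_G[OF h] g_G by simp
  have kG: "?k \<in> carrier G" using fG g_G by simp
  have kf: "?k \<otimes>\<^bsub>G\<^esub> g [^]\<^bsub>G\<^esub> i = ?f" using fG g_G by (simp add: Gr.m_assoc)
  have "?k \<notin> H" using index(5)[OF _ h i(1) j kf] i(2) by blast
  then have "proj ?k s = \<zero>"
    using component_meets_C[OF subgroup_H kG proj_in_component[OF kG C_carrier[OF s]] proj_C[OF kG s]] by auto
  then show ?thesis
    using proj_mult_component[OF kG _ C_carrier[OF s] u_pow(1)[OF g_G, of i]] kf g_G v(3) by simp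
qed

text \<open>The summand \<open>s j * v ^ j\<close> has its components in the degrees \<open>h * g ^ j\<close>, and these are different for
  different \<open>j < q\<close>.\<close>

lemma free_v: "free_family (C H) {..<q} (\<lambda>i. v [^] i)"
  unfolding free_family_def
proof (intro ballI impI)
  fix s j assume s: "s \<in> {..<q} \<rightarrow> C H" "(\<Oplus>i\<in>{..<q}. s i \<otimes> v [^] i) = \<zero>" and j: "j \<in> {..<q}"
  have sC: "s i \<in> C H" if "i < q" for i using s that by auto
  have sc: "s i \<in> carrier A" if "i < q" for i using C_carrier[OF sC[OF that]] .
  have "proj h (s j) = \<zero>" if h: "h \<in> H" for h
  proof -
    let ?f = "h \<otimes>\<^bsub>G\<^esub> g [^]\<^bsub>G\<^esub> j"
    have fG: "?f \<in> carrier G" using H_G[OF h] g_G by simp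
    have zero: "proj ?f (s i \<otimes> v [^] i) = \<zero>" if i: "i < q" "i \<noteq> j" for i
      using proj_other_power[OF h _ i(1) _ sC[OF i(1)]] i j by auto
    have "\<zero> = proj ?f (\<Oplus>i\<in>{..<q}. s i \<otimes> v [^] i)" using s proj_zero[OF fG] by simp
    also have "\<dots> = (\<Oplus>i\<in>{..<q}. proj ?f (s i \<otimes> v [^] i))"
      using sc v(3) fG by (intro proj_finsum) auto
    also have "\<dots> = proj ?f (s j \<otimes> v [^] j)"
      using zero sc v(3) fG j by (intro finsum_delta) auto
    also have "\<dots> = proj h (s j) \<otimes> v [^] j"
      using proj_mult_component[OF H_G[OF h] _ sc u_pow(1)[OF g_G, of j]] j g_G by simp
    finally have z: "proj h (s j) \<otimes> v [^] j = \<zero>" by (rule sym)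
    have vj: "v [^] j \<in> Units A" using u_pow(2)[OF g_G, of j] .
    have "proj h (s j) = proj h (s j) \<otimes> v [^] j \<otimes> inv (v [^] j)"
      using vj v(3) sc H_G[OF h] j by (simp add: m_assoc)
    then show ?thesis unfolding z using vj by simp
  qed
  then have "(\<Oplus>h\<in>H. proj h (s j)) = (\<Oplus>h\<in>H. \<zero>)" by (intro finsum_eqI) auto
  then show "s j = \<zero>" using C_decomposition[OF subgroup_H sC[of j]] j by simp
qed

lemma powers_C': "v [^] (i::nat) \<in> C H'"
  using v_C' by (induction i) (auto simp: subringE(3,6)[OF subring_C])

lemma span_v: "span_family (C H) {..<q} (\<lambda>i. v [^] i) = C H'"
proof
  let ?V = "span_family (C H) {..<q} (\<lambda>i. v [^] i)"
  note span = subring_C[of H] finite_lessThan[of q]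
  have vc: "(\<lambda>i. v [^] i) \<in> {..<q} \<rightarrow> carrier A" using v(3) by auto
  show "?V \<subseteq> C H'"
    unfolding span_family_def using C_mono[OF HH'] powers_C'
    by (auto simp: Pi_def intro!: finsum_mem_subring[OF subring_C] subringE(6)[OF subring_C])
  show "C H' \<subseteq> ?V"
  proof
    fix a assume a: "a \<in> C H'"
    \<comment> \<open>A homogeneous element of degree \<open>h * g ^ j\<close> is the product of one of degree \<open>h\<close> and \<open>v ^ j\<close>.\<close>
    have part: "proj f a \<in> ?V" if f: "f \<in> H'" for f
    proof -
      from index(2)[OF f] obtain h j where hj: "h \<in> H" "j < q" "f = h \<otimes>\<^bsub>G\<^esub> g [^]\<^bsub>G\<^esub> (j::nat)" by blast
      have gj: "g [^]\<^bsub>G\<^esub> j \<in> carrier G" using g_G by simp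
      have p: "proj f a \<in> component f" using proj_in_component[OF H'_G[OF f] C_carrier[OF a]] .
      have "proj f a \<otimes> inv (v [^] j) \<in> component (f \<otimes>\<^bsub>G\<^esub> inv\<^bsub>G\<^esub> (g [^]\<^bsub>G\<^esub> j))"
        using component_mult[OF H'_G[OF f] Gr.inv_closed[OF gj] p inv_component[OF gj u_pow[OF g_G, of j]]] .
      also have "f \<otimes>\<^bsub>G\<^esub> inv\<^bsub>G\<^esub> (g [^]\<^bsub>G\<^esub> j) = h" using hj(3) H_G[OF hj(1)] gj by (simp add: Gr.m_assoc)
      finally have "proj f a \<otimes> inv (v [^] j) \<in> C H" using component_subset_C[OF hj(1)] by blast
      from span_family_single[OF span vc _ this, of j]
      have "proj f a \<otimes> inv (v [^] j) \<otimes> v [^] j \<in> ?V" using hj(2) by simp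
      then show ?thesis using componentD(1)[OF p] u_pow(2)[OF g_G, of j] v(3) by (simp add: m_assoc)
    qed
    have "?V \<subseteq> carrier A" unfolding span_family_def using C_carrier vc by (auto simp: Pi_def intro!: finsum_closed)
    moreover have "\<zero> \<in> ?V"
      using span_family_single[OF span vc, of 0 \<zero>] q_pos subringE(2)[OF subring_C] by simp
    ultimately have "(\<Oplus>f\<in>H'. proj f a) \<in> ?V"
      using additive_finsum[OF abelian_monoid_axioms finite_H', of "\<lambda>f. proj f a" ?V "\<lambda>x. x"]
        part span_family_add[OF span vc] by auto
    then show "a \<in> ?V" using C_decomposition[OF subgroup_H' a] by simp
  qed
qed

end

context prime_step
begin

abbreviation B where "B \<equiv> A\<lparr>carrier := C H\<rparr>"
abbreviation E where "E \<equiv> A\<lparr>carrier := C H'\<rparr>"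

lemma conj_v_hom:
  assumes "x \<in> carrier A" "y \<in> carrier A"
  shows "conj_v (x \<oplus> y) = conj_v x \<oplus> conj_v y" "conj_v (x \<otimes> y) = conj_v x \<otimes> conj_v y"
proof -
  show "conj_v (x \<oplus> y) = conj_v x \<oplus> conj_v y"
    unfolding conj_v_def using assms v(3,4) by (simp add: l_distr r_distr)
  have "conj_v x \<otimes> conj_v y = v \<otimes> x \<otimes> (inv v \<otimes> v) \<otimes> y \<otimes> inv v"
    unfolding conj_v_def using assms v(3,4) by (simp only: m_assoc m_closed)
  also have "\<dots> = v \<otimes> (x \<otimes> y) \<otimes> inv v" unfolding v(5) using assms v(3,4) by (simp add: m_assoc)
  finally show "conj_v (x \<otimes> y) = conj_v x \<otimes> conj_v y" unfolding conj_v_def by simp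
qed

lemma conj_v_inverse:
  assumes "x \<in> carrier A"
  shows "inv v \<otimes> conj_v x \<otimes> v = x" "conj_v (inv v \<otimes> x \<otimes> v) = x"
proof -
  have "inv v \<otimes> conj_v x \<otimes> v = (inv v \<otimes> v) \<otimes> x \<otimes> (inv v \<otimes> v)"
    unfolding conj_v_def using assms v(3,4) by (simp only: m_assoc m_closed)
  then show "inv v \<otimes> conj_v x \<otimes> v = x" using assms v(5) by simp
  have "conj_v (inv v \<otimes> x \<otimes> v) = (v \<otimes> inv v) \<otimes> x \<otimes> (v \<otimes> inv v)"
    unfolding conj_v_def using assms v(3,4) by (simp only: m_assoc m_closed)
  then show "conj_v (inv v \<otimes> x \<otimes> v) = x" using assms v(6) by simp
qed

lemma conj_v_iso: "conj_v \<in> ring_iso B B"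
proof -
  have "conj_v \<in> ring_hom B B"
  proof (rule ring_hom_memI)
    show "conj_v \<one>\<^bsub>B\<^esub> = \<one>\<^bsub>B\<^esub>" unfolding conj_v_def using v by simp
  qed (use conj_v_C conj_v_hom C_carrier in auto)
  moreover have "bij_betw conj_v (C H) (C H)"
  proof (rule bij_betw_byWitness[where f' = "\<lambda>x. inv v \<otimes> x \<otimes> v"])
    show "\<forall>x\<in>C H. inv v \<otimes> conj_v x \<otimes> v = x" "\<forall>x\<in>C H. conj_v (inv v \<otimes> x \<otimes> v) = x"
      using conj_v_inverse C_carrier by auto
    show "conj_v ` C H \<subseteq> C H" "(\<lambda>x. inv v \<otimes> x \<otimes> v) ` C H \<subseteq> C H" using conj_v_C by auto
  qed
  ultimately show ?thesis unfolding ring_iso_def by simp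
qed

lemma conj_v_M: "z \<in> M \<Longrightarrow> conj_v z = g z"
  unfolding conj_v_def by (rule conj_component[OF g_G v(1,2)])

text \<open>By the Galois correspondence: \<open>g ^ d\<close> is not in \<open>H\<close>, so it does not fix the fixed field of \<open>H\<close>.\<close>

lemma g_pow_moves:
  assumes "0 < d" "d < q"
  shows "\<exists>z\<in>fixed H. (conj_v ^^ d) z \<noteq> z"
proof (rule ccontr)
  assume "\<not> ?thesis"
  then have "(g [^]\<^bsub>G\<^esub> d) z = z" if "z \<in> fixed H" for z
    using that conj_v_pow_M[OF fixed_M[OF that], of d] by auto
  then have "g [^]\<^bsub>G\<^esub> d \<in> H" using g_G by (intro fixing_imp_mem[OF subgroup_H]) auto
  then show False using index(1)[of d] assms by (auto dest!: dvd_imp_le)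
qed

lemma order_conj_v: "has_order_on (fixed H) conj_v q"
  unfolding has_order_on_def
proof (intro conjI ballI allI impI)
  fix z assume z: "z \<in> fixed H"
  have "g [^]\<^bsub>G\<^esub> q \<in> H" using index(1)[of q] by simp
  then show "(conj_v ^^ q) z = z" using conj_v_pow_M[OF fixed_M[OF z]] fixedD[OF z] by simp
qed (use q_pos g_pow_moves in auto)

lemma Units_B:
  assumes "x \<in> C H" "x \<in> Units A"
  shows "x \<in> Units B" "inv\<^bsub>B\<^esub> x = inv x"
proof -
  have i: "inv x \<in> C H" using centralizer_inverse[OF _ assms] fixed_M by (simp add: subset_iff)
  show U: "x \<in> Units B"
    unfolding Units_def using assms(1) i Units_l_inv[OF assms(2)] Units_r_inv[OF assms(2)] by auto
  show "inv\<^bsub>B\<^esub> x = inv x"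
    using m_inv_monoid_consistent[OF U] subring.axioms(2)[OF subring_C] by simp
qed

lemma v_pow_fixed_units: "v [^] q \<in> fixed_units B conj_v"
proof -
  let ?c = "v [^] q"
  have cU: "?c \<in> Units A" "?c \<in> carrier A" "inv ?c \<in> carrier A" using u_pow(2)[OF g_G, of q] by auto
  have comm: "v \<otimes> ?c = ?c \<otimes> v" using nat_pow_Suc2[OF v(3), of q] by simp
  have tc: "conj_v ?c = ?c" unfolding conj_v_def comm using cU v by (simp add: m_assoc)
  have iC: "inv ?c \<in> C H" using centralizer_inverse[OF _ v_pow_C cU(1)] fixed_M by (simp add: subset_iff)
  have "conj_v (inv ?c) = inv ?c"
  proof -
    have "conj_v (inv ?c) \<otimes> ?c = conj_v (inv ?c \<otimes> ?c)" using conj_v_hom(2)[OF cU(3,2)] tc by simp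
    also have "\<dots> = \<one>" unfolding conj_v_def using cU v by simp
    finally have 1: "conj_v (inv ?c) \<otimes> ?c = \<one>" .
    have "conj_v (inv ?c) \<in> carrier A" unfolding conj_v_def using cU v by simp
    then show ?thesis using inv_unique[OF 1 Units_r_inv[OF cU(1)] cU(2) _ cU(3)] by simp
  qed
  then show ?thesis
    unfolding fixed_units_def fixed_ring_def Units_def using tc iC v_pow_C cU by auto
qed

text \<open>The \<open>q\<close>-th power is conjugation by \<open>v ^ q\<close>, which lies in \<open>C H\<close>. An inner automorphism of \<open>C H\<close>
  fixes its centre, which no smaller positive power does.\<close>

lemma inner_order_conj_v: "has_inner_order B conj_v q"
  unfolding has_inner_order_def
proof (intro conjI allI impI)
  show "0 < q" by (rule q_pos)
  have cU: "v [^] q \<in> Units A" using u_pow(2)[OF g_G, of q] .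
  show "inner_automorphism B (conj_v ^^ q)"
    unfolding inner_automorphism_def
    using Units_B[OF v_pow_C cU] conj_v_pow C_carrier by (intro bexI[of _ "v [^] q"]) auto
  fix d assume d: "0 < d \<and> d < q"
  interpret B: ring B by (rule subring_is_ring[OF subring_C])
  show "\<not> inner_automorphism B (conj_v ^^ d)"
  proof
    assume "inner_automorphism B (conj_v ^^ d)"
    then obtain x where x: "x \<in> Units B" "\<And>y. y \<in> C H \<Longrightarrow> (conj_v ^^ d) y = x \<otimes> y \<otimes> inv\<^bsub>B\<^esub> x"
      unfolding inner_automorphism_def by auto
    have xC: "x \<in> C H" "inv\<^bsub>B\<^esub> x \<in> C H" "x \<otimes> inv\<^bsub>B\<^esub> x = \<one>"
      using B.Units_closed[OF x(1)] B.Units_inv_closed[OF x(1)] B.Units_r_inv[OF x(1)] by simp_all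
    have "(conj_v ^^ d) z = z" if z: "z \<in> fixed H" for z
    proof -
      have zM: "z \<in> M" using fixed_M[OF z] .
      have "(conj_v ^^ d) z = z \<otimes> x \<otimes> inv\<^bsub>B\<^esub> x" using x(2)[of z] M_subset_C zM C_D[OF xC(1) z] by auto
      then show ?thesis using xC C_carrier zM by (simp add: m_assoc)
    qed
    then show False using g_pow_moves d by blast
  qed
qed

text \<open>\<open>H'\<close> is generated by \<open>H\<close> and \<open>g\<close>.\<close>

lemma fixed_H': "fixed H' = fixed H \<inter> fixed_ring B conj_v"
proof (intro equalityI subsetI)
  fix z assume z: "z \<in> fixed H'"
  have zM: "z \<in> M" using fixed_M[OF z] .
  have "z \<in> fixed H" using z fixed_antimono[OF HH'] by blast
  moreover have "conj_v z = z" using conj_v_M[OF zM] fixedD[OF z g_mem(1)] by simp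
  ultimately show "z \<in> fixed H \<inter> fixed_ring B conj_v"
    using M_subset_C zM unfolding fixed_ring_def by auto
next
  fix z assume z: "z \<in> fixed H \<inter> fixed_ring B conj_v"
  then have zM: "z \<in> M" and zH: "z \<in> fixed H" using fixed_M by auto
  have gz: "g z = z" using z conj_v_M[OF zM] unfolding fixed_ring_def by simp
  have pow: "(g [^]\<^bsub>G\<^esub> d) z = z" for d :: nat
    by (induction d) (use gz g_G zM in auto)
  show "z \<in> fixed H'"
  proof (rule fixedI[OF zM])
    fix f assume "f \<in> H'"
    from index(2)[OF this] obtain h d where "h \<in> H" "f = h \<otimes>\<^bsub>G\<^esub> g [^]\<^bsub>G\<^esub> (d::nat)" by blast
    then show "f z = z" using pow[of d] H_G g_G zM fixedD[OF zH] by simp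
  qed
qed

lemma subring_C_E: "subring (C H) E"
proof -
  interpret E: ring E by (rule subring_is_ring[OF subring_C])
  show ?thesis
    using E.ring_incl_imp_subring[of "C H"] C_mono[OF HH'] subring_is_ring[OF subring_C] by simp
qed

theorem step_iso: "iso_generalised_cyclic E (fixed H') B (fixed H) conj_v q (v [^] q)"
proof -
  interpret E: ring E by (rule subring_is_ring[OF subring_C])
  have pow: "v [^]\<^bsub>E\<^esub> (i::nat) = v [^] i" for i using nat_pow_consistent[of v i "C H'"] by simp
  have hom: "conj_v \<in> ring_hom B B" using conj_v_iso unfolding ring_iso_def by simp
  interpret ev: twisted_evaluation E "C H" conj_v v
  proof (intro twisted_evaluation.intro twisted_evaluation_axioms.intro E.ring_axioms)
    show "subring (C H) E" by (rule subring_C_E)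
    show "conj_v \<in> ring_hom (E\<lparr>carrier := C H\<rparr>) (E\<lparr>carrier := C H\<rparr>)" using hom by simp
    show "v \<in> carrier E" using v_C' by simp
    fix b assume b: "b \<in> C H"
    have "conj_v b \<otimes> v = v \<otimes> b \<otimes> (inv v \<otimes> v)"
      unfolding conj_v_def using v(3,4) C_carrier[OF b] by (simp only: m_assoc m_closed)
    then show "v \<otimes>\<^bsub>E\<^esub> b = conj_v b \<otimes>\<^bsub>E\<^esub> v" using v C_carrier[OF b] by simp
  qed
  have free: "E.free_family (C H) {..<q} (\<lambda>i. v [^]\<^bsub>E\<^esub> i)"
    using free_family_subring[OF subring_C, of "{..<q}" "\<lambda>i. v [^] i" H' "C H"] powers_C' C_mono[OF HH'] free_v
    unfolding pow by auto
  have span: "E.span_family (C H) {..<q} (\<lambda>i. v [^]\<^bsub>E\<^esub> i) = carrier E"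
    using span_family_subring[OF subring_C, of "{..<q}" "\<lambda>i. v [^] i" H' "C H"] powers_C' C_mono[OF HH'] span_v
    unfolding pow by auto
  have c: "v [^]\<^bsub>E\<^esub> q = v [^] q" by (rule pow)
  have inv: "right_invariant B conj_v (cyclic_poly B conj_v q (v [^] q))"
    using ev.right_invariant_cpoly[OF q_pos v_pow_C c free span] by simp
  have "\<exists>h\<in>ring_iso E (generalised_cyclic_algebra B conj_v q (v [^] q)). \<forall>z\<in>C H. h z = monomial B z 0"
    using ev.iso_generalised_cyclic_algebra[OF q_pos v_pow_C c free span] by simp
  moreover have "fixed H' \<subseteq> C H" using fixed_M M_subset_C by blast
  ultimately have iso: "\<exists>h\<in>ring_iso E (generalised_cyclic_algebra B conj_v q (v [^] q)). \<forall>z\<in>fixed H'. h z = monomial B z 0"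
    by blast
  have "central_simple_algebra B (fixed H)" using csa_C[OF subgroup_H] unfolding csa_degree_def by simp
  then have "generalised_cyclic_data B (fixed H) conj_v q (v [^] q)"
    unfolding generalised_cyclic_data_def
    using conj_v_iso order_conj_v v_pow_fixed_units inv by simp
  then show ?thesis unfolding iso_generalised_cyclic_def using fixed_H' iso by simp
qed

lemma conj_v_F: "x \<in> F \<Longrightarrow> conj_v x = x"
  using conj_v_M[of x] F_subset_M G_fixes[OF g_G] by auto

lemma C_strict: "C H \<subset> C H'"
proof
  show "C H \<subseteq> C H'" by (rule C_mono[OF HH'])
  show "C H \<noteq> C H'"
    using component_meets_C[OF subgroup_H g_G v(1)] v_C' u(2)[OF g_G] g_mem(2) by blast
qed

end

section \<open>The chain\<close>

theorem theorem8p11: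
  fixes A :: "('a, 'b) ring_scheme" and F M :: "'a set" and n k :: nat
    and G :: "('a \<Rightarrow> 'a) monoid" and Gs :: "nat \<Rightarrow> ('a \<Rightarrow> 'a) set"
    and q :: "nat \<Rightarrow> nat" and Z :: "nat \<Rightarrow> 'a set"
  assumes crossed: "crossed_product_algebra A F n M G"
    and maximal: "maximal_subfield A M"
    and nontrivial: "carrier G \<noteq> {\<one>\<^bsub>G\<^esub>}"
    and solvable: "solvable G"
    and chain_bot: "Gs 0 = {\<one>\<^bsub>G\<^esub>}"
    and chain_top: "Gs k = carrier G"
    and chain_subgroup: "\<And>j. j \<le> k \<Longrightarrow> subgroup (Gs j) G"
    and chain_strict: "\<And>j. j < k \<Longrightarrow> Gs j \<subset> Gs (Suc j)"
    and chain_normal: "\<And>j. j < k \<Longrightarrow> Gs j \<lhd> (G\<lparr>carrier := Gs (Suc j)\<rparr>)"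
    and chain_cyclic: "\<And>j. j < k \<Longrightarrow> cyclic_group ((G\<lparr>carrier := Gs (Suc j)\<rparr>) Mod Gs j)"
    and chain_order: "\<And>j. j < k \<Longrightarrow> order ((G\<lparr>carrier := Gs (Suc j)\<rparr>) Mod Gs j) = q j"
    and chain_prime: "\<And>j. j < k \<Longrightarrow> Factorial_Ring.prime (q j)"
    and Z: "\<And>i. i \<le> k \<Longrightarrow> Z i = fixed_field M (Gs i)"
  shows "\<exists>(As :: nat \<Rightarrow> 'a set) (\<tau> :: nat \<Rightarrow> 'a \<Rightarrow> 'a) (c :: nat \<Rightarrow> 'a) (\<sigma> :: nat \<Rightarrow> 'a \<Rightarrow> 'a).
      As 0 = M
    \<and> (\<forall>i<k. As i \<subset> As (Suc i))
    \<and> As k = centralizer A (fixed_field M (carrier G))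
    \<and> As k = carrier A
    \<and> (\<forall>i\<le>k. subring (As i) A \<and> F \<subseteq> As i)
    \<and> (\<forall>i<k.
          iso_generalised_cyclic (A\<lparr>carrier := As (Suc i)\<rparr>) (Z (Suc i))
            (A\<lparr>carrier := As i\<rparr>) (Z i) (\<tau> i) (q i) (c i)
        \<and> csa_degree (A\<lparr>carrier := As (Suc i)\<rparr>) (Z (Suc i)) (\<Prod>l\<in>{0..i}. q l)
        \<and> Factorial_Ring.prime (q i)
        \<and> \<tau> i \<in> ring_iso (A\<lparr>carrier := As i\<rparr>) (A\<lparr>carrier := As i\<rparr>)
        \<and> (\<forall>x\<in>F. \<tau> i x = x)
        \<and> has_inner_order (A\<lparr>carrier := As i\<rparr>) (\<tau> i) (q i)
        \<and> \<sigma> (Suc i) \<in> carrier G \<and> (\<forall>x\<in>M. \<tau> i x = \<sigma> (Suc i) x)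
        \<and> c i \<in> fixed_units (A\<lparr>carrier := As i\<rparr>) (\<tau> i))
    \<and> (\<forall>i\<in>{1..k}. subfield (Z i) A \<and> subfield (Z (i - 1)) A \<and> Z i \<subseteq> Z (i - 1)
        \<and> Factorial_Ring.prime (q (i - 1)) \<and> ring.dimension A (q (i - 1)) (Z i) (Z (i - 1)))
    \<and> (\<forall>i\<le>k. As i = centralizer A (fixed_field M (Gs i)))"
proof -
  have csa: "csa_degree A F n" and galois: "galois_extension A F M n" and G: "G = galois_group A F M"
    using crossed unfolding crossed_product_algebra_def by auto
  have ring: "ring A" using csa unfolding csa_degree_def central_simple_algebra_def by simp
  \<comment> \<open>The successive quotients have positive order, hence are finite; this makes the Galois group
    finite and computes the orders of the groups in the chain.\<close>
  have chain: "finite (Gs j) \<and> card (Gs j) = (\<Prod>l\<in>{0..<j}. q l)" if "j \<le> k" for j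
    using that
  proof (induction j)
    case 0
    then show ?case using chain_bot by simp
  next
    case (Suc j)
    then have j: "j < k" and IH: "finite (Gs j)" "card (Gs j) = (\<Prod>l\<in>{0..<j}. q l)" by auto
    interpret N: normal "Gs j" "G\<lparr>carrier := Gs (Suc j)\<rparr>" by (rule chain_normal[OF j])
    have index: "card (rcosets\<^bsub>G\<lparr>carrier := Gs (Suc j)\<rparr>\<^esub> Gs j) = q j"
      using chain_order[OF j] unfolding order_def FactGroup_def by simp
    moreover have "0 < q j" using chain_prime[OF j] prime_gt_0_nat by blast
    ultimately have "finite (rcosets\<^bsub>G\<lparr>carrier := Gs (Suc j)\<rparr>\<^esub> Gs j)" by (metis card_gt_0_iff)
    then have "finite (Gs (Suc j))"
      using N.finite_if_finite_index[OF N.subgroup_axioms IH(1)] by simp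
    moreover have "q j * card (Gs j) = card (Gs (Suc j))"
      using N.lagrange[OF N.subgroup_axioms] index unfolding order_def by simp
    ultimately show ?case using IH by (simp add: mult.commute)
  qed
  interpret crossed_product A F M n
    using ring galois csa chain[of k] chain_top
    unfolding crossed_product_def crossed_product_axioms_def galois_subfield_def galois_subfield_axioms_def G
    by simp
  have "\<forall>i. \<exists>g. i < k \<longrightarrow> g \<in> Gs (Suc i) \<and> g \<notin> Gs i" using chain_strict by blast
  then obtain g where g: "\<And>i. i < k \<Longrightarrow> g i \<in> Gs (Suc i) \<and> g i \<notin> Gs i" by metis
  have step: "prime_step A F M n (Gs i) (Gs (Suc i)) (q i) (g i)" if i: "i < k" for i
    using chain_subgroup[of i] chain_subgroup[of "Suc i"] chain_normal[OF i] chain_prime[OF i]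
      chain_order[OF i] g[OF i] i crossed_product_axioms
    unfolding prime_step_def prime_step_axioms_def G by simp
  note sub = chain_subgroup[unfolded G]
  let ?As = "\<lambda>i. C (Gs i)"
  let ?\<tau> = "\<lambda>i x. u (g i) \<otimes>\<^bsub>A\<^esub> x \<otimes>\<^bsub>A\<^esub> inv\<^bsub>A\<^esub> (u (g i))"
  let ?c = "\<lambda>i. u (g i) [^]\<^bsub>A\<^esub> q i"
  show ?thesis
  proof (rule exI[of _ ?As], rule exI[of _ ?\<tau>], rule exI[of _ ?c], rule exI[of _ "\<lambda>i. g (i - 1)"],
      intro conjI allI ballI impI)
    show "C (Gs 0) = M" unfolding chain_bot G by (rule C_one)
    show "C (Gs k) = centralizer A (fixed (carrier G))" unfolding chain_top ..
    show "C (Gs k) = carrier A" unfolding chain_top G by (rule C_G)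
  next
    fix i assume i: "i \<le> k"
    show "subring (C (Gs i)) A" by (rule subring_C)
    show "F \<subseteq> C (Gs i)" using F_subset_M M_subset_C by blast
  next
    fix i assume i: "i < k"
    interpret S: prime_step A F M n "Gs i" "Gs (Suc i)" "q i" "g i" by (rule step[OF i])
    have \<tau>: "?\<tau> i = S.conj_v" unfolding S.conj_v_def ..
    have Zi: "Z i = fixed (Gs i)" "Z (Suc i) = fixed (Gs (Suc i))" using Z i by auto
    show "C (Gs i) \<subset> C (Gs (Suc i))" by (rule S.C_strict)
    show "iso_generalised_cyclic (A\<lparr>carrier := C (Gs (Suc i))\<rparr>) (Z (Suc i))
        (A\<lparr>carrier := C (Gs i)\<rparr>) (Z i) (?\<tau> i) (q i) (?c i)"
      unfolding \<tau> Zi by (rule S.step_iso)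
    have "card (Gs (Suc i)) = (\<Prod>l\<in>{0..i}. q l)"
      using chain[of "Suc i"] i by (simp add: atLeastLessThanSuc_atLeastAtMost)
    then show "csa_degree (A\<lparr>carrier := C (Gs (Suc i))\<rparr>) (Z (Suc i)) (\<Prod>l\<in>{0..i}. q l)"
      unfolding Zi using csa_C[OF sub[of "Suc i"]] i by simp
    show "Factorial_Ring.prime (q i)" by (rule chain_prime[OF i])
    show "?\<tau> i \<in> ring_iso (A\<lparr>carrier := C (Gs i)\<rparr>) (A\<lparr>carrier := C (Gs i)\<rparr>)"
      unfolding \<tau> by (rule S.conj_v_iso)
    show "?\<tau> i x = x" if "x \<in> F" for x using S.conj_v_F[OF that] unfolding S.conj_v_def .
    show "has_inner_order (A\<lparr>carrier := C (Gs i)\<rparr>) (?\<tau> i) (q i)" unfolding \<tau> by (rule S.inner_order_conj_v)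
    show "g (Suc i - 1) \<in> carrier G" unfolding G using S.g_G by simp
    show "?\<tau> i x = g (Suc i - 1) x" if "x \<in> M" for x using S.conj_v_M[OF that] unfolding S.conj_v_def by simp
    show "?c i \<in> fixed_units (A\<lparr>carrier := C (Gs i)\<rparr>) (?\<tau> i)" unfolding \<tau> by (rule S.v_pow_fixed_units)
  next
    fix i assume i: "i \<in> {1..k}"
    then obtain j where j: "i = Suc j" "j < k" by (cases i) auto
    have Zi: "Z i = fixed (Gs i)" "Z (i - 1) = fixed (Gs (i - 1))" using Z i by auto
    have s: "subgroup (Gs i) G" "subgroup (Gs (i - 1)) G" using chain_subgroup i by auto
    show "subfield (Z i) A" "subfield (Z (i - 1)) A"
      unfolding Zi using s subgroup.subset unfolding G by (auto intro!: subfield_fixed)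
    have incl: "Gs j \<subseteq> Gs (Suc j)" using chain_strict[OF j(2)] by blast
    show "Z i \<subseteq> Z (i - 1)" unfolding Zi using fixed_antimono[OF incl] j by simp
    show "Factorial_Ring.prime (q (i - 1))" using chain_prime[OF j(2)] j by simp
    have "card (Gs (Suc j)) = q j * card (Gs j)" using chain[of j] chain[of "Suc j"] j by simp
    then show "ring.dimension A (q (i - 1)) (Z i) (Z (i - 1))"
      unfolding Zi using dimension_between_fixed[OF sub sub incl, of "q j"] j by simp
  qed simp
qed

end
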